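(* Every capped cubical polytope can be reconstructed from its dual graph. That is: if $P$ and $P'$ are capped cubical polytopes and $\varphi:\Delta_P\to\Delta_{P'}$ is an isomorphism of their dual graphs, then the bijection from the facets of $P$ to the facets of $P'$ given by $\varphi$ is induced by an isomorphism of the face lattices of $P$ and $P'$; in particular, $P$ and $P'$ are combinatorially equivalent.
   Context: A combinatorial cube is a polytope combinatorially equivalent to a cube. A $d$-polytope is cubical if each of its facets is a combinatorial $(d-1)$-cube. The dual graph $\Delta_P$ of a polytope $P$ is the vertex-edge graph of the dual polytope of $P$: its nodes are the facets of $P$, and two facets are adjacent if and only if their intersection is a ridge (a face of codimension $2$) of $P$. A cubical polytope $P$ is called capped over a cubical polytope $Q$ if there is a combinatorial cube $C$ such that $P=Q\cup C$ and $Q\cap C$ is a facet of $Q$. A cubical polytope is called capped if it is obtained by iterated capping starting with a combinatorial cube, i.e. there is a sequence $P_0,P_1,\dots,P_k=P$ ($k\ge 0$) of cubical polytopes such that $P_0$ is a combinatorial cube and $P_i$ is capped over $P_{i-1}$ for $i=1,\dots,k$. "Reconstructing" a polytope means determining its face lattice. *)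

theory Defs
  imports "HOL-Analysis.Analysis"
begin

text \<open>Faces include the empty face and the polytope itself, as they do for \<^term>\<open>(face_of)\<close>.\<close>

definition face_lattice_iso ::
    "('a::euclidean_space set \<Rightarrow> 'b::euclidean_space set) \<Rightarrow> 'a set \<Rightarrow> 'b set \<Rightarrow> bool" where
  "face_lattice_iso f P Q \<longleftrightarrow>
     bij_betw f {F. F face_of P} {F. F face_of Q} \<and>
     (\<forall>F G. F face_of P \<longrightarrow> G face_of P \<longrightarrow> (F \<subseteq> G \<longleftrightarrow> f F \<subseteq> f G))"

definition combinatorially_equivalent ::
    "'a::euclidean_space set \<Rightarrow> 'b::euclidean_space set \<Rightarrow> bool" where
  "combinatorially_equivalent P Q \<longleftrightarrow> (\<exists>f. face_lattice_iso f P Q)"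

text \<open>
  For \<open>B \<subseteq> Basis\<close>, the box \<open>cbox 0 (\<Sum>B)\<close> is the unit cube of dimension \<open>card B\<close>
  in the coordinate subspace spanned by \<open>B\<close>. A polytope in \<open>'a\<close> has dimension at most
  \<open>DIM('a)\<close>, so these are all the cubes needed; \<open>B = {}\<close> gives a point, the 0-cube.
\<close>

definition combinatorial_cube :: "'a::euclidean_space set \<Rightarrow> bool" where
  "combinatorial_cube C \<longleftrightarrow>
     polytope C \<and> (\<exists>B\<subseteq>(Basis :: 'a set). combinatorially_equivalent C (cbox 0 (\<Sum>B)))"

text \<open>
  Combinatorial equivalence preserves dimension, so a facet of a \<open>d\<close>-polytope that is a
  combinatorial cube is a combinatorial \<open>(d - 1)\<close>-cube.
\<close>

definition cubical_polytope :: "'a::euclidean_space set \<Rightarrow> bool" where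
  "cubical_polytope P \<longleftrightarrow> polytope P \<and> (\<forall>F. F facet_of P \<longrightarrow> combinatorial_cube F)"

definition capped_over :: "'a::euclidean_space set \<Rightarrow> 'a set \<Rightarrow> bool" where
  "capped_over P Q \<longleftrightarrow>
     cubical_polytope P \<and> cubical_polytope Q \<and>
     (\<exists>C. combinatorial_cube C \<and> P = Q \<union> C \<and> (Q \<inter> C) facet_of Q)"

definition capped_cubical_polytope :: "'a::euclidean_space set \<Rightarrow> bool" where
  "capped_cubical_polytope P \<longleftrightarrow>
     (\<exists>(k::nat) (p :: nat \<Rightarrow> 'a set).
        p k = P \<and> (\<forall>i\<le>k. cubical_polytope (p i)) \<and>
        combinatorial_cube (p 0) \<and> (\<forall>i<k. capped_over (p (Suc i)) (p i)))"

text \<open>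
  Since \<^prop>\<open>aff_dim {} = -1\<close>, the empty face is the ridge of a segment, whose two endpoints
  are therefore adjacent. In contrast, \<^term>\<open>(facet_of)\<close> excludes the empty face, so the dual
  graph of a point has no nodes.
\<close>

definition ridge_of :: "'a::euclidean_space set \<Rightarrow> 'a set \<Rightarrow> bool" where
  "ridge_of R P \<longleftrightarrow> R face_of P \<and> aff_dim R = aff_dim P - 2"

definition dual_nodes :: "'a::euclidean_space set \<Rightarrow> 'a set set" where
  "dual_nodes P = {F. F facet_of P}"

definition dual_adjacent :: "'a::euclidean_space set \<Rightarrow> 'a set \<Rightarrow> 'a set \<Rightarrow> bool" where
  "dual_adjacent P F G \<longleftrightarrow> F \<in> dual_nodes P \<and> G \<in> dual_nodes P \<and> ridge_of (F \<inter> G) P"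

definition dual_graph_iso ::
    "('a::euclidean_space set \<Rightarrow> 'b::euclidean_space set) \<Rightarrow> 'a set \<Rightarrow> 'b set \<Rightarrow> bool" where
  "dual_graph_iso \<phi> P P' \<longleftrightarrow>
     bij_betw \<phi> (dual_nodes P) (dual_nodes P') \<and>
     (\<forall>F\<in>dual_nodes P. \<forall>G\<in>dual_nodes P.
        dual_adjacent P F G \<longleftrightarrow> dual_adjacent P' (\<phi> F) (\<phi> G))"

end

theory Submission
  imports Defs
begin

text \<open>
  A polytope is determined up to combinatorial equivalence by its vertices, once each vertex is read as
  the set of facets containing it, its star (\<open>face_lattice_iso_of_stars\<close>). So a dual graph isomorphism
  is induced by a lattice isomorphism as soon as it maps stars to stars. In a cubical polytope of
  dimension \<open>d \<ge> 2\<close> every facet has \<open>2 * (d - 1)\<close> neighbours, one for each facet of a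
  \<open>(d - 1)\<close>-cube, so degrees tell low dimensions from high ones. In dimension 1 the stars are the single
  nodes and in dimension 2 they are the edges of the dual graph. From now on the dimension is at least 3.

  In the dual graph of a cube every node is adjacent to all others but its opposite, and the stars are
  the sets that contain one node of each opposite pair. Capping over a facet \<open>F\<close> with a cube removes the
  node \<open>F\<close> and adds a node \<open>F'\<close>, the facet opposite to \<open>F\<close> in the cube, together with one side for each
  neighbour of \<open>F\<close>; each side is adjacent to its neighbour of \<open>F\<close>, to \<open>F'\<close> and to all sides but one.
  The graph alone shows that \<open>F'\<close> might be the top of a cap: its neighbours are paired off as in a
  cube, and each of them has a single exit, a neighbour other than \<open>F'\<close> and its neighbours; these exits
  are distinct. Collapsing the sides onto \<open>F'\<close> undoes the cap, for the graph and for the stars, and the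
  stars can be recovered from the collapsed ones and the graph (\<open>star_determined_by_quot\<close>).

  The difficulty is that the same graph could arise from different sequences of caps. It is resolved by
  confluence: in any system built by capping, every node that looks like the top of a cap is one, and
  collapsing there stays in the class (\<open>capped_system_caps\<close>). Indeed two such nodes have disjoint closed
  neighbourhoods, so that the collapses commute, with one exception: two cubes glued along a facet,
  where collapsing at either end leaves a cube. Hence two systems of stars on the same graph can be
  collapsed at the same node, and they agree by induction (\<open>capped_system_unique\<close>).

  It remains to see that the facets, adjacencies and stars of a capped polytope form such a system. If
  \<open>P = Q \<union> C\<close> is capped over \<open>Q\<close>, the hyperplane of \<open>F = Q \<inter> C\<close> cuts \<open>P\<close> into \<open>Q\<close> and \<open>C\<close>. If no facet
  of \<open>P\<close> crosses the hyperplane, the facets of \<open>P\<close> are those of \<open>Q\<close> and \<open>C\<close> except \<open>F\<close>, and the two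
  systems are glued as described (\<open>capped_system_glue\<close>). But a facet of \<open>Q\<close> and a facet of \<open>C\<close> may lie in
  one hyperplane and merge into one crossing facet of \<open>P\<close>. Counting the facets of the three cubes
  involved shows that then the neighbours of the crossing facet cross as well, so that all facets of \<open>F\<close>
  come from crossing facets. Then no vertex of \<open>F\<close> is a vertex of \<open>P\<close>, and \<open>P\<close> is combinatorially
  equivalent to \<open>Q\<close> with \<open>F'\<close> in the role of \<open>F\<close> (\<open>system_crossing\<close>).
\<close>

section \<open>Graphs with stars that arise by capping\<close>

definition nb :: "('n \<Rightarrow> 'n \<Rightarrow> bool) \<Rightarrow> 'n \<Rightarrow> 'n set" where
  "nb E f = {x. E f x}"

definition graph_on :: "'n set \<Rightarrow> ('n \<Rightarrow> 'n \<Rightarrow> bool) \<Rightarrow> bool" where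
  "graph_on N E \<longleftrightarrow> finite N \<and> (\<forall>x y. E x y \<longrightarrow> x \<in> N \<and> y \<in> N \<and> x \<noteq> y \<and> E y x)"

text \<open>
  The dual graph of a cube whose opposite facets are exchanged by \<open>\<alpha>\<close>, with the family \<open>V\<close> of stars of
  its vertices.
\<close>

definition cube_with ::
    "('n \<Rightarrow> 'n) \<Rightarrow> 'n set \<Rightarrow> ('n \<Rightarrow> 'n \<Rightarrow> bool) \<Rightarrow> 'n set set \<Rightarrow> bool" where
  "cube_with \<alpha> N E V \<longleftrightarrow> finite N \<and>
     (\<forall>x\<in>N. \<alpha> x \<in> N \<and> \<alpha> x \<noteq> x \<and> \<alpha> (\<alpha> x) = x) \<and>
     (\<forall>x y. E x y \<longleftrightarrow> x \<in> N \<and> y \<in> N \<and> x \<noteq> y \<and> y \<noteq> \<alpha> x) \<and>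
     V = {S. S \<subseteq> N \<and> (\<forall>x\<in>N. x \<in> S \<longleftrightarrow> \<alpha> x \<notin> S)}"

text \<open>
  A candidate for the top of a cap, as far as the graph shows: the neighbours of \<open>f\<close> induce the dual graph
  of a cube, and each of them has one further neighbour, its exit. The bound 4 corresponds to dimension
  at least 3; for smaller neighbourhoods two candidates may overlap. In a cube with at least
  6 nodes every node qualifies, but there all exits of its neighbours coincide.
\<close>

definition cap_node :: "('n \<Rightarrow> 'n \<Rightarrow> bool) \<Rightarrow> 'n \<Rightarrow> bool" where
  "cap_node E f \<longleftrightarrow> 4 \<le> card (nb E f) \<and>
     (\<forall>x. E f x \<longrightarrow> (\<exists>!y. E f y \<and> y \<noteq> x \<and> \<not> E x y)) \<and>
     (\<forall>x. E f x \<longrightarrow> (\<exists>!y. E x y \<and> y \<noteq> f \<and> \<not> E f y))"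

definition exits_distinct :: "('n \<Rightarrow> 'n \<Rightarrow> bool) \<Rightarrow> 'n \<Rightarrow> bool" where
  "exits_distinct E f \<longleftrightarrow>
     (\<forall>x y z. E f x \<longrightarrow> E f y \<longrightarrow> E x z \<longrightarrow> E y z \<longrightarrow> z \<noteq> f \<longrightarrow> \<not> E f z \<longrightarrow> x = y)"

definition transversal :: "('n \<Rightarrow> 'n \<Rightarrow> bool) \<Rightarrow> 'n \<Rightarrow> 'n set \<Rightarrow> bool" where
  "transversal E f T \<longleftrightarrow> T \<subseteq> nb E f \<and>
     (\<forall>x y. E f x \<longrightarrow> E f y \<longrightarrow> y \<noteq> x \<longrightarrow> \<not> E x y \<longrightarrow> (x \<in> T \<longleftrightarrow> y \<notin> T))"

text \<open>
  What it means for the stars that \<open>f\<close> is the top of a cap: the stars through \<open>f\<close> are the vertices of the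
  top facet, and a star that meets the sides but not \<open>f\<close> is a vertex of the bottom, which lies on a side
  exactly if it lies on the exit of that side.
\<close>

definition caps :: "('n \<Rightarrow> 'n \<Rightarrow> bool) \<Rightarrow> 'n set set \<Rightarrow> 'n \<Rightarrow> bool" where
  "caps E V f \<longleftrightarrow>
     (\<forall>S. f \<in> S \<longrightarrow> (S \<in> V \<longleftrightarrow> transversal E f (S - {f}))) \<and>
     (\<forall>S. S \<in> V \<longrightarrow> f \<notin> S \<longrightarrow> S \<inter> nb E f \<noteq> {} \<longrightarrow> transversal E f (S \<inter> nb E f)) \<and>
     (\<forall>S x y. S \<in> V \<longrightarrow> f \<notin> S \<longrightarrow> S \<inter> nb E f \<noteq> {} \<longrightarrow>
        E f x \<longrightarrow> E x y \<longrightarrow> y \<noteq> f \<longrightarrow> \<not> E f y \<longrightarrow> (x \<in> S \<longleftrightarrow> y \<in> S))"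

text \<open>
  The node \<open>f\<close> itself takes over the role of the facet over which the cap was placed.
\<close>

definition collapse :: "('n \<Rightarrow> 'n \<Rightarrow> bool) \<Rightarrow> 'n \<Rightarrow> 'n \<Rightarrow> 'n" where
  "collapse E f x = (if E f x then f else x)"

definition graph_quot :: "('n \<Rightarrow> 'n \<Rightarrow> bool) \<Rightarrow> 'n \<Rightarrow> 'n \<Rightarrow> 'n \<Rightarrow> bool" where
  "graph_quot E f x y \<longleftrightarrow>
     x \<noteq> y \<and> (\<exists>x' y'. E x' y' \<and> collapse E f x' = x \<and> collapse E f y' = y)"

text \<open>
  The stars through \<open>f\<close> are left out, since these vertices disappear together with the cap.
\<close>

definition star_quot :: "('n \<Rightarrow> 'n \<Rightarrow> bool) \<Rightarrow> 'n set set \<Rightarrow> 'n \<Rightarrow> 'n set set" where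
  "star_quot E V f = (`) (collapse E f) ` {S \<in> V. f \<notin> S}"

text \<open>
  Capping is described backwards, by collapsing. In this form the smaller system lives on a subset of the
  nodes of the larger one, and its graph is determined by the larger graph and the node \<open>f\<close>.
\<close>

inductive capped_system :: "'n set \<Rightarrow> ('n \<Rightarrow> 'n \<Rightarrow> bool) \<Rightarrow> 'n set set \<Rightarrow> bool" where
  cube: "cube_with \<alpha> N E V \<Longrightarrow> 6 \<le> card N \<Longrightarrow> capped_system N E V"
| cap: "graph_on N E \<Longrightarrow> f \<in> N \<Longrightarrow> V \<subseteq> Pow N \<Longrightarrow> cap_node E f \<Longrightarrow> exits_distinct E f \<Longrightarrow> caps E V f
    \<Longrightarrow> capped_system (N - nb E f) (graph_quot E f) (star_quot E V f) \<Longrightarrow> capped_system N E V"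

lemma nb_iff [simp]: "x \<in> nb E f \<longleftrightarrow> E f x"
  by (simp add: nb_def)

lemma cube_adj: "cube_with \<alpha> N E V \<Longrightarrow> E x y \<longleftrightarrow> x \<in> N \<and> y \<in> N \<and> x \<noteq> y \<and> y \<noteq> \<alpha> x"
  and cube_opp: "cube_with \<alpha> N E V \<Longrightarrow> x \<in> N \<Longrightarrow> \<alpha> x \<in> N \<and> \<alpha> x \<noteq> x \<and> \<alpha> (\<alpha> x) = x"
  and cube_star: "cube_with \<alpha> N E V \<Longrightarrow> S \<in> V \<longleftrightarrow> S \<subseteq> N \<and> (\<forall>x\<in>N. x \<in> S \<longleftrightarrow> \<alpha> x \<notin> S)"
  and cube_finite: "cube_with \<alpha> N E V \<Longrightarrow> finite N"
  unfolding cube_with_def by simp_all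

lemma cube_graph: "cube_with \<alpha> N E V \<Longrightarrow> graph_on N E"
  unfolding cube_with_def graph_on_def by metis

lemma capped_system_graph: "capped_system N E V \<Longrightarrow> graph_on N E \<and> V \<subseteq> Pow N"
proof (induction rule: capped_system.induct)
  case (cube \<alpha> N E V)
  then show ?case using cube_graph[OF cube(1)] unfolding cube_with_def by blast
qed blast

lemma finite_nb: "graph_on N E \<Longrightarrow> finite (nb E f)"
  unfolding graph_on_def by (rule finite_subset[of _ N]) auto

lemma cap_node_mate: "cap_node E f \<Longrightarrow> E f x \<Longrightarrow> \<exists>!y. E f y \<and> y \<noteq> x \<and> \<not> E x y"
  and cap_node_exit: "cap_node E f \<Longrightarrow> E f x \<Longrightarrow> \<exists>!y. E x y \<and> y \<noteq> f \<and> \<not> E f y"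
  and cap_node_card: "cap_node E f \<Longrightarrow> 4 \<le> card (nb E f)"
  unfolding cap_node_def by simp_all

lemma exits_distinctD:
  "exits_distinct E f \<Longrightarrow> E f x \<Longrightarrow> E f y \<Longrightarrow> E x z \<Longrightarrow> E y z \<Longrightarrow> z \<noteq> f \<Longrightarrow> \<not> E f z \<Longrightarrow> x = y"
  unfolding exits_distinct_def by metis

lemma capsD1: "caps E V f \<Longrightarrow> f \<in> S \<Longrightarrow> S \<in> V \<longleftrightarrow> transversal E f (S - {f})"
  and capsD2: "caps E V f \<Longrightarrow> S \<in> V \<Longrightarrow> f \<notin> S \<Longrightarrow> S \<inter> nb E f \<noteq> {} \<Longrightarrow>
        E f x \<Longrightarrow> E x y \<Longrightarrow> y \<noteq> f \<Longrightarrow> \<not> E f y \<Longrightarrow> x \<in> S \<longleftrightarrow> y \<in> S"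
  and capsD3: "caps E V f \<Longrightarrow> S \<in> V \<Longrightarrow> f \<notin> S \<Longrightarrow> S \<inter> nb E f \<noteq> {} \<Longrightarrow> transversal E f (S \<inter> nb E f)"
  unfolding caps_def by simp_all

lemma pick_fourth:
  assumes "4 \<le> card A" shows "\<exists>z\<in>A. z \<noteq> a \<and> z \<noteq> b \<and> z \<noteq> c"
proof (rule ccontr)
  assume "\<not> ?thesis" then have "A \<subseteq> {a,b,c}" by auto
  then have "card A \<le> card {a,b,c}" by (intro card_mono) auto
  also have "\<dots> \<le> 3" by (simp add: card_insert_if)
  finally show False using assms by simp
qed

lemma cap_node_pick: "cap_node E f \<Longrightarrow> \<exists>x. E f x \<and> x \<noteq> a \<and> x \<noteq> b \<and> x \<noteq> c"
  using pick_fourth[OF cap_node_card, of E f a b c] unfolding Bex_def nb_iff .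

text \<open>
  If \<open>f\<close> were a neighbour of \<open>g\<close>, the exit of \<open>f\<close> would be a neighbour of \<open>f\<close> that is not adjacent to \<open>g\<close>,
  nor to any other neighbour of \<open>g\<close>, as exits are distinct; but it may miss only one neighbour of \<open>f\<close>. If
  \<open>z\<close> were a common neighbour, \<open>f\<close> would be the exit of \<open>z\<close>, and \<open>z\<close> would be adjacent to no other neighbour
  of \<open>f\<close>.
\<close>

lemma cap_nodes_far_apart:
  assumes G: "graph_on N E" and g: "cap_node E g" "exits_distinct E g" and f: "cap_node E f"
    and ne: "f \<noteq> g"
  shows "\<not> E g f" "nb E f \<inter> nb E g = {}"
proof -
  have sym: "\<And>x y. E x y \<Longrightarrow> E y x" and irr: "\<And>x. \<not> E x x" using G unfolding graph_on_def by auto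
  show nadj: "\<not> E g f"
  proof
    assume gf: "E g f"
    obtain u where u: "E f u" "u \<noteq> g" "\<not> E g u" using cap_node_exit[OF g(1) gf] by blast
    obtain b where b: "\<And>z. E g z \<Longrightarrow> z \<noteq> f \<Longrightarrow> \<not> E f z \<Longrightarrow> z = b"
      using cap_node_mate[OF g(1) gf] by blast
    obtain z where z: "E g z" "z \<noteq> f" "z \<noteq> b"
      using cap_node_pick[OF g(1), of f b b] by blast
    have fz: "E f z" using b z by blast
    have "\<not> E z u"
      using exits_distinctD[OF g(2) gf z(1) u(1) _ u(2,3)] z(2) by blast
    then have uz: "\<not> E u z" using sym by blast
    have ug: "\<not> E u g" using u(3) sym by blast
    have fg: "E f g" using gf sym by blast
    have gz: "g \<noteq> z" using z(1) irr by blast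
    have "z \<noteq> u" using z(1) u(3) by blast
    then show False using cap_node_mate[OF f u(1)] fz uz fg ug u(2) gz by blast
  qed
  show "nb E f \<inter> nb E g = {}"
  proof (rule ccontr)
    assume "\<not> ?thesis"
    then obtain z where z: "E f z" "E g z" by auto
    have zf: "E z f" using z sym by blast
    have iso: "\<not> E z y" if y: "E f y" for y
    proof
      assume zy: "E z y"
      have yg: "y \<noteq> g" using y nadj sym by blast
      have yf: "y \<noteq> f" using y irr by blast
      have gy: "E g y" using cap_node_exit[OF g(1) z(2)] zf ne nadj zy yg yf by blast
      have "E y f" using y sym by blast
      then have "y = z" using exits_distinctD[OF g(2) gy z(2) _ zf ne nadj] by blast
      then show False using zy irr by blast
    qed
    obtain b where "\<And>y. E f y \<Longrightarrow> y \<noteq> z \<Longrightarrow> \<not> E z y \<Longrightarrow> y = b"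
      using cap_node_mate[OF f z(1)] by blast
    with iso cap_node_pick[OF f, of z b b] show False by metis
  qed
qed

text \<open>
  Contracting the neighbourhood of \<open>g\<close> leaves the neighbourhood of \<open>f\<close> untouched when \<open>f\<close> is neither
  \<open>g\<close> nor a neighbour of \<open>g\<close> and the two have no common neighbour. The only change that \<open>f\<close> can
  notice is that an exit lying in the neighbourhood of \<open>g\<close> becomes \<open>g\<close>.
\<close>

context
  fixes N :: "'n set" and E :: "'n \<Rightarrow> 'n \<Rightarrow> bool" and f g :: 'n
  assumes G: "graph_on N E" and ne: "f \<noteq> g" and nadj: "\<not> E g f"
    and dis: "nb E f \<inter> nb E g = {}"
begin

lemma graph_sym: "E x y \<Longrightarrow> E y x" and graph_irrefl: "\<not> E x x" using G unfolding graph_on_def by auto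

lemma collapse_far: "collapse E g x = f \<longleftrightarrow> x = f"
  using nadj ne unfolding collapse_def by auto

lemma collapse_nb_far: "E f y \<Longrightarrow> collapse E g x = y \<longleftrightarrow> x = y"
  using dis nadj ne graph_sym unfolding collapse_def nb_def by auto

lemma quot_nb_far: "nb (graph_quot E g) f = nb E f"
proof -
  have "graph_quot E g f y \<longleftrightarrow> E f y" for y
  proof
    assume "graph_quot E g f y"
    then obtain y' where y': "E f y'" "collapse E g y' = y"
      unfolding graph_quot_def collapse_far by blast
    then have "y' = y" using collapse_nb_far[OF y'(1)] by (metis collapse_def dis disjoint_iff nb_iff)
    with y' show "E f y" by simp
  next
    assume "E f y"
    then show "graph_quot E g f y" unfolding graph_quot_def
      using collapse_far collapse_nb_far graph_irrefl by blast
  qed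
  then show ?thesis unfolding nb_def by auto
qed

lemma quot_adj_far: "graph_quot E g f y \<longleftrightarrow> E f y"
  using quot_nb_far unfolding nb_def by blast

lemma quot_nb_adj_far: "E f x \<Longrightarrow> E f y \<Longrightarrow> graph_quot E g x y \<longleftrightarrow> E x y"
  unfolding graph_quot_def by (simp add: collapse_nb_far) (use graph_irrefl in blast)

lemma quot_exit_far:
  assumes x: "E f x"
  shows "(graph_quot E g x z \<and> z \<noteq> f \<and> \<not> E f z) \<longleftrightarrow>
    (\<exists>z'. E x z' \<and> z' \<noteq> f \<and> \<not> E f z' \<and> z = collapse E g z')"
proof -
  have fg: "\<not> E f g" using nadj graph_sym by blast
  have gx: "x \<noteq> g" using fg x by blast
  have xg: "\<not> E g x" using dis x by auto
  have *: "graph_quot E g x z \<longleftrightarrow> x \<noteq> z \<and> (\<exists>z'. E x z' \<and> collapse E g z' = z)"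
    unfolding graph_quot_def collapse_nb_far[OF x] by blast
  have c1: "collapse E g z' = f \<longleftrightarrow> z' = f" for z' by (rule collapse_far)
  have c2: "E f (collapse E g z') \<longleftrightarrow> E f z'" for z'
    using fg dis unfolding collapse_def nb_def by auto
  have c3: "collapse E g z' \<noteq> x" if "E x z'" for z'
    using collapse_nb_far[OF x] graph_irrefl that by metis
  show ?thesis unfolding * using c1 c2 c3 by metis
qed

lemma quot_cap_node_far:
  assumes f: "cap_node E f" shows "cap_node (graph_quot E g) f"
  unfolding cap_node_def quot_nb_far quot_adj_far
proof (intro conjI allI impI)
  show "4 \<le> card (nb E f)" using cap_node_card[OF f] .
  fix x assume x: "E f x"
  show "\<exists>!y. E f y \<and> y \<noteq> x \<and> \<not> graph_quot E g x y"
    using cap_node_mate[OF f x] quot_nb_adj_far[OF x] by metis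
  obtain z' where z': "E x z'" "z' \<noteq> f" "\<not> E f z'" "\<And>w. E x w \<Longrightarrow> w \<noteq> f \<Longrightarrow> \<not> E f w \<Longrightarrow> w = z'"
    using cap_node_exit[OF f x] by blast
  show "\<exists>!y. graph_quot E g x y \<and> y \<noteq> f \<and> \<not> E f y"
    unfolding quot_exit_far[OF x]
  proof (rule ex1I)
    show "\<exists>z''. E x z'' \<and> z'' \<noteq> f \<and> \<not> E f z'' \<and> collapse E g z' = collapse E g z''"
      using z' by blast
    show "y = collapse E g z'"
      if "\<exists>z'. E x z' \<and> z' \<noteq> f \<and> \<not> E f z' \<and> y = collapse E g z'" for y
      using that z'(4) by blast
  qed
qed

lemma exits_distinct_of_quot:
  assumes "exits_distinct (graph_quot E g) f" shows "exits_distinct E f"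
  unfolding exits_distinct_def
proof (intro allI impI)
  fix x y z assume h: "E f x" "E f y" "E x z" "E y z" "z \<noteq> f" "\<not> E f z"
  let ?z = "collapse E g z"
  have 1: "graph_quot E g x ?z \<and> ?z \<noteq> f \<and> \<not> E f ?z"
    unfolding quot_exit_far[OF h(1)] using h by blast
  have 2: "graph_quot E g y ?z \<and> ?z \<noteq> f \<and> \<not> E f ?z"
    unfolding quot_exit_far[OF h(2)] using h by blast
  show "x = y"
    using exits_distinctD[OF assms, of x y ?z] 1 2 h(1,2) unfolding quot_adj_far by blast
qed

end

lemma quot_commute:
  assumes G: "graph_on N E" and ne: "f \<noteq> g" and nadj: "\<not> E g f" and dis: "nb E f \<inter> nb E g = {}"
  shows "graph_quot (graph_quot E g) f = graph_quot (graph_quot E f) g"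
proof -
  have nadj': "\<not> E f g" using G nadj unfolding graph_on_def by blast
  have cf: "collapse (graph_quot E g) f = collapse E f"
    unfolding collapse_def using quot_adj_far[OF G ne nadj dis] by auto
  have cg: "collapse (graph_quot E f) g = collapse E g"
    unfolding collapse_def using quot_adj_far[OF G ne[symmetric] nadj'] dis by (auto simp: Int_commute)
  have comm: "collapse E f (collapse E g x) = collapse E g (collapse E f x)" for x
    using ne nadj nadj' dis unfolding collapse_def nb_def by auto
  have *: "graph_quot (graph_quot E a) b x y \<longleftrightarrow> x \<noteq> y \<and>
      (\<exists>x' y'. E x' y' \<and> collapse E b (collapse E a x') = x \<and> collapse E b (collapse E a y') = y)"
    if "collapse (graph_quot E a) b = collapse E b" for a b x y
    unfolding graph_quot_def[of "graph_quot E a"] that unfolding graph_quot_def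
  proof (intro conj_cong refl iffI)
    assume xy: "x \<noteq> y"
    assume "\<exists>x' y'. E x' y' \<and> collapse E b (collapse E a x') = x \<and> collapse E b (collapse E a y') = y"
    then obtain x' y' where h: "E x' y'" "collapse E b (collapse E a x') = x" "collapse E b (collapse E a y') = y"
      by blast
    then have "collapse E a x' \<noteq> collapse E a y'" using xy by metis
    with h show "\<exists>x' y'. (x' \<noteq> y' \<and> (\<exists>u w. E u w \<and> collapse E a u = x' \<and> collapse E a w = y')) \<and>
        collapse E b x' = x \<and> collapse E b y' = y" by blast
  qed auto
  show ?thesis by (intro ext) (simp add: *[OF cf] *[OF cg] comm)
qed


lemma star_quot_commute:
  assumes G: "graph_on N E" and ne: "f \<noteq> g" and nadj: "\<not> E g f" and dis: "nb E f \<inter> nb E g = {}"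
  shows "star_quot (graph_quot E g) (star_quot E V g) f = star_quot (graph_quot E f) (star_quot E V f) g"
proof -
  have nadj': "\<not> E f g" using G nadj unfolding graph_on_def by blast
  have dis': "nb E g \<inter> nb E f = {}" using dis by blast
  have cf: "collapse (graph_quot E g) f = collapse E f"
    unfolding collapse_def using quot_adj_far[OF G ne nadj dis] by auto
  have cg: "collapse (graph_quot E f) g = collapse E g"
    unfolding collapse_def using quot_adj_far[OF G ne[symmetric] nadj' dis'] by auto
  have comm: "collapse E f ` collapse E g ` S = collapse E g ` collapse E f ` S" for S
    using ne nadj nadj' dis unfolding collapse_def nb_def image_image by (intro image_cong) auto
  have mf: "f \<notin> collapse E g ` S \<longleftrightarrow> f \<notin> S" for S
    using collapse_far[OF G ne nadj dis] by (metis image_iff)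
  have mg: "g \<notin> collapse E f ` S \<longleftrightarrow> g \<notin> S" for S
    using collapse_far[OF G ne[symmetric] nadj' dis'] by (metis image_iff)
  have "star_quot (graph_quot E g) (star_quot E V g) f =
      (\<lambda>S. collapse E f ` collapse E g ` S) ` {S \<in> V. f \<notin> S \<and> g \<notin> S}"
    unfolding star_quot_def cf using mf by auto
  also have "\<dots> = (\<lambda>S. collapse E g ` collapse E f ` S) ` {S \<in> V. f \<notin> S \<and> g \<notin> S}"
    unfolding comm by simp
  also have "\<dots> = star_quot (graph_quot E f) (star_quot E V f) g"
    unfolding star_quot_def cg using mg by auto
  finally show ?thesis .
qed

lemma graph_on_quot:
  assumes G: "graph_on N E" and f: "f \<in> N" shows "graph_on (N - nb E f) (graph_quot E f)"
proof -
  have c: "collapse E f x \<in> N - nb E f" if "x \<in> N" for x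
    using that f G unfolding collapse_def graph_on_def by auto
  have sym: "\<And>x y. E x y \<Longrightarrow> E y x" and N: "\<And>x y. E x y \<Longrightarrow> x \<in> N \<and> y \<in> N"
    using G unfolding graph_on_def by auto
  show ?thesis unfolding graph_on_def
  proof (intro conjI allI impI)
    show "finite (N - nb E f)" using G unfolding graph_on_def by auto
    fix x y assume "graph_quot E f x y"
    then obtain x' y' where h: "x \<noteq> y" "E x' y'" "collapse E f x' = x" "collapse E f y' = y"
      unfolding graph_quot_def by blast
    show "x \<in> N - nb E f" "y \<in> N - nb E f" using c h N by metis+
    show "x \<noteq> y" using h by simp
    show "graph_quot E f y x" unfolding graph_quot_def using h sym by metis
  qed
qed

lemma collapse_image:
  assumes "\<not> E f f" "f \<notin> S"
  shows "y \<in> collapse E f ` S \<longleftrightarrow> (if y = f then S \<inter> nb E f \<noteq> {} else y \<in> S \<and> \<not> E f y)"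
  using assms unfolding collapse_def nb_def by auto

lemma collapse_image_away: "S \<inter> nb E f = {} \<Longrightarrow> collapse E f ` S = S"
  unfolding collapse_def nb_def by force

text \<open>
  A collapsed star shows whether the star meets the sides, and if so, the exits it contains show which
  sides it contains.
\<close>

lemma star_determined_by_quot:
  assumes G: "graph_on N E" and f: "cap_node E f" and c: "caps E V f" "caps E V' f"
    and eq: "star_quot E V f = star_quot E V' f"
  shows "V \<subseteq> V'"
proof
  fix S assume S: "S \<in> V"
  have irr: "\<not> E f f" using G unfolding graph_on_def by blast
  show "S \<in> V'"
  proof (cases "f \<in> S")
    case True then show ?thesis using S capsD1[OF c(1)] capsD1[OF c(2)] by blast
  next
    case False
    then have "collapse E f ` S \<in> star_quot E V f" using S unfolding star_quot_def by simp
    then have "collapse E f ` S \<in> star_quot E V' f" unfolding eq .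
    then obtain S' where S': "S' \<in> V'" "f \<notin> S'" and im: "collapse E f ` S = collapse E f ` S'"
      unfolding star_quot_def by auto
    have out: "y \<in> S \<longleftrightarrow> y \<in> S'" if "y \<noteq> f" "\<not> E f y" for y
      using collapse_image[of E f S y, OF irr False] collapse_image[of E f S' y, OF irr S'(2)] im that by auto
    have meet: "S \<inter> nb E f \<noteq> {} \<longleftrightarrow> S' \<inter> nb E f \<noteq> {}"
      using collapse_image[of E f S f, OF irr False] collapse_image[of E f S' f, OF irr S'(2)] im by auto
    have inn: "x \<in> S \<longleftrightarrow> x \<in> S'" if x: "E f x" for x
    proof (cases "S \<inter> nb E f = {}")
      case True then show ?thesis using meet x by auto
    next
      case m: False
      obtain y where y: "E x y" "y \<noteq> f" "\<not> E f y" using cap_node_exit[OF f x] by blast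
      show ?thesis
        using capsD2[OF c(1) S False m x y] capsD2[OF c(2) S' _ x y] m meet out y by auto
    qed
    have "S = S'" using out inn False S'(2) by (intro set_eqI) metis
    then show ?thesis using S' by simp
  qed
qed

text \<open>
  In a cube the opposite of \<open>f\<close> is the exit of every neighbour of \<open>f\<close>.
\<close>

lemma cube_cap_node:
  assumes cube: "cube_with \<alpha> N E V" and f: "cap_node E f"
  shows "\<not> exits_distinct E f"
proof
  assume d: "exits_distinct E f"
  have e: "\<And>x y. E x y \<longleftrightarrow> x \<in> N \<and> y \<in> N \<and> x \<noteq> y \<and> y \<noteq> \<alpha> x"
    and a: "\<And>x. x \<in> N \<Longrightarrow> \<alpha> x \<in> N \<and> \<alpha> x \<noteq> x \<and> \<alpha> (\<alpha> x) = x"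
    using cube_adj[OF cube] cube_opp[OF cube] by auto
  obtain x where x: "E f x" using cap_node_pick[OF f, of f f f] by blast
  obtain y where y: "E f y" "y \<noteq> x" using cap_node_pick[OF f, of x x x] by blast
  have "E x (\<alpha> f)" "E y (\<alpha> f)" "\<alpha> f \<noteq> f" "\<not> E f (\<alpha> f)" using x y a unfolding e by metis+
  then show False using exits_distinctD[OF d x y(1)] y(2) by blast
qed

text \<open>
  Outside a cube the exits are distinct. If collapsing at the last cap \<open>g\<close> leaves a cube, all exits of the
  neighbours of \<open>f\<close> become \<open>g\<close>; so they are neighbours of \<open>g\<close>, and distinct since each of these has only
  one exit in turn. Otherwise the exits are distinct after the collapse already.
\<close>

lemma capped_system_cap_node:
  assumes "capped_system N E V" "cap_node E f"
  shows "(\<exists>\<alpha>. cube_with \<alpha> N E V) \<or> exits_distinct E f"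
  using assms
proof (induction rule: capped_system.induct)
  case (cube \<alpha> N E V)
  then show ?case by blast
next
  case (cap N E g V)
  show ?case
  proof (cases "f = g")
    case True then show ?thesis using cap by simp
  next
    case ne: False
    note G = cap(1)
    note far = cap_nodes_far_apart[OF G cap(4,5) cap.prems ne]
    have sym: "\<And>x y. E x y \<Longrightarrow> E y x" and irr: "\<And>x. \<not> E x x" using G unfolding graph_on_def by auto
    note ctx = G ne far
    have "(\<exists>\<alpha>. cube_with \<alpha> (N - nb E g) (graph_quot E g) (star_quot E V g)) \<or> exits_distinct (graph_quot E g) f"
      using cap.IH quot_cap_node_far[OF ctx cap.prems] by blast
    then show ?thesis
    proof
      assume "exits_distinct (graph_quot E g) f"
      then show ?thesis using exits_distinct_of_quot[OF ctx] by blast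
    next
      assume "\<exists>\<alpha>. cube_with \<alpha> (N - nb E g) (graph_quot E g) (star_quot E V g)"
      then obtain \<alpha> where "cube_with \<alpha> (N - nb E g) (graph_quot E g) (star_quot E V g)" ..
      note e = cube_adj[OF this]
      have fN: "f \<in> N - nb E g"
      proof -
        obtain x where "E f x" using cap_node_pick[OF cap.prems, of f f f] by blast
        then show ?thesis using G far unfolding graph_on_def by auto
      qed
      have gN: "g \<in> N - nb E g" using cap irr by auto
      have g: "g = \<alpha> f" using e[of f g] quot_adj_far[OF ctx, of g] fN gN ne far sym by blast
      have "exits_distinct E f" unfolding exits_distinct_def
      proof (intro allI impI)
        fix x y z assume h: "E f x" "E f y" "E x z" "E y z" "z \<noteq> f" "\<not> E f z"
        have xg: "x \<noteq> g" "\<not> E g x" "y \<noteq> g" "\<not> E g y" using h far sym by auto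
        have "graph_quot E g x (collapse E g z) \<and> collapse E g z \<noteq> f \<and> \<not> E f (collapse E g z)"
          unfolding quot_exit_far[OF ctx h(1)] using h by blast
        then have "collapse E g z = \<alpha> f"
          using e[of f "collapse E g z"] e[of x "collapse E g z"] quot_adj_far[OF ctx, of "collapse E g z"] fN by auto
        then have "z = g \<or> E g z" using g unfolding collapse_def by (auto split: if_splits)
        then have "E g z" using h(3) xg sym by blast
        from cap_node_exit[OF cap(4) this] show "x = y" using h xg sym by blast
      qed
      then show ?thesis ..
    qed
  qed
qed


text \<open>
  Choose, from each opposite pair that \<open>A\<close> leaves open, the element picked by a fixed choice function.
\<close>

lemma cube_star_through:
  assumes cube: "cube_with \<alpha> N E V" and A: "A \<subseteq> N" "\<And>x. x \<in> A \<Longrightarrow> \<alpha> x \<notin> A"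
  shows "\<exists>S\<in>V. A \<subseteq> S"
proof
  define r where "r w = (SOME u. u \<in> {w, \<alpha> w})" for w
  define S where "S = {w \<in> N. w \<in> A \<or> (\<alpha> w \<notin> A \<and> r w = w)}"
  note opp = cube_opp[OF cube]
  have r1: "r w \<in> {w, \<alpha> w}" for w unfolding r_def by (rule someI_ex) blast
  have r2: "r (\<alpha> w) = r w" if "w \<in> N" for w
    using opp[OF that] unfolding r_def by (simp add: insert_commute)
  have "w \<in> S \<longleftrightarrow> \<alpha> w \<notin> S" if w: "w \<in> N" for w
  proof -
    have a: "\<alpha> w \<in> N" "\<alpha> w \<noteq> w" "\<alpha> (\<alpha> w) = w" using opp[OF w] by auto
    show ?thesis
    proof (cases "w \<in> A \<or> \<alpha> w \<in> A")
      case True then show ?thesis using A(2)[of w] a w unfolding S_def by auto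
    next
      case False then show ?thesis using a w r1[of w] r2[OF w] unfolding S_def by auto
    qed
  qed
  then show "S \<in> V" unfolding cube_star[OF cube] unfolding S_def by blast
  show "A \<subseteq> S" using A(1) unfolding S_def by blast
qed

section \<open>Every node that looks like a cap can be collapsed\<close>

lemma transversal_quot_far:
  assumes "graph_on N E" "f \<noteq> g" "\<not> E g f" "nb E f \<inter> nb E g = {}"
  shows "transversal (graph_quot E g) f T \<longleftrightarrow> transversal E f T"
  unfolding transversal_def quot_nb_far[OF assms] quot_adj_far[OF assms]
  using quot_nb_adj_far[OF assms] by auto

lemma transversal_sub: "transversal E f T \<Longrightarrow> T \<subseteq> nb E f"
  unfolding transversal_def by simp

lemma capsI:
  assumes "\<And>S. f \<in> S \<Longrightarrow> S \<in> V \<longleftrightarrow> transversal E f (S - {f})"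
    and "\<And>S. S \<in> V \<Longrightarrow> f \<notin> S \<Longrightarrow> S \<inter> nb E f \<noteq> {} \<Longrightarrow> transversal E f (S \<inter> nb E f)"
    and "\<And>S x y. S \<in> V \<Longrightarrow> f \<notin> S \<Longrightarrow> S \<inter> nb E f \<noteq> {} \<Longrightarrow> E f x \<Longrightarrow> E x y \<Longrightarrow> y \<noteq> f \<Longrightarrow> \<not> E f y \<Longrightarrow>
      x \<in> S \<longleftrightarrow> y \<in> S"
  shows "caps E V f"
  unfolding caps_def using assms by simp

lemma star_quotI: "S \<in> V \<Longrightarrow> f \<notin> S \<Longrightarrow> S' = collapse E f ` S \<Longrightarrow> S' \<in> star_quot E V f"
  unfolding star_quot_def by simp

text \<open>
  The confluence step. By induction along the caps, let \<open>g\<close> be the top of the last one. The neighbourhoods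
  of \<open>f\<close> and \<open>g\<close> are far apart, so \<open>f\<close> is still a cap node after collapsing at \<open>g\<close>. If the result is not a
  cube, the induction hypothesis and commutation of the two collapses give the claim; the point to check
  is that both descriptions of the stars survive even if an edge joins a side of \<open>f\<close> to a side of \<open>g\<close>.
  If the result is a cube, then \<open>f\<close> is the opposite of \<open>g\<close> in it, and collapsing at \<open>f\<close> instead gives
  another cube, whose opposite pairs are \<open>f, g\<close> and the pairs of neighbours of \<open>g\<close>.
\<close>

lemma capped_system_caps:
  assumes "capped_system N E V" "cap_node E f" "exits_distinct E f"
  shows "caps E V f \<and> capped_system (N - nb E f) (graph_quot E f) (star_quot E V f)"
  using assms
proof (induction rule: capped_system.induct)
  case (cube \<alpha> N E V)
  then show ?case using cube_cap_node by metis
next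
  case (cap N E g V)
  show ?case
  proof (cases "f = g")
    case True then show ?thesis using cap by simp
  next
    case ne: False
    note G = cap(1) and fcap = cap.prems(1) and fdist = cap.prems(2) and gcap = cap(4) and gdist = cap(5)
      and W = cap(6)
    note far = cap_nodes_far_apart[OF G gcap gdist fcap ne]
    have sym: "\<And>x y. E x y \<Longrightarrow> E y x" and irr: "\<And>x. \<not> E x x" using G unfolding graph_on_def by auto
    note ctx = G ne far
    have far': "\<not> E f g" "nb E g \<inter> nb E f = {}" using far sym by auto
    note ctx' = G ne[symmetric] far'
    have disj: "\<And>x. E f x \<Longrightarrow> \<not> E g x" using far(2) by auto
    let ?E = "graph_quot E g" and ?N = "N - nb E g" and ?V = "star_quot E V g"
    have fN: "f \<in> N" "\<And>x. E f x \<Longrightarrow> x \<in> N" "\<And>x. E g x \<Longrightarrow> x \<in> N"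
      using G cap_node_pick[OF fcap, of f f f] unfolding graph_on_def by blast+
    have fcap': "cap_node ?E f" using quot_cap_node_far[OF ctx fcap] .
    have Vsub: "V \<subseteq> Pow N" by (fact cap(3))
    have near_g: "S - {g} \<subseteq> nb E g" if "S \<in> V" "g \<in> S" for S
      using that capsD1[OF W that(2)] transversal_sub by metis
    have near_g': "S \<inter> nb E f = {}" "f \<notin> S" if "S \<in> V" "g \<in> S" for S
    proof -
      show "S \<inter> nb E f = {}" using near_g[OF that] disj far'(1) by auto
      show "f \<notin> S" using near_g[OF that] ne far(1) by auto
    qed
    have cimg: "y \<in> collapse E g ` S \<longleftrightarrow> (if y = g then S \<inter> nb E g \<noteq> {} else y \<in> S \<and> \<not> E g y)"
      if "g \<notin> S" for S y using collapse_image[OF irr that] .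
    have quotV: "S' \<in> ?V \<longleftrightarrow> (\<exists>S. S \<in> V \<and> g \<notin> S \<and> S' = collapse E g ` S)" for S'
      unfolding star_quot_def by auto
    have cimgf: "y \<in> collapse E f ` S \<longleftrightarrow> (if y = f then S \<inter> nb E f \<noteq> {} else y \<in> S \<and> \<not> E f y)"
      if "f \<notin> S" for S y using collapse_image[OF irr that] .
    show ?thesis
    proof (cases "exits_distinct ?E f")
      case True
      from cap.IH[OF fcap' True]
      have Wf: "caps ?E ?V f" and Kf: "capped_system (?N - nb ?E f) (graph_quot ?E f) (star_quot ?E ?V f)" by auto
      have D1: "S \<in> V \<longleftrightarrow> transversal E f (S - {f})" if fS: "f \<in> S" for S
      proof
        assume S: "S \<in> V"
        then have g: "g \<notin> S" using near_g' fS by blast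
        have fS': "f \<in> collapse E g ` S" using cimg[OF g] fS ne far by auto
        have "collapse E g ` S \<in> ?V" using quotV S g by blast
        then have T: "transversal E f (collapse E g ` S - {f})"
          using capsD1[OF Wf fS'] transversal_quot_far[OF ctx] by blast
        then have "g \<notin> collapse E g ` S" using transversal_sub far' ne by fastforce
        then have "S \<inter> nb E g = {}" using cimg[OF g, of g] by auto
        then show "transversal E f (S - {f})" using T collapse_image_away by metis
      next
        assume T: "transversal E f (S - {f})"
        then have S: "S \<in> ?V" using capsD1[OF Wf fS] transversal_quot_far[OF ctx] by blast
        have gS: "g \<notin> S" using transversal_sub[OF T] far' ne by auto
        obtain S0 where S0: "S0 \<in> V" "g \<notin> S0" "S = collapse E g ` S0" using S quotV by blast
        then have "S0 \<inter> nb E g = {}" using gS cimg[OF S0(2), of g] by auto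
        then show "S \<in> V" using S0 collapse_image_away by metis
      qed
      have qadj: "?E x (collapse E g y) \<and> collapse E g y \<noteq> f \<and> \<not> E f (collapse E g y)"
        if "E f x" "E x y" "y \<noteq> f" "\<not> E f y" for x y
        unfolding quot_exit_far[OF ctx that(1)] using that by blast
      have inS: "x \<in> S \<longleftrightarrow> collapse E g y \<in> collapse E g ` S"
        if S: "S \<in> V" "f \<notin> S" "S \<inter> nb E f \<noteq> {}" and x: "E f x" and y: "E x y" "y \<noteq> f" "\<not> E f y" for S x y
      proof -
        have g: "g \<notin> S" using near_g' S by blast
        have S': "collapse E g ` S \<in> ?V" using quotV S g by blast
        have f': "f \<notin> collapse E g ` S" using cimg[OF g] S(2) ne by auto
        have same: "x' \<in> collapse E g ` S \<longleftrightarrow> x' \<in> S" if "E f x'" for x'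
          using cimg[OF g, of x'] that disj far'(1) by auto
        have m: "collapse E g ` S \<inter> nb ?E f \<noteq> {}"
          using S(3) same unfolding quot_nb_far[OF ctx] disjoint_iff by (metis nb_iff)
        from qadj[OF x y] have "?E x (collapse E g y)" "collapse E g y \<noteq> f" "\<not> ?E f (collapse E g y)"
          unfolding quot_adj_far[OF ctx] by auto
        from capsD2[OF Wf S' f' m _ this] x same[OF x] show ?thesis
          unfolding quot_adj_far[OF ctx] by blast
      qed
      have D2: "x \<in> S \<longleftrightarrow> y \<in> S"
        if S: "S \<in> V" "f \<notin> S" "S \<inter> nb E f \<noteq> {}" and x: "E f x" and y: "E x y" "y \<noteq> f" "\<not> E f y" for S x y
      proof -
        have g: "g \<notin> S" using near_g' S by blast
        have yg: "y \<noteq> g" using y x disj sym by blast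
        have xg: "x \<noteq> g" "\<not> E g x" using x far' disj by auto
        note i = inS[OF S x y]
        show ?thesis
        proof (cases "E g y")
          case False
          then show ?thesis using i cimg[OF g, of y] yg unfolding collapse_def by auto
        next
          case True
          then have i': "x \<in> S \<longleftrightarrow> S \<inter> nb E g \<noteq> {}" using i cimg[OF g, of g] unfolding collapse_def by auto
          have "y \<in> S \<longleftrightarrow> x \<in> S" if "S \<inter> nb E g \<noteq> {}"
            using capsD2[OF W S(1) g that True _ xg] y(1) sym by blast
          then show ?thesis using i' True by auto
        qed
      qed
      have D3: "transversal E f (S \<inter> nb E f)" if S: "S \<in> V" "f \<notin> S" "S \<inter> nb E f \<noteq> {}" for S
      proof -
        have g: "g \<notin> S" using near_g' S by blast
        have S': "collapse E g ` S \<in> ?V" using quotV S g by blast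
        have f': "f \<notin> collapse E g ` S" using cimg[OF g] S(2) ne by auto
        have same: "x' \<in> collapse E g ` S \<longleftrightarrow> x' \<in> S" if "E f x'" for x'
          using cimg[OF g, of x'] that disj far'(1) by auto
        have "collapse E g ` S \<inter> nb ?E f = S \<inter> nb E f"
          using same unfolding quot_nb_far[OF ctx] by (intro set_eqI) (metis IntD1 IntD2 IntI nb_iff)
        then show ?thesis
          using capsD3[OF Wf S' f'] S(3) unfolding transversal_quot_far[OF ctx] by simp
      qed
      have caps_f: "caps E V f" by (rule capsI) (fact D1 D2 D3)+
      have caps_g: "caps (graph_quot E f) (star_quot E V f) g"
        unfolding caps_def quot_adj_far[OF ctx'] transversal_quot_far[OF ctx'] quot_nb_far[OF ctx']
      proof (intro conjI allI impI)
        fix S' assume g: "g \<in> S'"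
        show "S' \<in> star_quot E V f \<longleftrightarrow> transversal E g (S' - {g})"
        proof
          assume "S' \<in> star_quot E V f"
          then obtain S where S: "S \<in> V" "f \<notin> S" "S' = collapse E f ` S" unfolding star_quot_def by auto
          have gS: "g \<in> S" using g S(3) cimgf[OF S(2), of g] ne by auto
          have "S' = S" using near_g'(1)[OF S(1) gS] collapse_image_away S(3) by metis
          then show "transversal E g (S' - {g})" using capsD1[OF W gS] S(1) by blast
        next
          assume T: "transversal E g (S' - {g})"
          then have S: "S' \<in> V" using capsD1[OF W g] by blast
          show "S' \<in> star_quot E V f"
            using star_quotI[OF S near_g'(2)[OF S g] collapse_image_away[OF near_g'(1)[OF S g], symmetric]] .
        qed
      next
        fix S' assume S': "S' \<in> star_quot E V f" "g \<notin> S'" "S' \<inter> nb E g \<noteq> {}"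
        obtain S where S: "S \<in> V" "f \<notin> S" "S' = collapse E f ` S" using S'(1) unfolding star_quot_def by auto
        have g: "g \<notin> S" using S'(2) S(3) cimgf[OF S(2), of g] ne far'(1) by auto
        have "x' \<in> S' \<longleftrightarrow> x' \<in> S" if "E g x'" for x'
          using cimgf[OF S(2), of x'] S(3) that disj far(1) by auto
        then have "S' \<inter> nb E g = S \<inter> nb E g" by auto
        then show "transversal E g (S' \<inter> nb E g)" using capsD3[OF W S(1) g] S'(3) by simp
      next
        fix S' z w
        assume S': "S' \<in> star_quot E V f" "g \<notin> S'" "S' \<inter> nb E g \<noteq> {}" and z: "E g z"
          and w: "graph_quot E f z w" "w \<noteq> g" "\<not> E g w"
        obtain S where S: "S \<in> V" "f \<notin> S" "S' = collapse E f ` S" using S'(1) unfolding star_quot_def by auto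
        have g: "g \<notin> S" using S'(2) S(3) cimgf[OF S(2), of g] ne far'(1) by auto
        have same: "x' \<in> S' \<longleftrightarrow> x' \<in> S" if "E g x'" for x'
          using cimgf[OF S(2), of x'] S(3) that disj far(1) by auto
        have m: "S \<inter> nb E g \<noteq> {}" using S'(3) same by auto
        obtain y where y: "E z y" "y \<noteq> g" "\<not> E g y" "w = collapse E f y"
          using quot_exit_far[OF ctx' z, of w] w by blast
        have zy: "z \<in> S \<longleftrightarrow> y \<in> S" using capsD2[OF W S(1) g m z y(1,2,3)] .
        have yf: "y \<noteq> f" using y z disj sym by blast
        have zf: "z \<noteq> f" "\<not> E f z" using z far disj by auto
        show "z \<in> S' \<longleftrightarrow> w \<in> S'"
        proof (cases "E f y")
          case False
          then show ?thesis using zy same[OF z] y(4) yf cimgf[OF S(2), of y] S(3) unfolding collapse_def by auto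
        next
          case True
          then have wf: "w = f" using y(4) unfolding collapse_def by simp
          have w': "w \<in> S' \<longleftrightarrow> S \<inter> nb E f \<noteq> {}" using wf cimgf[OF S(2), of f] S(3) by auto
          have "y \<in> S" if mf: "S \<inter> nb E f \<noteq> {}"
          proof -
            have "y \<in> S \<longleftrightarrow> collapse E g z \<in> collapse E g ` S"
              using inS[OF S(1,2) mf True _ zf] y(1) sym by blast
            moreover have "collapse E g z = g" using z unfolding collapse_def by simp
            ultimately show ?thesis using cimg[OF g, of g] m by auto
          qed
          then have "S \<inter> nb E f \<noteq> {} \<longleftrightarrow> y \<in> S" using True by auto
          then show ?thesis using same[OF z] zy w' by blast
        qed
      qed
      have dist_g: "exits_distinct (graph_quot E f) g"
        unfolding exits_distinct_def quot_adj_far[OF ctx']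
      proof (intro allI impI)
        fix z1 z2 w
        assume z: "E g z1" "E g z2" and w: "graph_quot E f z1 w" "graph_quot E f z2 w" "w \<noteq> g" "\<not> E g w"
        obtain y1 where y1: "E z1 y1" "y1 \<noteq> g" "\<not> E g y1" "w = collapse E f y1"
          using quot_exit_far[OF ctx' z(1), of w] w by blast
        obtain y2 where y2: "E z2 y2" "y2 \<noteq> g" "\<not> E g y2" "w = collapse E f y2"
          using quot_exit_far[OF ctx' z(2), of w] w by blast
        have yf: "y1 \<noteq> f" "y2 \<noteq> f" using y1 y2 z disj sym by blast+
        have zf: "z1 \<noteq> f" "\<not> E f z1" "z2 \<noteq> f" "\<not> E f z2" using z far disj by auto
        have "y1 = y2"
        proof (cases "E f y1")
          case False
          then have "w = y1" using y1(4) unfolding collapse_def by simp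
          then show ?thesis using y2(4) yf unfolding collapse_def by (auto split: if_splits)
        next
          case True
          then have "w = f" using y1(4) unfolding collapse_def by simp
          then have y2f: "E f y2" using y2(4) yf unfolding collapse_def by (auto split: if_splits)
          have cz: "collapse E g z1 = g" "collapse E g z2 = g" using z unfolding collapse_def by auto
          have "?E y1 g \<and> g \<noteq> f \<and> \<not> E f g" using qadj[OF True sym[OF y1(1)] zf(1,2)] cz by simp
          moreover have "?E y2 g" using qadj[OF y2f sym[OF y2(1)] zf(3,4)] cz by simp
          ultimately show ?thesis
            using exits_distinctD[OF \<open>exits_distinct ?E f\<close>, of y1 y2 g] True y2f
            unfolding quot_adj_far[OF ctx] by blast
        qed
        then show "z1 = z2" using exits_distinctD[OF gdist z] y1 y2 by blast
      qed
      have sub: "star_quot E V f \<subseteq> Pow (N - nb E f)"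
      proof
        fix S' assume "S' \<in> star_quot E V f"
        then obtain S where S: "S \<in> V" "f \<notin> S" "S' = collapse E f ` S" unfolding star_quot_def by auto
        have "y \<in> N - nb E f" if "y \<in> S'" for y
          using that cimgf[OF S(2), of y] S(1,3) Vsub fN irr by (auto split: if_splits)
        then show "S' \<in> Pow (N - nb E f)" by blast
      qed
      have "capped_system (N - nb E f) (graph_quot E f) (star_quot E V f)"
      proof (rule capped_system.cap)
        show "graph_on (N - nb E f) (graph_quot E f)" using graph_on_quot[OF G fN(1)] .
        show "g \<in> N - nb E f" using cap(2) far' by simp
        show "cap_node (graph_quot E f) g" using quot_cap_node_far[OF ctx' gcap] .
        have "?N - nb ?E f = N - nb E f - nb (graph_quot E f) g"
          unfolding quot_nb_far[OF ctx] quot_nb_far[OF ctx'] by blast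
        then show "capped_system (N - nb E f - nb (graph_quot E f) g) (graph_quot (graph_quot E f) g)
            (star_quot (graph_quot E f) (star_quot E V f) g)"
          using Kf unfolding quot_commute[OF ctx] star_quot_commute[OF ctx] by simp
      qed (fact caps_g dist_g sub)+
      then show ?thesis using caps_f by blast
    next
      case False
      \<comment> \<open>The system consists of two cubes glued along a facet, with tops \<open>f\<close> and \<open>g\<close>.\<close>
      then obtain \<alpha> where cube: "cube_with \<alpha> ?N ?E ?V"
        using capped_system_cap_node[OF cap(7) fcap'] by blast
      have fQ: "f \<in> ?N" and gQ: "g \<in> ?N" using fN cap(2) far irr by auto
      have g: "g = \<alpha> f"
        using cube_adj[OF cube, of f g] quot_adj_far[OF ctx, of g] fQ gQ ne far' by blast
      have ag: "\<alpha> g = f" using cube_opp[OF cube fQ] g by simp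
      have nbf: "E f x \<longleftrightarrow> x \<in> ?N \<and> x \<noteq> f \<and> x \<noteq> g" for x
        using cube_adj[OF cube, of f x] quot_adj_far[OF ctx, of x] fQ g by auto
      have opp_f: "E f (\<alpha> x)" "\<alpha> x \<noteq> x" "\<alpha> (\<alpha> x) = x" "\<not> E x (\<alpha> x)" if x: "E f x" for x
      proof -
        have xN: "x \<in> ?N" "x \<noteq> f" "x \<noteq> g" using x nbf by auto
        show "\<alpha> x \<noteq> x" "\<alpha> (\<alpha> x) = x" using cube_opp[OF cube xN(1)] by auto
        then show fa: "E f (\<alpha> x)" using nbf[of "\<alpha> x"] cube_opp[OF cube xN(1)] xN g ag by metis
        show "\<not> E x (\<alpha> x)" using quot_nb_adj_far[OF ctx x fa] cube_adj[OF cube, of x "\<alpha> x"] by blast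
      qed
      have mate_f: "y = \<alpha> x" if "E f x" "E f y" "y \<noteq> x" "\<not> E x y" for x y
        using quot_nb_adj_far[OF ctx that(1,2)] cube_adj[OF cube, of x y] that nbf by blast
      have exit_f: "E g y" if "E f x" "E x y" "y \<noteq> f" "\<not> E f y" for x y
      proof (rule ccontr)
        assume "\<not> E g y"
        then have "y \<in> ?N" using that(2) G unfolding graph_on_def by auto
        then have "y = g" using that nbf by blast
        then show False using that disj sym by blast
      qed
      have exit_g: "E f y" if "E g z" "E z y" "y \<noteq> g" "\<not> E g y" for z y
      proof -
        have "y \<in> ?N" using that(2,4) G unfolding graph_on_def by auto
        moreover have "y \<noteq> f" using that disj sym by blast
        ultimately show ?thesis using that nbf by blast
      qed
      have star: "S \<in> ?V \<longleftrightarrow> S \<subseteq> ?N \<and> (\<forall>x\<in>?N. x \<in> S \<longleftrightarrow> \<alpha> x \<notin> S)" for S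
        using cube_star[OF cube] .
      have same: "x \<in> collapse E g ` S \<longleftrightarrow> x \<in> S" if "g \<notin> S" "E f x" for x S
        using cimg[OF that(1), of x] that(2) disj far'(1) by auto
      have samef: "f \<in> collapse E g ` S \<longleftrightarrow> f \<in> S" if "g \<notin> S" for S
        using cimg[OF that, of f] ne far by auto
      have quot_in: "collapse E g ` S \<in> ?V" if "S \<in> V" "g \<notin> S" for S using quotV that by blast
      have quot_flip: "x \<in> collapse E g ` S \<longleftrightarrow> \<alpha> x \<notin> collapse E g ` S"
        if S: "S \<in> V" "g \<notin> S" and x: "x \<in> ?N" for S x
        using conjunct2[OF star[THEN iffD1, OF quot_in[OF S]], rule_format, OF x] .
      have transf: "transversal E f (S \<inter> nb E f)" if S: "S \<in> V" "g \<notin> S" for S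
        unfolding transversal_def
      proof (intro conjI allI impI)
        fix x y assume x: "E f x" "E f y" "y \<noteq> x" "\<not> E x y"
        have "x \<in> ?N" using x nbf by blast
        then have "x \<in> collapse E g ` S \<longleftrightarrow> \<alpha> x \<notin> collapse E g ` S"
          by (rule quot_flip[OF S])
        then show "x \<in> S \<inter> nb E f \<longleftrightarrow> y \<notin> S \<inter> nb E f"
          using same[OF S(2)] x mate_f[OF x] by simp
      qed blast
      have meets_f: "S \<inter> nb E f \<noteq> {}" if S: "S \<in> V" "g \<notin> S" for S
      proof -
        obtain x where x: "E f x" using cap_node_pick[OF fcap, of f f f] by blast
        then show ?thesis using transf[OF S] opp_f[OF x] unfolding transversal_def
          by (metis Int_iff disjoint_iff nb_iff)
      qed
      have meets_g: "S \<inter> nb E g \<noteq> {} \<longleftrightarrow> f \<notin> S" if S: "S \<in> V" "g \<notin> S" for S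
      proof -
        have "f \<in> collapse E g ` S \<longleftrightarrow> g \<notin> collapse E g ` S" using quot_flip[OF S fQ] unfolding g .
        then show ?thesis using samef[OF S(2)] cimg[OF S(2), of g] by auto
      qed
      have D1: "S \<in> V \<longleftrightarrow> transversal E f (S - {f})" if fS: "f \<in> S" for S
      proof
        assume S: "S \<in> V"
        then have g: "g \<notin> S" using near_g' fS by blast
        have "S \<inter> nb E g = {}" using meets_g[OF S g] fS by blast
        then have "\<not> E g x" if "x \<in> S" for x using that by (metis disjoint_iff nb_iff)
        moreover have "x \<in> N" if "x \<in> S" for x using that S Vsub by blast
        ultimately have "S - {f} = S \<inter> nb E f" using g nbf irr[of f] by auto
        then show "transversal E f (S - {f})" using transf[OF S g] by simp
      next
        assume T: "transversal E f (S - {f})"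
        have sub: "S - {f} \<subseteq> nb E f" using transversal_sub[OF T] .
        have gS: "g \<notin> S" using sub far' ne by auto
        have "x \<in> S \<longleftrightarrow> \<alpha> x \<notin> S" if x: "x \<in> ?N" for x
        proof -
          consider "x = f" | "x = g" | "E f x" using nbf x by blast
          then show ?thesis
          proof cases
            case 3
            have "x \<noteq> f" "\<alpha> x \<noteq> f" using 3 opp_f[OF 3] irr by metis+
            moreover have "x \<in> S - {f} \<longleftrightarrow> \<alpha> x \<notin> S - {f}"
              using T 3 opp_f[OF 3] unfolding transversal_def by simp
            ultimately show ?thesis by blast
          qed (use fS gS g ag in auto)
        qed
        moreover have "S \<subseteq> ?N" using sub nbf fQ by auto
        ultimately have "S \<in> ?V" unfolding star by blast
        then obtain S0 where S0: "S0 \<in> V" "g \<notin> S0" "S = collapse E g ` S0" by (metis quotV)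
        then have "S0 \<inter> nb E g = {}" using gS cimg[OF S0(2), of g] by auto
        then show "S \<in> V" using S0 collapse_image_away by metis
      qed
      have D2: "x \<in> S \<longleftrightarrow> y \<in> S"
        if S: "S \<in> V" "f \<notin> S" "S \<inter> nb E f \<noteq> {}" and x: "E f x" and y: "E x y" "y \<noteq> f" "\<not> E f y" for S x y
      proof -
        have g: "g \<notin> S" using near_g' S by blast
        have xg: "x \<noteq> g" "\<not> E g x" using x far' disj by auto
        have "S \<inter> nb E g \<noteq> {}" using meets_g[OF S(1) g] S(2) by blast
        then show ?thesis using capsD2[OF W S(1) g _ exit_f[OF x y] sym[OF y(1)] xg] by blast
      qed
      have caps_f: "caps E V f"
      proof (rule capsI)
        fix S assume S: "S \<in> V" "f \<notin> S" "S \<inter> nb E f \<noteq> {}"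
        then show "transversal E f (S \<inter> nb E f)" using transf near_g'(1)[OF S(1)] by metis
      qed (fact D1 D2)+
      define \<beta> where "\<beta> z = (THE y. E g y \<and> y \<noteq> z \<and> \<not> E z y)" for z
      have beta: "E g (\<beta> z)" "\<beta> z \<noteq> z" "\<not> E z (\<beta> z)" if "E g z" for z
        using theI'[OF cap_node_mate[OF gcap that]] unfolding \<beta>_def by blast+
      have beta_unique: "y = \<beta> z" if "E g z" "E g y" "y \<noteq> z" "\<not> E z y" for y z
        using cap_node_mate[OF gcap that(1)] beta[OF that(1)] that by blast
      have beta_inv: "\<beta> (\<beta> z) = z" if "E g z" for z
        using beta_unique[OF beta(1)[OF that] that] beta[OF that] sym by metis
      \<comment> \<open>The edges between the two neighbourhoods respect opposites: otherwise some star would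
        contain two opposite neighbours of \<open>g\<close>.\<close>
      have opp_exit: "x' = \<alpha> x"
        if z: "E g z" and x: "E f x" "E z x" and x': "E f x'" "E (\<beta> z) x'" for z x x'
      proof (rule ccontr)
        assume ne': "x' \<noteq> \<alpha> x"
        have xg: "x \<noteq> g" "\<not> E g x" "x' \<noteq> g" "\<not> E g x'" using x x' far' disj by auto
        have xx': "\<alpha> x' \<noteq> x" using ne' opp_f(3)[OF x'(1)] by metis
        have "\<alpha> x \<noteq> g" "\<alpha> x' \<noteq> g" using opp_f(1)[OF x(1)] opp_f(1)[OF x'(1)] far' by metis+
        then have "\<exists>S\<in>?V. {g, x, x'} \<subseteq> S"
          using ne' xx' ag x x' nbf gQ opp_f(2)[OF x(1)] opp_f(2)[OF x'(1)] irr ne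
          by (intro cube_star_through[OF cube]) auto
        then obtain S' where S': "S' \<in> ?V" "{g, x, x'} \<subseteq> S'" ..
        obtain S where S: "S \<in> V" "g \<notin> S" "S' = collapse E g ` S" using quotV[THEN iffD1, OF S'(1)] by blast
        have sub: "{g, x, x'} \<subseteq> collapse E g ` S" using S'(2) S(3) by simp
        have m: "S \<inter> nb E g \<noteq> {}" using sub cimg[OF S(2), of g] by auto
        have "x \<in> S" "x' \<in> S" using sub same[OF S(2) x(1)] same[OF S(2) x'(1)] by auto
        then have "z \<in> S" "\<beta> z \<in> S"
          using capsD2[OF W S(1,2) m z x(2) xg(1,2)] capsD2[OF W S(1,2) m beta(1)[OF z] x'(2) xg(3,4)] by auto
        then show False using capsD3[OF W S(1,2) m] z beta[OF z] unfolding transversal_def by simp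
      qed
      have exit_ex: "\<exists>x. E f x \<and> E z x" if z: "E g z" for z
        using cap_node_exit[OF gcap z] exit_g[OF z] by blast
      have exit_ex': "\<exists>z. E g z \<and> E z x" if x: "E f x" for x
        using cap_node_exit[OF fcap x] exit_f[OF x] sym by blast
      have exit_uniq: "x = x'" if z: "E g z" and x: "E f x" "E z x" "E f x'" "E z x'" for x x' z
        using cap_node_exit[OF gcap z] x far' disj by blast
      have exit_uniq': "z = z'" if x: "E f x" and z: "E g z" "E z x" "E g z'" "E z' x" for x z z'
        using cap_node_exit[OF fcap x] z far disj sym by blast
      define \<alpha>' where "\<alpha>' x = (if x = f then g else if x = g then f else \<beta> x)" for x
      have a': "\<alpha>' f = g" "\<alpha>' g = f" "\<And>z. E g z \<Longrightarrow> \<alpha>' z = \<beta> z"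
        unfolding \<alpha>'_def using ne far irr by auto
      have M: "x \<in> N - nb E f \<longleftrightarrow> x = f \<or> x = g \<or> E g x" for x
      proof -
        have "E f x \<longleftrightarrow> x \<in> N \<and> \<not> E g x \<and> x \<noteq> f \<and> x \<noteq> g" using nbf[of x] by simp
        moreover have "x \<in> N - nb E f \<longleftrightarrow> x \<in> N \<and> \<not> E f x" by simp
        ultimately show ?thesis using fN(1) fN(3)[of x] cap(2) irr[of f] far'(1) disj[of x] by metis
      qed
      let ?F = "graph_quot E f"
      have F1: "?F x y \<Longrightarrow> x \<in> N - nb E f \<and> y \<in> N - nb E f \<and> x \<noteq> y \<and> ?F y x" for x y
        using graph_on_quot[OF G fN(1)] unfolding graph_on_def by blast
      have F2: "?F g y \<longleftrightarrow> E g y" for y using quot_adj_far[OF ctx'] .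
      have F3: "?F f z" if z: "E g z" for z
      proof -
        obtain x where "E f x" "E z x" using exit_ex[OF z] by blast
        moreover have "z \<noteq> f" "\<not> E f z" using z far disj by auto
        ultimately show ?thesis unfolding graph_quot_def
          by (intro conjI exI[of _ x] exI[of _ z]) (auto simp: collapse_def sym)
      qed
      have F4: "?F z z' \<longleftrightarrow> z \<noteq> z' \<and> z' \<noteq> \<beta> z" if "E g z" "E g z'" for z z'
        using quot_nb_adj_far[OF ctx' that] beta_unique[OF that] beta[OF that(1)] irr by metis
      have Fadj: "?F x y \<longleftrightarrow> x \<in> N - nb E f \<and> y \<in> N - nb E f \<and> x \<noteq> y \<and> y \<noteq> \<alpha>' x" for x y
      proof
        assume h: "?F x y"
        have "y \<noteq> \<alpha>' x"
        proof
          assume y: "y = \<alpha>' x"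
          consider "x = f" | "x = g" | "E g x" using F1[OF h] M by blast
          then show False using F1[OF h] F2 F4[of x y] h y a' far beta[of x] by cases auto
        qed
        then show "x \<in> N - nb E f \<and> y \<in> N - nb E f \<and> x \<noteq> y \<and> y \<noteq> \<alpha>' x" using F1[OF h] by blast
      next
        assume h: "x \<in> N - nb E f \<and> y \<in> N - nb E f \<and> x \<noteq> y \<and> y \<noteq> \<alpha>' x"
        then have "(x = f \<or> x = g \<or> E g x) \<and> (y = f \<or> y = g \<or> E g y)" using M by blast
        then show "?F x y" using h F1 F2 F3 F4 a' by metis
      qed
      have opp': "\<alpha>' x \<in> N - nb E f \<and> \<alpha>' x \<noteq> x \<and> \<alpha>' (\<alpha>' x) = x" if xM: "x \<in> N - nb E f" for x
      proof -
        consider "x = f" | "x = g" | "E g x" using xM[unfolded M] by blast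
        then show ?thesis
        proof cases
          case 3
          show ?thesis unfolding a'(3)[OF 3] M a'(3)[OF beta(1)[OF 3]]
            using beta(1,2)[OF 3] beta_inv[OF 3] by simp
        next
          case 1 show ?thesis unfolding 1 a'(1,2) M using ne by simp
        next
          case 2 show ?thesis unfolding 2 a'(1,2) M using ne by simp
        qed
      qed
      have star': "S' \<in> star_quot E V f \<longleftrightarrow>
          S' \<subseteq> N - nb E f \<and> (\<forall>x\<in>N - nb E f. x \<in> S' \<longleftrightarrow> \<alpha>' x \<notin> S')" for S'
      proof
        assume "S' \<in> star_quot E V f"
        then obtain S where S: "S \<in> V" "f \<notin> S" "S' = collapse E f ` S" unfolding star_quot_def by auto
        have img: "y \<in> S' \<longleftrightarrow> (if y = f then S \<inter> nb E f \<noteq> {} else y \<in> S \<and> \<not> E f y)" for y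
          unfolding S(3) using cimgf[OF S(2)] .
        have sub: "S' \<subseteq> N - nb E f"
        proof
          fix y assume "y \<in> S'"
          moreover have "y \<in> S \<Longrightarrow> y \<in> N" using S(1) Vsub by blast
          ultimately show "y \<in> N - nb E f" using img[of y] fN(1) irr[of f] by (auto split: if_splits)
        qed
        have onef: "f \<in> S' \<longleftrightarrow> g \<notin> S'"
          using img[of f] img[of g] meets_f[OF S(1)] near_g'(1)[OF S(1)] ne far'(1) by auto
        have T: "transversal E g (S \<inter> nb E g)"
        proof (cases "g \<in> S")
          case True
          then have "S \<inter> nb E g = S - {g}" using near_g[OF S(1) True] irr by auto
          then show ?thesis using capsD1[OF W True] S(1) by simp
        next
          case False
          then show ?thesis using capsD3[OF W S(1) False] meets_g[OF S(1) False] S(2) by simp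
        qed
        have "y \<in> S' \<longleftrightarrow> y \<in> S" if "E g y" for y
          using img[of y] that disj[of y] far(1) by (cases "y = f") auto
        then have "S' \<inter> nb E g = S \<inter> nb E g" by auto
        then have T': "transversal E g (S' \<inter> nb E g)" using T by simp
        have "x \<in> S' \<longleftrightarrow> \<alpha>' x \<notin> S'" if xM: "x \<in> N - nb E f" for x
        proof -
          consider "x = f" | "x = g" | "E g x" using xM[unfolded M] by blast
          then show ?thesis
          proof cases
            case 3 then show ?thesis using T' beta[OF 3] a'(3)[OF 3] unfolding transversal_def by simp
          qed (use onef a' in auto)
        qed
        with sub show "S' \<subseteq> N - nb E f \<and> (\<forall>x\<in>N - nb E f. x \<in> S' \<longleftrightarrow> \<alpha>' x \<notin> S')" by blast
      next
        assume h: "S' \<subseteq> N - nb E f \<and> (\<forall>x\<in>N - nb E f. x \<in> S' \<longleftrightarrow> \<alpha>' x \<notin> S')"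
        have onef: "f \<in> S' \<longleftrightarrow> g \<notin> S'" using h M[of f] a'(1) by metis
        have flip: "z \<in> S' \<longleftrightarrow> \<beta> z \<notin> S'" if "E g z" for z using h M[of z] a'(3)[OF that] that by metis
        have T: "transversal E g (S' \<inter> nb E g)" unfolding transversal_def
          using flip beta_unique by (metis Int_iff inf_le2 nb_iff)
        have inM: "y \<in> S' \<Longrightarrow> y = f \<or> y = g \<or> E g y" for y using h M by blast
        show "S' \<in> star_quot E V f"
        proof (cases "g \<in> S'")
          case True
          have "y \<in> S' - {g} \<longleftrightarrow> y \<in> S' \<inter> nb E g" for y using inM[of y] onef True irr[of g] by auto
          then have "S' - {g} = S' \<inter> nb E g" by blast
          then have "S' \<in> V" using T capsD1[OF W True] by simp
          moreover have "f \<notin> S'" using onef True by blast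
          moreover have "collapse E f ` S' = S'" using h by (intro collapse_image_away) blast
          ultimately show ?thesis using star_quotI by metis
        next
          case g': False
          define S1 where "S1 = insert g {x. E f x \<and> (\<exists>z\<in>S'. E g z \<and> E z x)}"
          have S1: "x \<in> S1 \<longleftrightarrow> z \<in> S'" if "E f x" "E g z" "E z x" for x z
            using that exit_uniq' far' unfolding S1_def by blast
          have "S1 \<in> ?V" unfolding star
          proof (intro conjI ballI)
            show "S1 \<subseteq> ?N"
            proof
              fix x assume "x \<in> S1"
              then have "x = g \<or> E f x" unfolding S1_def by blast
              then show "x \<in> ?N" using gQ nbf[of x] by metis
            qed
            fix x assume x: "x \<in> ?N"
            have f1: "f \<notin> S1" "g \<in> S1" unfolding S1_def using ne irr[of f] by simp_all
            consider "x = f" | "x = g" | "E f x" using nbf x by blast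
            then show "x \<in> S1 \<longleftrightarrow> \<alpha> x \<notin> S1"
            proof cases
              case 3
              obtain z where z: "E g z" "E z x" using exit_ex'[OF 3] by blast
              obtain x' where x': "E f x'" "E (\<beta> z) x'" using exit_ex[OF beta(1)[OF z(1)]] by blast
              have "x' = \<alpha> x" using opp_exit[OF z(1) 3 z(2) x'] .
              then show ?thesis
                using S1[OF 3 z] S1[OF x'(1) beta(1)[OF z(1)] x'(2)] flip[OF z(1)] by metis
            next
              case 1 show ?thesis unfolding 1 g[symmetric] using f1 by simp
            next
              case 2 show ?thesis unfolding 2 ag using f1 by simp
            qed
          qed
          then obtain S where S: "S \<in> V" "g \<notin> S" "S1 = collapse E g ` S" by (metis quotV)
          have fS: "f \<notin> S" using samef[OF S(2)] ne irr[of f] unfolding S(3)[symmetric] S1_def by simp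
          have m: "S \<inter> nb E g \<noteq> {}" using meets_g[OF S(1,2)] fS by blast
          have Sg: "z \<in> S \<longleftrightarrow> z \<in> S'" if z: "E g z" for z
          proof -
            obtain x where x: "E f x" "E z x" using exit_ex[OF z] by blast
            have "x \<noteq> g" "\<not> E g x" using x far' disj by auto
            then have "z \<in> S \<longleftrightarrow> x \<in> S" using capsD2[OF W S(1,2) m z x(2)] by blast
            then show ?thesis using same[OF S(2) x(1)] S(3) S1[OF x(1) z x(2)] by simp
          qed
          have "collapse E f ` S = S'"
          proof (intro set_eqI)
            fix y
            show "y \<in> collapse E f ` S \<longleftrightarrow> y \<in> S'"
            proof (cases "y = f")
              case True
              then show ?thesis using cimgf[OF fS, of f] meets_f[OF S(1,2)] onef g' by simp
            next
              case False
              show ?thesis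
              proof (cases "E g y")
                case True then show ?thesis using cimgf[OF fS, of y] Sg[OF True] False disj by auto
              next
                case n: False
                have "y \<in> S \<Longrightarrow> y \<in> N" using S(1) Vsub by blast
                then have "y \<in> S \<and> \<not> E f y \<longrightarrow> y = g" using nbf[of y] False n by auto
                then show ?thesis using cimgf[OF fS, of y] False n inM[of y] g' S(2) by auto
              qed
            qed
          qed
          then show ?thesis using star_quotI[OF S(1) fS, of S' E] by metis
        qed
      qed
      have "cube_with \<alpha>' (N - nb E f) ?F (star_quot E V f)"
        unfolding cube_with_def
      proof (intro conjI ballI allI)
        show "finite (N - nb E f)" using G unfolding graph_on_def by blast
        show "star_quot E V f = {S. S \<subseteq> N - nb E f \<and> (\<forall>x\<in>N - nb E f. x \<in> S \<longleftrightarrow> \<alpha>' x \<notin> S)}"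
          by (rule set_eqI) (simp only: star' mem_Collect_eq)
      qed (use opp' in blast | rule Fadj)+
      moreover have "6 \<le> card (N - nb E f)"
      proof -
        have "N - nb E f = insert f (insert g (nb E g))"
          by (rule set_eqI) (simp only: M insert_iff nb_iff)
        moreover have "card (insert f (insert g (nb E g))) = 2 + card (nb E g)"
          using finite_nb[OF G] ne far(1) irr[of g] by (simp add: card_insert_if)
        ultimately show ?thesis using cap_node_card[OF gcap] by simp
      qed
      ultimately show ?thesis using caps_f capped_system.cube by blast
    qed
  qed
qed

section \<open>The graph determines the stars\<close>

text \<open>
  The last cap of one system is, by confluence, also a cap of the other, and the induction hypothesis
  applies to the collapsed systems.
\<close>

theorem capped_system_unique:
  assumes "capped_system N E V" "capped_system N E V'"
  shows "V = V'"
  using assms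
proof (induction arbitrary: V' rule: capped_system.induct)
  case (cube \<alpha> N E V)
  from cube.prems show ?case
  proof cases
    case (cube \<beta>)
    have "\<beta> x = \<alpha> x" if "x \<in> N" for x
      using cube_adj[OF cube(1), of x "\<alpha> x"] cube_adj[OF \<open>cube_with \<alpha> N E V\<close>, of x "\<alpha> x"]
        cube_opp[OF \<open>cube_with \<alpha> N E V\<close> that] that by metis
    then show ?thesis
      using cube_star[OF cube(1)] cube_star[OF \<open>cube_with \<alpha> N E V\<close>] by (intro set_eqI) simp
  next
    case (cap f)
    then show ?thesis using cube_cap_node[OF \<open>cube_with \<alpha> N E V\<close>] by blast
  qed
next
  case (cap N E f V)
  have "caps E V' f" and K: "capped_system (N - nb E f) (graph_quot E f) (star_quot E V' f)"
    using capped_system_caps[OF cap.prems cap(4,5)] by auto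
  moreover have "star_quot E V f = star_quot E V' f" using cap.IH[OF K] .
  ultimately show ?case
    using star_determined_by_quot[OF cap(1,4)] cap(6) by (metis subset_antisym)
qed

lemma cube_with_image:
  fixes N :: "'n set" and N' :: "'m set"
  assumes C: "cube_with \<alpha> N E V" and bij: "bij_betw \<sigma> N N'"
    and adj: "\<And>x y. x \<in> N \<Longrightarrow> y \<in> N \<Longrightarrow> E x y \<longleftrightarrow> E' (\<sigma> x) (\<sigma> y)"
    and E': "\<And>x y. E' x y \<Longrightarrow> x \<in> N' \<and> y \<in> N'"
    and V': "V' = (`) \<sigma> ` V"
  shows "\<exists>\<beta>. cube_with \<beta> N' E' V'"
proof -
  define \<tau> where "\<tau> = the_inv_into N \<sigma>"
  have inj: "inj_on \<sigma> N" and N': "\<sigma> ` N = N'" using bij unfolding bij_betw_def by auto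
  have ts: "\<tau> (\<sigma> x) = x" if "x \<in> N" for x unfolding \<tau>_def using the_inv_into_f_f[OF inj that] .
  define \<beta> where "\<beta> = \<sigma> \<circ> \<alpha> \<circ> \<tau>"
  have b: "\<beta> (\<sigma> x) = \<sigma> (\<alpha> x)" if "x \<in> N" for x unfolding \<beta>_def using ts[OF that] by simp
  note opp = cube_opp[OF C]
  have sN: "\<sigma> x \<in> N'" if "x \<in> N" for x using N' that by blast
  have seq: "\<sigma> x = \<sigma> y \<longleftrightarrow> x = y" if "x \<in> N" "y \<in> N" for x y using inj that unfolding inj_on_def by blast
  have "cube_with \<beta> N' E' V'"
    unfolding cube_with_def
  proof (intro conjI ballI allI)
    show "finite N'" using cube_finite[OF C] N' by blast
    fix y assume "y \<in> N'"
    then obtain x where x: "x \<in> N" "y = \<sigma> x" using N' by blast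
    have a: "\<alpha> x \<in> N" "\<alpha> x \<noteq> x" "\<alpha> (\<alpha> x) = x" using opp[OF x(1)] by auto
    show "\<beta> y \<in> N'" "\<beta> y \<noteq> y" "\<beta> (\<beta> y) = y"
      unfolding x(2) b[OF x(1)] b[OF a(1)] a(3) using sN[OF a(1)] seq[OF a(1) x(1)] a(2) by auto
  next
    fix x' y' :: 'm
    show "E' x' y' \<longleftrightarrow> x' \<in> N' \<and> y' \<in> N' \<and> x' \<noteq> y' \<and> y' \<noteq> \<beta> x'"
    proof (cases "x' \<in> N' \<and> y' \<in> N'")
      case True
      then obtain x y where x: "x \<in> N" "x' = \<sigma> x" "y \<in> N" "y' = \<sigma> y" using N' by blast
      have "\<alpha> x \<in> N" using opp[OF x(1)] by blast
      then show ?thesis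
        unfolding x(2,4) b[OF x(1)] adj[OF x(1,3), symmetric] cube_adj[OF C]
        using seq[OF x(1,3)] seq[OF x(3), of "\<alpha> x"] x sN by blast
    next
      case False then show ?thesis using E' by blast
    qed
  next
    show "V' = {S. S \<subseteq> N' \<and> (\<forall>x\<in>N'. x \<in> S \<longleftrightarrow> \<beta> x \<notin> S)}"
    proof (intro set_eqI iffI)
      fix S' assume "S' \<in> V'"
      then obtain S where S: "S \<in> V" "S' = \<sigma> ` S" unfolding V' by blast
      have sub: "S \<subseteq> N" and flip: "\<And>x. x \<in> N \<Longrightarrow> x \<in> S \<longleftrightarrow> \<alpha> x \<notin> S" using S(1) cube_star[OF C] by auto
      have mem: "\<sigma> x \<in> S' \<longleftrightarrow> x \<in> S" if "x \<in> N" for x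
        unfolding S(2) using inj_on_image_mem_iff[OF inj that sub] .
      have "\<sigma> x \<in> S' \<longleftrightarrow> \<beta> (\<sigma> x) \<notin> S'" if "x \<in> N" for x
        using mem[OF that] mem[of "\<alpha> x"] flip[OF that] opp[OF that] unfolding b[OF that] by blast
      moreover have "S' \<subseteq> N'" using S(2) sub sN by auto
      ultimately show "S' \<in> {S. S \<subseteq> N' \<and> (\<forall>x\<in>N'. x \<in> S \<longleftrightarrow> \<beta> x \<notin> S)}" unfolding N'[symmetric] by blast
    next
      fix S' assume S': "S' \<in> {S. S \<subseteq> N' \<and> (\<forall>x\<in>N'. x \<in> S \<longleftrightarrow> \<beta> x \<notin> S)}"
      define S where "S = {x \<in> N. \<sigma> x \<in> S'}"
      have "x \<in> S \<longleftrightarrow> \<alpha> x \<notin> S" if "x \<in> N" for x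
        using S' sN[OF that] b[OF that] opp[OF that] that unfolding S_def by auto
      then have "S \<in> V" unfolding cube_star[OF C] S_def by blast
      moreover have "S' = \<sigma> ` S" using S' N' unfolding S_def by auto
      ultimately show "S' \<in> V'" unfolding V' by blast
    qed
  qed
  then show ?thesis by (rule exI[of _ \<beta>])
qed

lemma capped_system_image:
  fixes N :: "'n set" and N' :: "'m set"
  assumes "capped_system N E V" and "bij_betw \<sigma> N N'"
    and "\<And>x y. x \<in> N \<Longrightarrow> y \<in> N \<Longrightarrow> E x y \<longleftrightarrow> E' (\<sigma> x) (\<sigma> y)"
    and "\<And>x y. E' x y \<Longrightarrow> x \<in> N' \<and> y \<in> N'"
    and "V' = (`) \<sigma> ` V"
  shows "capped_system N' E' V'"
  using assms
proof (induction arbitrary: N' E' V' rule: capped_system.induct)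
  case (cube \<alpha> N E V)
  obtain \<beta> where "cube_with \<beta> N' E' V'" using cube_with_image[OF cube(1) cube.prems] by blast
  moreover have "6 \<le> card N'" using cube(2) bij_betw_same_card[OF cube.prems(1)] by simp
  ultimately show ?case by (rule capped_system.cube)
next
  case (cap N E f V)
  note G = cap(1) and f = cap(2) and Vsub = cap(3) and fcap = cap(4) and fdist = cap(5) and W = cap(6)
    and bij = cap.prems(1) and adj = cap.prems(2) and E' = cap.prems(3)
  have inj: "inj_on \<sigma> N" and N': "\<sigma> ` N = N'" using bij unfolding bij_betw_def by auto
  have EN: "\<And>x y. E x y \<Longrightarrow> x \<in> N \<and> y \<in> N \<and> x \<noteq> y \<and> E y x" using G unfolding graph_on_def by blast
  have sN: "\<sigma> x \<in> N'" if "x \<in> N" for x using N' that by blast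
  have seq: "\<sigma> x = \<sigma> y \<longleftrightarrow> x = y" if "x \<in> N" "y \<in> N" for x y using inj that unfolding inj_on_def by blast
  have pre: "\<exists>x\<in>N. y = \<sigma> x" if "y \<in> N'" for y using that N' by blast
  have adjE: "\<exists>x y. E x y \<and> x' = \<sigma> x \<and> y' = \<sigma> y" if "E' x' y'" for x' y'
    using E'[OF that] pre adj that by metis
  have adjf: "\<exists>x. E f x \<and> x' = \<sigma> x" if "E' (\<sigma> f) x'" for x'
    using adjE[OF that] seq f EN by metis
  have nbs: "nb E' (\<sigma> f) = \<sigma> ` nb E f"
  proof (intro equalityI subsetI)
    fix x' assume "x' \<in> nb E' (\<sigma> f)"
    then have "E' (\<sigma> f) x'" by simp
    then obtain x where "E f x" "x' = \<sigma> x" using adjf by blast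
    then show "x' \<in> \<sigma> ` nb E f" by simp
  next
    fix x' assume "x' \<in> \<sigma> ` nb E f"
    then obtain x where x: "E f x" "x' = \<sigma> x" by auto
    then have "x \<in> N" using EN by blast
    then show "x' \<in> nb E' (\<sigma> f)" using x adj[OF f, of x] by simp
  qed
  have adjf': "E' (\<sigma> f) (\<sigma> x) \<longleftrightarrow> E f x" if "x \<in> N" for x using adj[OF f that] by simp
  have nbN: "nb E f \<subseteq> N" unfolding nb_def using EN by blast
  have mem: "\<sigma> x \<in> \<sigma> ` S \<longleftrightarrow> x \<in> S" if "x \<in> N" "S \<subseteq> N" for x S
    using inj_on_image_mem_iff[OF inj that] .
  have G': "graph_on N' E'" unfolding graph_on_def
  proof (intro conjI allI impI)
    show "finite N'" using G N' unfolding graph_on_def by blast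
    fix x' y' assume h: "E' x' y'"
    then obtain x y where x: "E x y" "x' = \<sigma> x" "y' = \<sigma> y" using adjE by blast
    show "x' \<in> N'" "y' \<in> N'" using E' h by blast+
    show "x' \<noteq> y'" using x EN seq by metis
    show "E' y' x'" using x EN adj by metis
  qed
  have fcap': "cap_node E' (\<sigma> f)" unfolding cap_node_def
  proof (intro conjI allI impI)
    show "4 \<le> card (nb E' (\<sigma> f))"
      unfolding nbs using card_image[OF inj_on_subset[OF inj nbN]] cap_node_card[OF fcap] by simp
    fix x' assume "E' (\<sigma> f) x'"
    then obtain x where x: "E f x" "x' = \<sigma> x" using adjf by blast
    have xN: "x \<in> N" using EN x by blast
    obtain y where y: "E f y" "y \<noteq> x" "\<not> E x y" and u: "\<And>w. E f w \<Longrightarrow> w \<noteq> x \<Longrightarrow> \<not> E x w \<Longrightarrow> w = y"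
      using cap_node_mate[OF fcap x(1)] by blast
    show "\<exists>!y. E' (\<sigma> f) y \<and> y \<noteq> x' \<and> \<not> E' x' y"
    proof (rule ex1I[of _ "\<sigma> y"])
      show "E' (\<sigma> f) (\<sigma> y) \<and> \<sigma> y \<noteq> x' \<and> \<not> E' x' (\<sigma> y)"
        using y x EN[OF y(1)] xN adj[OF f, of y] adj[OF xN, of y] seq[of y x] by simp
      fix w' assume w': "E' (\<sigma> f) w' \<and> w' \<noteq> x' \<and> \<not> E' x' w'"
      then obtain w where w: "E f w" "w' = \<sigma> w" using adjf by blast
      then show "w' = \<sigma> y" using u[of w] w' x adj[OF xN, of w] EN[OF w(1)] by metis
    qed
    obtain y where y: "E x y" "y \<noteq> f" "\<not> E f y" and u: "\<And>w. E x w \<Longrightarrow> w \<noteq> f \<Longrightarrow> \<not> E f w \<Longrightarrow> w = y"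
      using cap_node_exit[OF fcap x(1)] by blast
    show "\<exists>!y. E' x' y \<and> y \<noteq> \<sigma> f \<and> \<not> E' (\<sigma> f) y"
    proof (rule ex1I[of _ "\<sigma> y"])
      show "E' x' (\<sigma> y) \<and> \<sigma> y \<noteq> \<sigma> f \<and> \<not> E' (\<sigma> f) (\<sigma> y)"
        using y x EN[OF y(1)] xN adj[OF f, of y] adj[OF xN, of y] seq[of y f] f by simp
      fix w' assume w': "E' x' w' \<and> w' \<noteq> \<sigma> f \<and> \<not> E' (\<sigma> f) w'"
      then obtain w where w: "w \<in> N" "w' = \<sigma> w" using E' pre by blast
      then show "w' = \<sigma> y" using u[of w] w' x adj[OF xN w(1)] adj[OF f w(1)] by metis
    qed
  qed
  have fdist': "exits_distinct E' (\<sigma> f)" unfolding exits_distinct_def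
  proof (intro allI impI)
    fix x' y' z' assume h: "E' (\<sigma> f) x'" "E' (\<sigma> f) y'" "E' x' z'" "E' y' z'" "z' \<noteq> \<sigma> f" "\<not> E' (\<sigma> f) z'"
    obtain x y z where x: "E f x" "x' = \<sigma> x" "E f y" "y' = \<sigma> y" "z \<in> N" "z' = \<sigma> z"
      using adjf h(1,2) E'[OF h(3)] pre by metis
    have N: "x \<in> N" "y \<in> N" using EN x by blast+
    have "x = y"
      using exits_distinctD[OF fdist x(1,3), of z] h x adj[OF N(1) x(5)] adj[OF N(2) x(5)] adj[OF f x(5)] by metis
    then show "x' = y'" using x by simp
  qed
  have tr: "transversal E' (\<sigma> f) (\<sigma> ` T) \<longleftrightarrow> transversal E f T" if T: "T \<subseteq> N" for T
  proof -
    have "\<sigma> ` T \<subseteq> \<sigma> ` nb E f \<longleftrightarrow> T \<subseteq> nb E f"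
      using inj_on_image_subset_iff[OF inj T nbN] .
    moreover have "(\<forall>x y. E' (\<sigma> f) x \<longrightarrow> E' (\<sigma> f) y \<longrightarrow> y \<noteq> x \<longrightarrow> \<not> E' x y \<longrightarrow> (x \<in> \<sigma> ` T \<longleftrightarrow> y \<notin> \<sigma> ` T)) \<longleftrightarrow>
        (\<forall>x y. E f x \<longrightarrow> E f y \<longrightarrow> y \<noteq> x \<longrightarrow> \<not> E x y \<longrightarrow> (x \<in> T \<longleftrightarrow> y \<notin> T))" (is "?L \<longleftrightarrow> ?R")
    proof
      assume L: ?L
      show ?R
      proof (intro allI impI)
        fix x y assume h: "E f x" "E f y" "y \<noteq> x" "\<not> E x y"
        have N: "x \<in> N" "y \<in> N" using EN h by blast+
        show "x \<in> T \<longleftrightarrow> y \<notin> T"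
          using L[rule_format, of "\<sigma> x" "\<sigma> y"] h adjf'[OF N(1)] adjf'[OF N(2)] adj[OF N] seq[OF N]
            mem[OF N(1) T] mem[OF N(2) T] by simp
      qed
    next
      assume R: ?R
      show ?L
      proof (intro allI impI)
        fix x' y' assume h: "E' (\<sigma> f) x'" "E' (\<sigma> f) y'" "y' \<noteq> x'" "\<not> E' x' y'"
        obtain x y where x: "E f x" "x' = \<sigma> x" "E f y" "y' = \<sigma> y" using adjf h(1,2) by metis
        have N: "x \<in> N" "y \<in> N" using EN x by blast+
        show "x' \<in> \<sigma> ` T \<longleftrightarrow> y' \<notin> \<sigma> ` T"
          using R[rule_format, of x y] h(3,4) x adj[OF N] seq[OF N] mem[OF N(1) T] mem[OF N(2) T] by simp
      qed
    qed
    ultimately show ?thesis unfolding transversal_def nbs by simp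
  qed
  have Vin: "S' \<in> V' \<longleftrightarrow> (\<exists>S\<in>V. S' = \<sigma> ` S)" for S' unfolding cap.prems(4) by blast
  have imV: "\<sigma> ` S \<in> V' \<longleftrightarrow> S \<in> V" if "S \<subseteq> N" for S
  proof
    assume "\<sigma> ` S \<in> V'"
    then obtain S0 where S0: "S0 \<in> V" "\<sigma> ` S = \<sigma> ` S0" unfolding Vin by blast
    then have "S = S0" using inj_on_image_eq_iff[OF inj that] Vsub by blast
    then show "S \<in> V" using S0 by simp
  qed (use Vin in blast)
  have lift: "\<exists>S. S \<subseteq> N \<and> S' = \<sigma> ` S" if "S' \<subseteq> N'" for S'
    using that unfolding N'[symmetric] subset_image_iff by blast
  have V'sub: "V' \<subseteq> Pow N'" unfolding cap.prems(4) N'[symmetric] using Vsub by auto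
  have dif: "\<sigma> ` (S - {f}) = \<sigma> ` S - {\<sigma> f}" if "S \<subseteq> N" for S
    using inj_on_image_set_diff[OF inj, of S "{f}"] Diff_subset[of S "{f}"] that f by auto
  have W': "caps E' V' (\<sigma> f)"
  proof (rule capsI)
    fix S' assume fS: "\<sigma> f \<in> S'"
    show "S' \<in> V' \<longleftrightarrow> transversal E' (\<sigma> f) (S' - {\<sigma> f})"
    proof (cases "S' \<subseteq> N'")
      case True
      then obtain S where S: "S \<subseteq> N" "S' = \<sigma> ` S" using lift by blast
      have "f \<in> S" using fS mem[OF f S(1)] S(2) by simp
      then show ?thesis unfolding S(2) dif[OF S(1), symmetric] imV[OF S(1)]
        using capsD1[OF W] tr[of "S - {f}"] S(1) by blast
    next
      case False
      have "nb E' (\<sigma> f) \<subseteq> N'" unfolding nb_def using E' by blast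
      then have "\<not> transversal E' (\<sigma> f) (S' - {\<sigma> f})"
        using False sN[OF f] transversal_sub[of E' "\<sigma> f" "S' - {\<sigma> f}"] by blast
      then show ?thesis using False V'sub by blast
    qed
  next
    fix S' assume h: "S' \<in> V'" "\<sigma> f \<notin> S'" "S' \<inter> nb E' (\<sigma> f) \<noteq> {}"
    obtain S where S: "S \<in> V" "S' = \<sigma> ` S" using h(1) Vin by blast
    have sub: "S \<subseteq> N" using S Vsub by blast
    have i: "S' \<inter> nb E' (\<sigma> f) = \<sigma> ` (S \<inter> nb E f)"
      unfolding nbs S(2) using inj_on_image_Int[OF inj sub nbN] by simp
    have "f \<notin> S" using h(2) S(2) by blast
    then have "transversal E f (S \<inter> nb E f)" using capsD3[OF W S(1)] h(3) i by auto
    then show "transversal E' (\<sigma> f) (S' \<inter> nb E' (\<sigma> f))" unfolding i using tr[of "S \<inter> nb E f"] sub by blast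
  next
    fix S' x' y' assume h: "S' \<in> V'" "\<sigma> f \<notin> S'" "S' \<inter> nb E' (\<sigma> f) \<noteq> {}"
      and x': "E' (\<sigma> f) x'" "E' x' y'" "y' \<noteq> \<sigma> f" "\<not> E' (\<sigma> f) y'"
    obtain S where S: "S \<in> V" "S' = \<sigma> ` S" using h(1) Vin by blast
    have sub: "S \<subseteq> N" using S Vsub by blast
    have i: "S' \<inter> nb E' (\<sigma> f) = \<sigma> ` (S \<inter> nb E f)"
      unfolding nbs S(2) using inj_on_image_Int[OF inj sub nbN] by simp
    have fS: "f \<notin> S" using h(2) S(2) by blast
    obtain x y where x: "E f x" "x' = \<sigma> x" "y \<in> N" "y' = \<sigma> y" using adjf[OF x'(1)] E'[OF x'(2)] pre by metis
    have xN: "x \<in> N" using EN x by blast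
    have "x \<in> S \<longleftrightarrow> y \<in> S"
      using capsD2[OF W S(1) fS _ x(1), of y] h(3) i x' x adj[OF xN x(3)] adjf'[OF x(3)] by auto
    then show "x' \<in> S' \<longleftrightarrow> y' \<in> S'" using x S(2) mem[OF xN sub] mem[OF x(3) sub] by simp
  qed
  have col: "collapse E' (\<sigma> f) (\<sigma> x) = \<sigma> (collapse E f x)" if "x \<in> N" for x
    unfolding collapse_def using adjf'[OF that] by simp
  have colN: "collapse E f x \<in> N" if "x \<in> N" for x unfolding collapse_def using f that by simp
  have NN: "N' - nb E' (\<sigma> f) = \<sigma> ` (N - nb E f)"
    unfolding nbs N'[symmetric] using inj_on_image_set_diff[OF inj, of N "nb E f"] nbN by simp
  have "capped_system (N' - nb E' (\<sigma> f)) (graph_quot E' (\<sigma> f)) (star_quot E' V' (\<sigma> f))"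
  proof (rule cap.IH)
    show "bij_betw \<sigma> (N - nb E f) (N' - nb E' (\<sigma> f))"
      unfolding NN bij_betw_def using inj_on_subset[OF inj] by blast
    show "graph_quot E' (\<sigma> f) x' y' \<Longrightarrow> x' \<in> N' - nb E' (\<sigma> f) \<and> y' \<in> N' - nb E' (\<sigma> f)" for x' y'
      using graph_on_quot[OF G' sN[OF f]] unfolding graph_on_def by metis
    show "graph_quot E f x y \<longleftrightarrow> graph_quot E' (\<sigma> f) (\<sigma> x) (\<sigma> y)"
      if "x \<in> N - nb E f" "y \<in> N - nb E f" for x y
    proof
      assume "graph_quot E f x y"
      then obtain u w where u: "x \<noteq> y" "E u w" "collapse E f u = x" "collapse E f w = y"
        unfolding graph_quot_def by blast
      have N: "u \<in> N" "w \<in> N" using EN u by blast+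
      show "graph_quot E' (\<sigma> f) (\<sigma> x) (\<sigma> y)" unfolding graph_quot_def
        using u N that col[OF N(1)] col[OF N(2)] adj[OF N] seq[of x y] by (metis DiffD1)
    next
      assume "graph_quot E' (\<sigma> f) (\<sigma> x) (\<sigma> y)"
      then obtain u' w' where u: "\<sigma> x \<noteq> \<sigma> y" "E' u' w'" "collapse E' (\<sigma> f) u' = \<sigma> x" "collapse E' (\<sigma> f) w' = \<sigma> y"
        unfolding graph_quot_def by blast
      obtain u w where v: "E u w" "u' = \<sigma> u" "w' = \<sigma> w" using adjE[OF u(2)] by blast
      have N: "u \<in> N" "w \<in> N" using EN v by blast+
      have "collapse E f u = x" "collapse E f w = y"
        using u v that col[OF N(1)] col[OF N(2)] seq[OF colN[OF N(1)]] seq[OF colN[OF N(2)]] by auto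
      then show "graph_quot E f x y" unfolding graph_quot_def using v u by blast
    qed
    have ci: "collapse E' (\<sigma> f) ` \<sigma> ` S = \<sigma> ` collapse E f ` S" if "S \<in> V" for S
      using col Vsub that unfolding image_image by (intro image_cong) auto
    have fm: "\<sigma> f \<notin> \<sigma> ` S \<longleftrightarrow> f \<notin> S" if "S \<in> V" for S using mem[OF f, of S] that Vsub by blast
    have "star_quot E' V' (\<sigma> f) = (\<lambda>S. collapse E' (\<sigma> f) ` \<sigma> ` S) ` {S \<in> V. f \<notin> S}"
      unfolding star_quot_def cap.prems(4) using fm by auto
    also have "\<dots> = (\<lambda>S. \<sigma> ` collapse E f ` S) ` {S \<in> V. f \<notin> S}"
      using ci by (intro image_cong) auto
    also have "\<dots> = (`) \<sigma> ` star_quot E V f" unfolding star_quot_def by (simp add: image_image)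
    finally show "star_quot E' V' (\<sigma> f) = (`) \<sigma> ` star_quot E V f" .
  qed
  with G' sN[OF f] V'sub fcap' fdist' W' show ?case by (rule capped_system.cap)
qed

section \<open>Gluing a cube onto a system\<close>

text \<open>
  The system of \<open>P = Q \<union> C\<close> when no facet crosses: \<open>\<tau>\<close> maps a side of the cube to the facet of \<open>Q\<close> that
  meets \<open>F\<close> in the same ridge. The opposite \<open>H\<close> of \<open>F\<close> is the top of the cap, \<open>\<tau> x\<close> is the exit of the
  side \<open>x\<close>, and collapsing at \<open>H\<close> gives a copy of the system of \<open>Q\<close> in which \<open>F\<close> is renamed to \<open>H\<close>.
\<close>

lemma capped_system_glue:
  assumes K: "capped_system NQ EB VQ" and FQ: "F \<in> NQ"
    and cube: "cube_with \<alpha> NC EC VC" and FC: "F \<in> NC" and big: "6 \<le> card NC"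
    and int: "NQ \<inter> NC = {F}"
    and \<tau>: "bij_betw \<tau> (nb EC F) (nb EB F)"
    and NP: "NP = (NQ \<union> NC) - {F}"
    and EP: "\<And>x y. EP x y \<longleftrightarrow>
      (x \<noteq> F \<and> y \<noteq> F \<and> (EB x y \<or> EC x y)) \<or> (EC F x \<and> y = \<tau> x) \<or> (EC F y \<and> x = \<tau> y)"
    and VP: "VP = {S \<in> VQ. F \<notin> S} \<union> {S \<in> VC. F \<notin> S} \<union>
      {(S - {F}) \<union> {x \<in> nb EC F. \<tau> x \<in> S} | S. S \<in> VQ \<and> F \<in> S}"
    and matched: "\<And>S. S \<in> VQ \<Longrightarrow> F \<in> S \<Longrightarrow> insert F {x \<in> nb EC F. \<tau> x \<in> S} \<in> VC"
  shows "capped_system NP EP VP"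
proof -
  define H where "H = \<alpha> F"
  note GQ = conjunct1[OF capped_system_graph[OF K]] and VQsub = conjunct2[OF capped_system_graph[OF K]]
  have EB: "\<And>x y. EB x y \<Longrightarrow> x \<in> NQ \<and> y \<in> NQ \<and> x \<noteq> y \<and> EB y x" using GQ unfolding graph_on_def by blast
  note EC = cube_adj[OF cube] and opp = cube_opp[OF cube] and VC = cube_star[OF cube]
  have H: "H \<in> NC" "H \<noteq> F" "\<alpha> H = F" using opp[OF FC] unfolding H_def by auto
  have HQ: "H \<notin> NQ" using H int by blast
  have nbC: "EC F x \<longleftrightarrow> x \<in> NC \<and> x \<noteq> F \<and> x \<noteq> H" for x using EC FC unfolding H_def by blast
  have nbCQ: "x \<notin> NQ" if "EC F x" for x using that nbC int by blast
  have t: "EB F (\<tau> x)" if "EC F x" for x using \<tau> that unfolding bij_betw_def nb_def by blast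
  have tQ: "\<tau> x \<in> NQ" "\<tau> x \<noteq> F" if "EC F x" for x using EB[OF t[OF that]] by auto
  have tinj: "x = y" if "EC F x" "EC F y" "\<tau> x = \<tau> y" for x y
    using \<tau> that unfolding bij_betw_def inj_on_def by simp
  have tsurj: "\<exists>x. EC F x \<and> y = \<tau> x" if "EB F y" for y
  proof -
    have "y \<in> \<tau> ` nb EC F" using \<tau> that unfolding bij_betw_def by simp
    then show ?thesis by auto
  qed
  have ECN: "x \<in> NC \<and> y \<in> NC" if "EC x y" for x y using that EC by blast
  have oppn: "EC F (\<alpha> x)" "\<alpha> x \<noteq> x" "\<alpha> (\<alpha> x) = x" if "EC F x" for x
  proof -
    have x: "x \<in> NC" "x \<noteq> F" "x \<noteq> H" using that nbC by auto
    show "\<alpha> x \<noteq> x" "\<alpha> (\<alpha> x) = x" using opp[OF x(1)] by auto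
    then have "\<alpha> x \<noteq> F" "\<alpha> x \<noteq> H" using x H unfolding H_def by metis+
    then show "EC F (\<alpha> x)" using nbC opp[OF x(1)] by blast
  qed
  have P_H: "EP H y \<longleftrightarrow> EC F y" for y
  proof
    assume "EP H y"
    then consider "y \<noteq> F" "EB H y" | "y \<noteq> F" "EC H y" | "EC F H" | "EC F y" "H = \<tau> y" unfolding EP by blast
    then show "EC F y"
    proof cases
      case 2 then show ?thesis using nbC EC[of H y] by blast
    qed (use EB HQ nbC tQ in metis)+
  next
    assume "EC F y"
    then have "EC H y" "y \<noteq> F" using nbC[of y] EC[of H y] H by auto
    then show "EP H y" unfolding EP using H(2) by blast
  qed
  have nbP: "nb EP H = nb EC F" unfolding nb_def P_H ..
  have P_side: "EP x y \<longleftrightarrow> (y \<noteq> F \<and> EC x y) \<or> y = \<tau> x" if x: "EC F x" for x y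
  proof -
    have "x \<noteq> F" "x \<notin> NQ" using x nbC nbCQ by auto
    moreover have "\<not> EB x y" using calculation EB by blast
    moreover have "\<not> (EC F y \<and> x = \<tau> y)" using calculation tQ by blast
    ultimately show ?thesis unfolding EP using x by blast
  qed
  have P_side2: "EP x y \<longleftrightarrow> EC x y" if "EC F x" "EC F y" for x y
    unfolding P_side[OF that(1)] using that(2) nbC[of y] nbCQ[OF that(2)] tQ[OF that(1)] by metis
  have P_exit: "EP x y \<and> y \<noteq> H \<and> \<not> EC F y \<longleftrightarrow> y = \<tau> x" if x: "EC F x" for x y
  proof -
    have "y = H \<or> EC F y" if "y \<noteq> F" "EC x y" using that ECN nbC by blast
    moreover have "\<tau> x \<noteq> H" "\<not> EC F (\<tau> x)" using tQ[OF x] HQ nbCQ by metis+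
    ultimately show ?thesis unfolding P_side[OF x] by blast
  qed
  have side_mate: "y = \<alpha> x \<longleftrightarrow> EC F y \<and> y \<noteq> x \<and> \<not> EP x y" if x: "EC F x" for x y
  proof
    assume y: "y = \<alpha> x"
    have "\<not> EC x y" using EC[of x y] y by blast
    then show "EC F y \<and> y \<noteq> x \<and> \<not> EP x y" using oppn[OF x] P_side2[OF x, of y] y by metis
  next
    assume y: "EC F y \<and> y \<noteq> x \<and> \<not> EP x y"
    then have "\<not> EC x y" using P_side2[OF x] by blast
    then show "y = \<alpha> x" using EC[of x y] x y nbC by blast
  qed
  have GP: "graph_on NP EP" unfolding graph_on_def
  proof (intro conjI allI impI)
    show "finite NP" using GQ cube_finite[OF cube] unfolding NP graph_on_def by simp
    fix x y assume "EP x y"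
    then consider "x \<noteq> F" "y \<noteq> F" "EB x y" | "x \<noteq> F" "y \<noteq> F" "EC x y" | "EC F x" "y = \<tau> x" | "EC F y" "x = \<tau> y"
      unfolding EP by blast
    then have "x \<in> NP \<and> y \<in> NP \<and> x \<noteq> y \<and> EP y x"
    proof cases
      case 1 then show ?thesis using EB[OF 1(3)] unfolding NP EP by blast
    next
      case 2
      have "EC y x" using 2 EC opp by metis
      then show ?thesis using 2 EC[of x y] unfolding NP EP by blast
    next
      case 3 then show ?thesis using tQ[OF 3(1)] nbC[of x] nbCQ[OF 3(1)] unfolding NP EP by auto
    next
      case 4 then show ?thesis using tQ[OF 4(1)] nbC[of y] nbCQ[OF 4(1)] unfolding NP EP by auto
    qed
    then show "x \<in> NP" "y \<in> NP" "x \<noteq> y" "EP y x" by auto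
  qed
  have HP: "H \<in> NP" using H unfolding NP by blast
  have nbC': "nb EC F = NC - {F, H}" unfolding nb_def using nbC by blast
  have fcap: "cap_node EP H" unfolding cap_node_def nbP P_H
  proof (intro conjI allI impI)
    have "card (NC - {F, H}) = card NC - 2"
      using FC H cube_finite[OF cube] by (subst card_Diff_subset) auto
    then show "4 \<le> card (nb EC F)" using big unfolding nbC' by simp
    fix x assume x: "EC F x"
    show "\<exists>!y. EC F y \<and> y \<noteq> x \<and> \<not> EP x y" unfolding side_mate[OF x, symmetric] by simp
    show "\<exists>!y. EP x y \<and> y \<noteq> H \<and> \<not> EC F y" unfolding P_exit[OF x] by simp
  qed
  have fdist: "exits_distinct EP H" unfolding exits_distinct_def P_H
  proof (intro allI impI)
    fix x y z assume h: "EC F x" "EC F y" "EP x z" "EP y z" "z \<noteq> H" "\<not> EC F z"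
    then have "z = \<tau> x" "z = \<tau> y" using P_exit by blast+
    then show "x = y" using tinj h(1,2) by simp
  qed
  have trans: "transversal EP H T \<longleftrightarrow> T \<subseteq> nb EC F \<and> (\<forall>x. EC F x \<longrightarrow> (x \<in> T \<longleftrightarrow> \<alpha> x \<notin> T))" for T
    unfolding transversal_def nbP P_H using side_mate by metis
  have VPcases: "(S \<in> VQ \<and> F \<notin> S \<and> S \<subseteq> NQ) \<or> (S \<in> VC \<and> F \<notin> S \<and> H \<in> S) \<or>
     (\<exists>S0. S0 \<in> VQ \<and> F \<in> S0 \<and> S = (S0 - {F}) \<union> {x \<in> nb EC F. \<tau> x \<in> S0})" if "S \<in> VP" for S
  proof -
    have "S \<in> VC \<Longrightarrow> F \<notin> S \<Longrightarrow> H \<in> S" using VC FC unfolding H_def by metis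
    moreover have "S \<in> VQ \<Longrightarrow> S \<subseteq> NQ" using VQsub by blast
    ultimately show ?thesis using that unfolding VP by blast
  qed
  have side_star: "\<exists>S0. S0 \<in> VQ \<and> F \<in> S0 \<and> S = (S0 - {F}) \<union> {x \<in> nb EC F. \<tau> x \<in> S0}"
    if S: "S \<in> VP" "H \<notin> S" "S \<inter> nb EC F \<noteq> {}" for S
  proof -
    have "\<not> S \<subseteq> NQ" using S(3) nbCQ by auto
    then show ?thesis using VPcases[OF S(1)] S(2) by blast
  qed
  have W: "caps EP VP H"
  proof (rule capsI)
    fix S assume HS: "H \<in> S"
    have "S \<in> VP \<longleftrightarrow> S \<in> VC \<and> F \<notin> S"
    proof
      assume S: "S \<in> VP"
      have "\<not> S \<subseteq> NQ" using HS HQ by blast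
      moreover have "S \<noteq> (S0 - {F}) \<union> {x \<in> nb EC F. \<tau> x \<in> S0}" if "S0 \<in> VQ" for S0
        using HS HQ that VQsub nbC[of H] by auto
      ultimately show "S \<in> VC \<and> F \<notin> S" using VPcases[OF S] by blast
    qed (simp add: VP)
    also have "\<dots> \<longleftrightarrow> transversal EP H (S - {H})"
    proof
      assume S: "S \<in> VC \<and> F \<notin> S"
      then have sub: "S \<subseteq> NC" and flip: "\<And>x. x \<in> NC \<Longrightarrow> x \<in> S \<longleftrightarrow> \<alpha> x \<notin> S" using VC by auto
      show "transversal EP H (S - {H})" unfolding trans nbC'
      proof (intro conjI allI impI)
        show "S - {H} \<subseteq> NC - {F, H}" using sub S by blast
        fix x assume x: "EC F x"
        have "x \<noteq> H" "\<alpha> x \<noteq> H" "x \<in> NC" using x oppn(1)[OF x] nbC by metis+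
        then show "x \<in> S - {H} \<longleftrightarrow> \<alpha> x \<notin> S - {H}" using flip by blast
      qed
    next
      assume T: "transversal EP H (S - {H})"
      then have sub: "S - {H} \<subseteq> NC - {F, H}" and flip: "\<And>x. EC F x \<Longrightarrow> x \<in> S - {H} \<longleftrightarrow> \<alpha> x \<notin> S - {H}"
        unfolding trans nbC' by auto
      have FS: "F \<notin> S" using sub H(2) by auto
      have "x \<in> S \<longleftrightarrow> \<alpha> x \<notin> S" if x: "x \<in> NC" for x
      proof -
        consider "x = F" | "x = H" | "EC F x" using nbC x by blast
        then show ?thesis
        proof cases
          case 1 show ?thesis unfolding 1 using FS HS H_def by simp
        next
          case 2 show ?thesis unfolding 2 H(3) using FS HS by simp
        next
          case 3
          have "x \<noteq> H" "\<alpha> x \<noteq> H" using 3 oppn(1)[OF 3] nbC by metis+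
          then show ?thesis using flip[OF 3] by blast
        qed
      qed
      moreover have "S \<subseteq> NC" using sub H(1) by auto
      ultimately show "S \<in> VC \<and> F \<notin> S" unfolding VC using FS by simp
    qed
    finally show "S \<in> VP \<longleftrightarrow> transversal EP H (S - {H})" .
  next
    fix S assume S: "S \<in> VP" "H \<notin> S" "S \<inter> nb EP H \<noteq> {}"
    then obtain S0 where S0: "S0 \<in> VQ" "F \<in> S0" "S = (S0 - {F}) \<union> {x \<in> nb EC F. \<tau> x \<in> S0}"
      using side_star[OF S(1,2) S(3)[unfolded nbP]] by blast
    have "x \<notin> S0" if "EC F x" for x using nbCQ[OF that] S0(1) VQsub by blast
    then have eq: "S \<inter> nb EP H = {x \<in> nb EC F. \<tau> x \<in> S0}"
      unfolding nbP S0(3) by auto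
    have flip: "x \<in> NC \<Longrightarrow> x \<in> insert F {x \<in> nb EC F. \<tau> x \<in> S0} \<longleftrightarrow> \<alpha> x \<notin> insert F {x \<in> nb EC F. \<tau> x \<in> S0}" for x
      using conjunct2[OF VC[THEN iffD1, OF matched[OF S0(1,2)]]] by blast
    show "transversal EP H (S \<inter> nb EP H)" unfolding eq trans
    proof (intro conjI allI impI)
      fix x assume x: "EC F x"
      have "x \<noteq> F" "\<alpha> x \<noteq> F" "x \<in> NC" using x oppn(1)[OF x] nbC by metis+
      then show "x \<in> {x \<in> nb EC F. \<tau> x \<in> S0} \<longleftrightarrow> \<alpha> x \<notin> {x \<in> nb EC F. \<tau> x \<in> S0}"
        using flip[of x] by blast
    qed blast
  next
    fix S x y assume S: "S \<in> VP" "H \<notin> S" "S \<inter> nb EP H \<noteq> {}"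
      and x: "EP H x" "EP x y" "y \<noteq> H" "\<not> EP H y"
    then obtain S0 where S0: "S0 \<in> VQ" "F \<in> S0" "S = (S0 - {F}) \<union> {x \<in> nb EC F. \<tau> x \<in> S0}"
      using side_star[OF S(1,2) S(3)[unfolded nbP]] by blast
    have xF: "EC F x" using x(1) unfolding P_H .
    have y: "y = \<tau> x" using x P_exit[OF xF] unfolding P_H by blast
    have "x \<notin> S0" using nbCQ[OF xF] S0(1) VQsub by blast
    then have "x \<in> S \<longleftrightarrow> \<tau> x \<in> S0" using S0(3) xF by simp
    moreover have "\<tau> x \<in> S \<longleftrightarrow> \<tau> x \<in> S0"
      using S0(3) tQ[OF xF] nbCQ[of "\<tau> x"] by auto
    ultimately show "x \<in> S \<longleftrightarrow> y \<in> S" using y by simp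
  qed
  have VPsub: "VP \<subseteq> Pow NP"
  proof
    fix S assume S: "S \<in> VP"
    show "S \<in> Pow NP" using VPcases[OF S]
    proof (elim disjE exE conjE)
      assume "S \<in> VC" "F \<notin> S" then show ?thesis using VC unfolding NP by blast
    next
      fix S0 assume S0: "S0 \<in> VQ" "S = (S0 - {F}) \<union> {x \<in> nb EC F. \<tau> x \<in> S0}"
      then show ?thesis using VQsub unfolding NP nbC' by blast
    qed (auto simp: NP)
  qed
  define \<sigma> where "\<sigma> x = (if x = F then H else x)" for x
  have col: "collapse EP H u = x \<longleftrightarrow> u = x" if "x \<in> NQ" for u x
  proof -
    have "x \<noteq> H" "\<not> EC F x" using that HQ nbCQ by metis+
    then show ?thesis unfolding collapse_def P_H by auto
  qed
  have colH: "collapse EP H u = H \<longleftrightarrow> u = H \<or> EC F u" for u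
    unfolding collapse_def P_H by simp
  have P_Q: "EP x y \<longleftrightarrow> EB x y" if "x \<in> NQ" "y \<in> NQ" "x \<noteq> F" "y \<noteq> F" for x y
  proof -
    have "\<not> EC x y" "\<not> EC F x" "\<not> EC F y" using that ECN int nbCQ by blast+
    then show ?thesis unfolding EP using that by blast
  qed
  have Gq: "graph_on (NP - nb EP H) (graph_quot EP H)" using graph_on_quot[OF GP HP] .
  have quotF: "graph_quot EP H H y \<longleftrightarrow> EB F y" if y: "y \<in> NQ" "y \<noteq> F" for y
  proof -
    have "graph_quot EP H H y \<longleftrightarrow> (\<exists>u. (u = H \<or> EC F u) \<and> EP u y)"
      unfolding graph_quot_def colH col[OF y(1)] using y HQ by blast
    also have "\<dots> \<longleftrightarrow> (\<exists>u. EC F u \<and> EP u y)" using P_H nbCQ y by blast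
    also have "\<dots> \<longleftrightarrow> (\<exists>u. EC F u \<and> y = \<tau> u)"
    proof -
      have "EC u y \<Longrightarrow> False" for u using ECN int y by blast
      then show ?thesis using P_side by blast
    qed
    also have "\<dots> \<longleftrightarrow> EB F y" using t tsurj by blast
    finally show ?thesis .
  qed
  have "capped_system (NP - nb EP H) (graph_quot EP H) (star_quot EP VP H)"
  proof (rule capped_system_image[OF K, of \<sigma>])
    show "bij_betw \<sigma> NQ (NP - nb EP H)"
    proof -
      have "NP - nb EP H = insert H (NQ - {F})"
        unfolding nbP nbC' NP using H HQ int FQ by auto
      moreover have "\<sigma> ` NQ = insert H (NQ - {F})" unfolding \<sigma>_def using FQ by auto
      moreover have "inj_on \<sigma> NQ" unfolding \<sigma>_def inj_on_def using HQ by auto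
      ultimately show ?thesis unfolding bij_betw_def by simp
    qed
    show "graph_quot EP H x y \<Longrightarrow> x \<in> NP - nb EP H \<and> y \<in> NP - nb EP H" for x y
      using Gq unfolding graph_on_def by blast
    have symq: "graph_quot EP H y x" if "graph_quot EP H x y" for x y
      using Gq that unfolding graph_on_def by blast
    show "EB x y \<longleftrightarrow> graph_quot EP H (\<sigma> x) (\<sigma> y)" if N: "x \<in> NQ" "y \<in> NQ" for x y
    proof -
      consider "x = F" "y = F" | "x = F" "y \<noteq> F" | "x \<noteq> F" "y = F" | "x \<noteq> F" "y \<noteq> F" by blast
      then show ?thesis
      proof cases
        case 1 then show ?thesis using EB[of F F] unfolding graph_quot_def by blast
      next
        case 2 then show ?thesis using quotF[OF N(2)] unfolding \<sigma>_def by simp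
      next
        case 3 then show ?thesis using quotF[OF N(1)] EB[of x F] EB[of F x] symq unfolding \<sigma>_def by auto
      next
        case 4
        have "graph_quot EP H x y \<longleftrightarrow> x \<noteq> y \<and> EP x y"
          unfolding graph_quot_def col[OF N(1)] col[OF N(2)] by blast
        then show ?thesis using 4 P_Q[OF N 4] EB[of x y] unfolding \<sigma>_def by auto
      qed
    qed
    have sid: "\<sigma> ` S = S" if "F \<notin> S" for S using that unfolding \<sigma>_def by force
    have c1: "collapse EP H ` S = S" if "S \<subseteq> NQ" for S
      using that nbCQ by (intro collapse_image_away) (auto simp: nbP)
    have c3: "collapse EP H ` ((S - {F}) \<union> {x \<in> nb EC F. \<tau> x \<in> S}) = \<sigma> ` S" if S: "S \<in> VQ" "F \<in> S" for S
    proof -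
      obtain x where x: "EC F x" using cap_node_pick[OF fcap, of F F F] unfolding P_H by blast
      have xN: "x \<in> NC" "x \<noteq> F" "\<alpha> x \<noteq> F" using x oppn(1)[OF x] nbC by metis+
      have "\<tau> x \<in> S \<or> \<tau> (\<alpha> x) \<in> S"
        using matched[OF S] xN x unfolding VC by auto
      then have ne: "{x \<in> nb EC F. \<tau> x \<in> S} \<noteq> {}" using x oppn(1)[OF x] by auto
      have "collapse EP H ` {x \<in> nb EC F. \<tau> x \<in> S} = {H}"
        using ne unfolding collapse_def P_H by auto
      moreover have "collapse EP H ` (S - {F}) = S - {F}" using S VQsub by (intro c1) blast
      moreover have "\<sigma> ` S = insert H (S - {F})" using S(2) unfolding \<sigma>_def by auto
      ultimately show ?thesis by (simp add: image_Un)
    qed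
    show "star_quot EP VP H = (`) \<sigma> ` VQ"
    proof (intro equalityI subsetI)
      fix S' assume "S' \<in> star_quot EP VP H"
      then obtain S where S: "S \<in> VP" "H \<notin> S" "S' = collapse EP H ` S" unfolding star_quot_def by blast
      from VPcases[OF S(1)] show "S' \<in> (`) \<sigma> ` VQ"
      proof (elim disjE exE conjE)
        assume "S \<in> VQ" "F \<notin> S" "S \<subseteq> NQ"
        then show ?thesis using S(3) c1 sid by (intro image_eqI[of _ _ S]) auto
      next
        assume "H \<in> S" then show ?thesis using S(2) by blast
      next
        fix S0 assume "S0 \<in> VQ" "F \<in> S0" "S = (S0 - {F}) \<union> {x \<in> nb EC F. \<tau> x \<in> S0}"
        then show ?thesis using S(3) c3 by (intro image_eqI[of _ _ S0]) auto
      qed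
    next
      fix S' assume "S' \<in> (`) \<sigma> ` VQ"
      then obtain S where S: "S \<in> VQ" "S' = \<sigma> ` S" by blast
      have sub: "S \<subseteq> NQ" using S VQsub by blast
      show "S' \<in> star_quot EP VP H"
      proof (cases "F \<in> S")
        case False
        then show ?thesis
          using S sub HQ sid[OF False] c1[OF sub] by (intro star_quotI[of S]) (auto simp: VP)
      next
        case True
        let ?S = "(S - {F}) \<union> {x \<in> nb EC F. \<tau> x \<in> S}"
        have "?S \<in> VP" using S(1) True unfolding VP by blast
        moreover have "H \<notin> ?S" using sub HQ nbC[of H] by auto
        ultimately show ?thesis using c3[OF S(1) True] S(2) by (intro star_quotI[of ?S]) auto
      qed
    qed
  qed
  then show ?thesis using capped_system.cap[OF GP HP VPsub fcap fdist W] by blast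
qed

section \<open>Ridges, neighbouring facets and lattice isomorphisms\<close>

definition vertex_star :: "'a::euclidean_space set \<Rightarrow> 'a \<Rightarrow> 'a set set" where
  "vertex_star P v = {F. F facet_of P \<and> v \<in> F}"

definition vertex_stars :: "'a::euclidean_space set \<Rightarrow> 'a set set set" where
  "vertex_stars P = vertex_star P ` {v. v extreme_point_of P}"

lemma face_eq_of_aff_dim:
  fixes T U :: "'a::euclidean_space set"
  assumes "T face_of S" "U face_of S" "T \<subseteq> U" "aff_dim T = aff_dim U"
  shows "T = U"
proof (rule ccontr)
  assume "T \<noteq> U"
  moreover have "T face_of U" using assms face_of_face by blast
  ultimately show False
    using face_of_aff_dim_lt[of U T] face_of_imp_convex[OF assms(2)] assms(4) by simp
qed

lemma facet_eq_of_subset: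
  fixes F G :: "'a::euclidean_space set"
  assumes "F facet_of P" "G facet_of P" "F \<subseteq> G" shows "F = G"
  using face_eq_of_aff_dim[of F P G] assms unfolding facet_of_def by simp

lemma facet_polytope: "polytope P \<Longrightarrow> F facet_of P \<Longrightarrow> polytope F"
  using face_of_polytope_polytope facet_of_imp_face_of by blast

text \<open>
  Modulo the ridge the polytope is a plane cone, which has only two boundary rays: a point of \<open>K\<close> off the
  ridge is a combination of points of \<open>F\<close> and \<open>G\<close> modulo the affine hull of \<open>R\<close>, the functionals of \<open>F\<close>
  and \<open>G\<close> force both coefficients to be positive, and then the functional of \<open>K\<close> is not tight at it.
\<close>

lemma no_three_facets_on_ridge:
  fixes P :: "'a::euclidean_space set"
  assumes P: "polytope P" and F: "F facet_of P" and G: "G facet_of P" and K: "K facet_of P"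
    and distinct: "F \<noteq> G" "F \<noteq> K" "G \<noteq> K"
    and R: "R face_of P" "aff_dim R = aff_dim P - 2" and sub: "R \<subseteq> F" "R \<subseteq> G" "R \<subseteq> K"
  shows False
proof -
  have cv: "convex P" and ph: "polyhedron P"
    using P polytope_imp_convex polytope_imp_polyhedron by auto
  have support: "\<exists>a b. P \<subseteq> {x. a \<bullet> x \<le> b} \<and> X = P \<inter> {x. a \<bullet> x = b}" if "X facet_of P" for X
    using facet_of_polyhedron[OF ph that] by metis
  obtain u cu where u: "P \<subseteq> {x. u \<bullet> x \<le> cu}" "F = P \<inter> {x. u \<bullet> x = cu}" using support[OF F] by blast
  obtain v cv where v: "P \<subseteq> {x. v \<bullet> x \<le> cv}" "G = P \<inter> {x. v \<bullet> x = cv}" using support[OF G] by blast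
  obtain w cw where w: "P \<subseteq> {x. w \<bullet> x \<le> cw}" "K = P \<inter> {x. w \<bullet> x = cw}" using support[OF K] by blast
  have rel: "\<exists>x. x \<in> X \<and> x \<notin> Y \<and> x \<notin> Z"
    if X: "X facet_of P" and Y: "Y facet_of P" "X \<noteq> Y" and Z: "Z facet_of P" "X \<noteq> Z" for X Y Z
  proof -
    have "convex X" "X \<noteq> {}" using X facet_of_imp_face_of face_of_imp_convex unfolding facet_of_def by blast+
    then obtain x where x: "x \<in> rel_interior X" using rel_interior_eq_empty by blast
    have "x \<notin> W" if W: "W facet_of P" "X \<noteq> W" for W
    proof
      assume "x \<in> W"
      then have "X \<subseteq> W"
        using subset_of_face_of[OF facet_of_imp_face_of[OF W(1)] facet_of_imp_subset[OF X]] x by blast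
      then show False using facet_eq_of_subset[OF X W(1)] W(2) by blast
    qed
    then show ?thesis using x rel_interior_subset Y Z by blast
  qed
  obtain f where f: "f \<in> F" "f \<notin> G" "f \<notin> K" using rel[OF F G _ K] distinct by blast
  obtain g where g: "g \<in> G" "g \<notin> F" "g \<notin> K" using rel[OF G F _ K] distinct by blast
  obtain k where k: "k \<in> K" "k \<notin> F" "k \<notin> G" using rel[OF K F _ G] distinct by blast
  have inP: "f \<in> P" "g \<in> P" "k \<in> P" using f g k u v w by auto
  have strict: "v \<bullet> f < cv" "w \<bullet> f < cw" "u \<bullet> g < cu" "w \<bullet> g < cw" "u \<bullet> k < cu" "v \<bullet> k < cv"
    using f g k inP u v w by (auto simp: less_le)
  have tight: "u \<bullet> f = cu" "v \<bullet> g = cv" "w \<bullet> k = cw" using f g k u v w by auto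
  \<comment> \<open>Modulo \<open>R\<close> the polytope is two-dimensional: every point of its affine hull is
    \<open>l f + m g\<close> up to \<open>R\<close>, which is read off by the three functionals.\<close>
  define A where "A = {y. \<exists>l  m . u \<bullet> y - cu = m  * (u \<bullet> g - cu) \<and> v \<bullet> y - cv = l  * (v \<bullet> f - cv) \<and>
      w \<bullet> y - cw = l  * (w \<bullet> f - cw) + m  * (w \<bullet> g - cw)}"
  have "affine A" unfolding affine_def
  proof (intro ballI allI impI)
    fix x y and p q :: real
    assume x: "x \<in> A" and y: "y \<in> A" and pq: "p + q = 1"
    obtain l m where 1: "u \<bullet> x - cu = m * (u \<bullet> g - cu)" "v \<bullet> x - cv = l * (v \<bullet> f - cv)"
      "w \<bullet> x - cw = l * (w \<bullet> f - cw) + m * (w \<bullet> g - cw)" using x unfolding A_def by blast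
    obtain l' m' where 2: "u \<bullet> y - cu = m' * (u \<bullet> g - cu)" "v \<bullet> y - cv = l' * (v \<bullet> f - cv)"
      "w \<bullet> y - cw = l' * (w \<bullet> f - cw) + m' * (w \<bullet> g - cw)" using y unfolding A_def by blast
    have comb: "a \<bullet> (p *\<^sub>R x + q *\<^sub>R y) - c = p * (a \<bullet> x - c) + q * (a \<bullet> y - c)" for a c
    proof -
      have "a \<bullet> (p *\<^sub>R x + q *\<^sub>R y) - c = a \<bullet> (p *\<^sub>R x + q *\<^sub>R y) - (p + q) * c" using pq by simp
      then show ?thesis by (simp add: inner_add_right algebra_simps)
    qed
    show "p *\<^sub>R x + q *\<^sub>R y \<in> A" unfolding A_def mem_Collect_eq comb 1 2
      by (rule exI[of _ "p * l + q * l'"], rule exI[of _ "p * m + q * m'"]) (simp add: algebra_simps)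
  qed
  moreover have "insert g (insert f R) \<subseteq> A"
  proof -
    have "f \<in> A" unfolding A_def using tight by (intro CollectI exI[of _ 1] exI[of _ 0]) simp
    moreover have "g \<in> A" unfolding A_def using tight by (intro CollectI exI[of _ 0] exI[of _ 1]) simp
    moreover have "R \<subseteq> A"
    proof
      fix r assume "r \<in> R"
      then have "u \<bullet> r = cu" "v \<bullet> r = cv" "w \<bullet> r = cw" using sub u v w by auto
      then show "r \<in> A" unfolding A_def by (intro CollectI exI[of _ 0]) simp
    qed
    ultimately show ?thesis by blast
  qed
  ultimately have hull: "affine hull (insert g (insert f R)) \<subseteq> A" by (simp add: hull_minimal)
  have inter: "x \<in> T" if "T face_of P" "x \<in> P" "x \<in> affine hull T" for x T
    using face_of_imp_eq_affine_Int[OF cv that(1)] that by blast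
  have fR: "f \<notin> affine hull R" using inter[OF R(1) inP(1)] f(2) sub(2) by blast
  have dimF: "aff_dim F = aff_dim P - 1" using F unfolding facet_of_def by simp
  have dfR: "aff_dim (insert f R) = aff_dim F" using fR R(2) dimF by (simp add: aff_dim_insert)
  then have hullF: "affine hull (insert f R) = affine hull F"
    using aff_dim_eq_full_gen[of "insert f R" F] f(1) sub(1) by blast
  have "g \<notin> affine hull F" using inter[OF facet_of_imp_face_of[OF F] inP(2)] g(2) by blast
  then have "aff_dim (insert g (insert f R)) = aff_dim P"
    using dfR dimF hullF aff_dim_insert[of g "insert f R"] by simp
  then have "affine hull (insert g (insert f R)) = affine hull P"
    using aff_dim_eq_full_gen[of "insert g (insert f R)" P] inP face_of_imp_subset[OF R(1)] by blast
  then have "k \<in> A" using hull inP(3) hull_subset[of P affine] by blast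
  then obtain l m where lm: "u \<bullet> k - cu = m * (u \<bullet> g - cu)" "v \<bullet> k - cv = l * (v \<bullet> f - cv)"
      "w \<bullet> k - cw = l * (w \<bullet> f - cw) + m * (w \<bullet> g - cw)" unfolding A_def by blast
  have "m > 0"
  proof -
    have "m * (u \<bullet> g - cu) < 0" using lm(1) strict by simp
    then show ?thesis using strict by (simp add: mult_less_0_iff)
  qed
  moreover have "l > 0"
  proof -
    have "l * (v \<bullet> f - cv) < 0" using lm(2) strict by simp
    then show ?thesis using strict by (simp add: mult_less_0_iff)
  qed
  ultimately have "l * (w \<bullet> f - cw) + m * (w \<bullet> g - cw) < 0"
    using strict by (intro add_neg_neg mult_pos_neg) auto
  then show False using lm(3) tight(3) by simp
qed

lemma ridge_other_facet:
  fixes P :: "'a::euclidean_space set"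
  assumes P: "polytope P" and F: "F facet_of P" and R: "R facet_of F"
  obtains G where "G facet_of P" "G \<noteq> F" "R = F \<inter> G" "\<And>K. K facet_of P \<Longrightarrow> R \<subseteq> K \<Longrightarrow> K = F \<or> K = G"
proof -
  have ph: "polyhedron P" using P polytope_imp_polyhedron by blast
  have Fp: "F face_of P" "aff_dim F = aff_dim P - 1" using F unfolding facet_of_def by auto
  have RF: "R face_of F" "R \<noteq> {}" "aff_dim R = aff_dim F - 1" using R unfolding facet_of_def by auto
  have RP: "R face_of P" using RF Fp face_of_trans by blast
  have RdP: "aff_dim R = aff_dim P - 2" using RF Fp by simp
  have "R = \<Inter>{G. G facet_of P \<and> R \<subseteq> G}"
    using face_of_polyhedron[OF ph RP RF(2)] RdP by fastforce
  moreover have "R \<noteq> F" using RF(3) by auto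
  ultimately obtain G where G: "G facet_of P" "R \<subseteq> G" "G \<noteq> F"
    using F face_of_imp_subset[OF RF(1)]
    by (metis (mono_tags, lifting) Inf_greatest mem_Collect_eq subset_antisym order_refl)
  have FG: "F \<inter> G face_of P" using face_of_Int[OF Fp(1) facet_of_imp_face_of[OF G(1)]] .
  have "F \<inter> G \<noteq> F" using facet_eq_of_subset[OF F G(1)] G(3) by blast
  moreover have "F \<inter> G face_of F" using FG face_of_face[OF Fp(1)] by blast
  ultimately have "aff_dim (F \<inter> G) < aff_dim F"
    using face_of_aff_dim_lt[OF face_of_imp_convex[OF Fp(1)]] by blast
  moreover have sub: "R \<subseteq> F \<inter> G" using G(2) face_of_imp_subset[OF RF(1)] by blast
  ultimately have "aff_dim (F \<inter> G) = aff_dim R" using aff_dim_subset[OF sub] RF(3) by linarith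
  then have "R = F \<inter> G" using face_eq_of_aff_dim[OF RP FG sub] by simp
  moreover have "K = F \<or> K = G" if "K facet_of P" "R \<subseteq> K" for K
    using no_three_facets_on_ridge[OF P F G(1) that(1) _ _ _ RP RdP _ G(2) that(2)] G(3)
      face_of_imp_subset[OF RF(1)] by blast
  ultimately show thesis using that G by blast
qed

lemma dual_adjacent_sym: "dual_adjacent P F G \<longleftrightarrow> dual_adjacent P G F"
  unfolding dual_adjacent_def by (auto simp: Int_commute)

lemma dual_adjacent_facet:
  fixes P :: "'a::euclidean_space set"
  assumes d: "2 \<le> aff_dim P" and F: "F facet_of P" and G: "G facet_of P"
  shows "dual_adjacent P F G \<longleftrightarrow> (F \<inter> G) facet_of F"
proof -
  have FG: "F \<inter> G face_of P" using face_of_Int facet_of_imp_face_of F G by blast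
  have "F \<inter> G face_of F" using FG face_of_face[OF facet_of_imp_face_of[OF F]] by blast
  moreover have "aff_dim F = aff_dim P - 1" using F unfolding facet_of_def by simp
  moreover have "F \<inter> G \<noteq> {}" if "aff_dim (F \<inter> G) = aff_dim P - 2"
  proof
    assume "F \<inter> G = {}"
    then have "aff_dim (F \<inter> G) = -1" by simp
    then show False using that d by linarith
  qed
  ultimately show ?thesis
    using F G FG unfolding dual_adjacent_def dual_nodes_def ridge_of_def facet_of_def[of "F \<inter> G"] by auto
qed

lemma dual_adjacent_neq:
  assumes "dual_adjacent P F G" shows "F \<noteq> G"
  using assms unfolding dual_adjacent_def dual_nodes_def ridge_of_def facet_of_def by auto

text \<open>
  This turns the number of facets of a facet into a degree of the dual graph.
\<close>

lemma neighbours_facets: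
  fixes P :: "'a::euclidean_space set"
  assumes P: "polytope P" and d: "2 \<le> aff_dim P" and F: "F facet_of P"
  shows "bij_betw (\<lambda>G. F \<inter> G) (nb (dual_adjacent P) F) (dual_nodes F)"
proof -
  have mem: "G facet_of P \<and> G \<noteq> F \<and> (F \<inter> G) facet_of F" if "G \<in> nb (dual_adjacent P) F" for G
  proof -
    have a: "dual_adjacent P F G" using that by simp
    then have G: "G facet_of P" unfolding dual_adjacent_def dual_nodes_def by blast
    then show ?thesis using dual_adjacent_facet[OF d F G] dual_adjacent_neq[OF a] a by blast
  qed
  have inj: "G = K" if G: "G \<in> nb (dual_adjacent P) F" and K: "K \<in> nb (dual_adjacent P) F"
    and eq: "F \<inter> G = F \<inter> K" for G K
  proof -
    note G = mem[OF G] and K = mem[OF K]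
    obtain G' where u: "\<And>K. K facet_of P \<Longrightarrow> F \<inter> G \<subseteq> K \<Longrightarrow> K = F \<or> K = G'"
      using ridge_other_facet[OF P F conjunct2[OF conjunct2[OF G]]] by metis
    have "G = G'" using u[of G] G by blast
    moreover have "K = G'" using u[of K] K eq by blast
    ultimately show ?thesis by simp
  qed
  have into: "X \<in> dual_nodes F" if "X \<in> (\<lambda>G. F \<inter> G) ` nb (dual_adjacent P) F" for X
    using that mem unfolding dual_nodes_def by blast
  have onto: "X \<in> (\<lambda>G. F \<inter> G) ` nb (dual_adjacent P) F" if "X \<in> dual_nodes F" for X
  proof -
    have X: "X facet_of F" using that unfolding dual_nodes_def by blast
    obtain G where G: "G facet_of P" "X = F \<inter> G" using ridge_other_facet[OF P F X] by metis
    then have "dual_adjacent P F G" using dual_adjacent_facet[OF d F G(1)] X by simp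
    then show ?thesis using G(2) by (intro image_eqI[of _ _ G]) auto
  qed
  show ?thesis unfolding bij_betw_def
  proof
    show "inj_on (\<lambda>G. F \<inter> G) (nb (dual_adjacent P) F)" using inj by (rule inj_onI)
    show "(\<lambda>G. F \<inter> G) ` nb (dual_adjacent P) F = dual_nodes F" using into onto by blast
  qed
qed

lemma finite_dual_nodes: "polytope P \<Longrightarrow> finite (dual_nodes P)"
  unfolding dual_nodes_def using finite_polytope_facets by blast

lemma face_lattice_iso_sub:
  "face_lattice_iso f P Q \<Longrightarrow> F face_of P \<Longrightarrow> G face_of P \<Longrightarrow> F \<subseteq> G \<longleftrightarrow> f F \<subseteq> f G"
  and face_lattice_iso_face: "face_lattice_iso f P Q \<Longrightarrow> F face_of P \<Longrightarrow> f F face_of Q"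
  unfolding face_lattice_iso_def bij_betw_def by auto

lemma face_lattice_iso_surj:
  "face_lattice_iso f P Q \<Longrightarrow> G face_of Q \<Longrightarrow> \<exists>F. F face_of P \<and> G = f F"
  unfolding face_lattice_iso_def bij_betw_def by blast

lemma face_lattice_iso_eq:
  assumes "face_lattice_iso f P Q" "F face_of P" "G face_of P" shows "f F = f G \<longleftrightarrow> F = G"
  using face_lattice_iso_sub[OF assms(1)] assms(2,3) by blast

lemma face_lattice_iso_inv:
  assumes f: "face_lattice_iso f P Q"
  shows "face_lattice_iso (inv_into {F. F face_of P} f) Q P"
  unfolding face_lattice_iso_def
proof (intro conjI allI impI)
  have bij: "bij_betw f {F. F face_of P} {F. F face_of Q}" using f unfolding face_lattice_iso_def by blast
  let ?g = "inv_into {F. F face_of P} f"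
  show bij': "bij_betw ?g {F. F face_of Q} {F. F face_of P}" using bij by (rule bij_betw_inv_into)
  fix F G assume FG: "F face_of Q" "G face_of Q"
  have "f (?g F) = F" "f (?g G) = G" using bij FG bij_betw_inv_into_right by fastforce+
  moreover have "?g F face_of P" "?g G face_of P" using bij' FG unfolding bij_betw_def by auto
  ultimately show "F \<subseteq> G \<longleftrightarrow> ?g F \<subseteq> ?g G" using face_lattice_iso_sub[OF f] by metis
qed

text \<open>
  By induction on the dimension: a nonempty polytope has a face of dimension one less, which is mapped to
  a proper face of \<open>f F\<close>, and a proper face has smaller dimension.
\<close>

lemma aff_dim_face_lattice_iso_le:
  fixes P :: "'a::euclidean_space set" and Q :: "'b::euclidean_space set"
  assumes P: "polytope P" and Q: "polytope Q" and f: "face_lattice_iso f P Q"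
  shows "F face_of P \<Longrightarrow> aff_dim F \<le> aff_dim (f F)"
proof (induction "nat (aff_dim F + 1)" arbitrary: F rule: less_induct)
  case less
  note F = less.prems
  have pF: "polytope F" using face_of_polytope_polytope[OF P F] .
  show ?case
  proof (cases "F = {}")
    case True then show ?thesis using aff_dim_geq[of "f F"] by simp
  next
    case False
    have "\<exists>D. D face_of F \<and> D \<noteq> F \<and> aff_dim D = aff_dim F - 1"
    proof (cases "aff_dim F = 0")
      case True
      then show ?thesis using False by (intro exI[of _ "{}"]) simp
    next
      case n: False
      have "aff_dim F \<noteq> -1" using False aff_dim_empty by blast
      then have "0 < aff_dim F" using n aff_dim_geq[of F] by linarith
      then obtain D where "D facet_of F" using polytope_facet_exists[OF pF] by blast
      then show ?thesis unfolding facet_of_def by auto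
    qed
    then obtain D where D: "D face_of F" "D \<noteq> F" "aff_dim D = aff_dim F - 1" by blast
    have DP: "D face_of P" using D(1) F face_of_trans by blast
    have "aff_dim D \<le> aff_dim (f D)"
      using less.hyps[of D] DP D(3) aff_dim_geq[of D] by simp
    moreover have "f D face_of f F"
      using face_lattice_iso_sub[OF f DP F] face_of_imp_subset[OF D(1)]
        face_lattice_iso_face[OF f DP] face_of_face[OF face_lattice_iso_face[OF f F]] by blast
    moreover have "f D \<noteq> f F" using face_lattice_iso_eq[OF f DP F] D(2) by blast
    moreover have "convex (f F)" using face_of_imp_convex[OF face_lattice_iso_face[OF f F]] .
    ultimately show ?thesis using face_of_aff_dim_lt[of "f F" "f D"] D(3) by simp
  qed
qed

lemma aff_dim_face_lattice_iso:
  fixes P :: "'a::euclidean_space set" and Q :: "'b::euclidean_space set"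
  assumes P: "polytope P" and Q: "polytope Q" and f: "face_lattice_iso f P Q" and F: "F face_of P"
  shows "aff_dim (f F) = aff_dim F"
proof -
  let ?g = "inv_into {F. F face_of P} f"
  have "bij_betw f {F. F face_of P} {F. F face_of Q}" using f unfolding face_lattice_iso_def by blast
  then have "?g (f F) = F" using F by (intro bij_betw_inv_into_left) auto
  then show ?thesis
    using aff_dim_face_lattice_iso_le[OF P Q f F]
      aff_dim_face_lattice_iso_le[OF Q P face_lattice_iso_inv[OF f] face_lattice_iso_face[OF f F]] by simp
qed

section \<open>The unit box\<close>

lemma sum_Basis_inner:
  assumes B: "B \<subseteq> (Basis :: 'a::euclidean_space set)" and i: "i \<in> Basis"
  shows "(\<Sum>B) \<bullet> i = (if i \<in> B then 1 else 0)"
proof -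
  have "(\<Sum>B) \<bullet> i = (\<Sum>b\<in>B. if b = i then 1 else 0)"
    unfolding inner_sum_left using B i by (intro sum.cong) (auto simp: inner_Basis)
  then show ?thesis using finite_subset[OF B finite_Basis] by simp
qed

lemma mem_unit_box:
  assumes B: "B \<subseteq> (Basis :: 'a::euclidean_space set)"
  shows "x \<in> cbox 0 (\<Sum>B) \<longleftrightarrow> (\<forall>i\<in>Basis. 0 \<le> x \<bullet> i \<and> x \<bullet> i \<le> (if i \<in> B then 1 else 0))"
  using sum_Basis_inner[OF B] by (simp add: mem_box)

lemma aff_dim_unit_box:
  assumes B: "B \<subseteq> (Basis :: 'a::euclidean_space set)"
  shows "aff_dim (cbox 0 (\<Sum>B)) = int (card B)"
proof -
  let ?Q = "cbox 0 (\<Sum>B)"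
  have 0: "0 \<in> ?Q" unfolding mem_unit_box[OF B] by simp
  have "B \<subseteq> ?Q"
  proof
    fix b assume "b \<in> B"
    then show "b \<in> ?Q" unfolding mem_unit_box[OF B] using B by (auto simp: inner_Basis)
  qed
  moreover have "?Q \<subseteq> span B"
  proof
    fix x assume x: "x \<in> ?Q"
    have z: "x \<bullet> i = 0" if "i \<in> Basis - B" for i
      using x that unfolding mem_unit_box[OF B] by (auto intro: antisym)
    have "x = (\<Sum>b\<in>Basis. (x \<bullet> b) *\<^sub>R b)" by (simp add: euclidean_representation)
    also have "\<dots> = (\<Sum>b\<in>B. (x \<bullet> b) *\<^sub>R b)"
      using z B by (intro sum.mono_neutral_right) auto
    finally show "x \<in> span B" by (metis (no_types, lifting) span_base span_scale span_sum)
  qed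
  ultimately have "span ?Q = span B" by (metis span_eq span_superset subset_trans)
  moreover have "independent B" using B independent_Basis independent_mono by blast
  ultimately have "dim ?Q = card B" by (metis dim_eq_card)
  then show ?thesis using aff_dim_zero[OF hull_inc[OF 0]] by simp
qed

text \<open>
  Up to a translation the slice is the box of the remaining directions.
\<close>

lemma aff_dim_unit_box_slice:
  assumes B: "B \<subseteq> (Basis :: 'a::euclidean_space set)" and D: "D \<subseteq> B"
    and e: "\<And>b. b \<in> D \<Longrightarrow> e b \<in> {0, 1::real}"
  shows "aff_dim {x \<in> cbox 0 (\<Sum>B). \<forall>b\<in>D. x \<bullet> b = e b} = int (card (B - D))"
proof -
  define c where "c = (\<Sum>b\<in>D. e b *\<^sub>R b)"
  have fD: "finite D" using finite_subset[OF B finite_Basis] D finite_subset by blast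
  have c: "c \<bullet> i = (if i \<in> D then e i else 0)" if i: "i \<in> Basis" for i
  proof -
    have "c \<bullet> i = (\<Sum>b\<in>D. if b = i then e i else 0)"
      unfolding c_def inner_sum_left using B D i by (intro sum.cong) (auto simp: inner_Basis)
    then show ?thesis using fD by simp
  qed
  have BD: "B - D \<subseteq> Basis" using B by blast
  have "{x \<in> cbox 0 (\<Sum>B). \<forall>b\<in>D. x \<bullet> b = e b} = (+) c ` cbox 0 (\<Sum>(B - D))"
  proof (intro set_eqI iffI)
    fix x assume "x \<in> {x \<in> cbox 0 (\<Sum>B). \<forall>b\<in>D. x \<bullet> b = e b}"
    then have x: "\<forall>i\<in>Basis. 0 \<le> x \<bullet> i \<and> x \<bullet> i \<le> (if i \<in> B then 1 else 0)" "\<forall>b\<in>D. x \<bullet> b = e b"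
      unfolding mem_unit_box[OF B] by auto
    have "x - c \<in> cbox 0 (\<Sum>(B - D))" unfolding mem_unit_box[OF BD]
    proof
      fix i :: 'a assume i: "i \<in> Basis"
      show "0 \<le> (x - c) \<bullet> i \<and> (x - c) \<bullet> i \<le> (if i \<in> B - D then 1 else 0)"
        unfolding inner_diff_left c[OF i] using x i by auto
    qed
    then show "x \<in> (+) c ` cbox 0 (\<Sum>(B - D))" by (intro image_eqI[of _ _ "x - c"]) simp_all
  next
    fix x assume "x \<in> (+) c ` cbox 0 (\<Sum>(B - D))"
    then obtain y where y: "x = c + y" "\<forall>i\<in>Basis. 0 \<le> y \<bullet> i \<and> y \<bullet> i \<le> (if i \<in> B - D then 1 else 0)"
      using mem_unit_box[OF BD] by blast
    have xi: "x \<bullet> i = (if i \<in> D then e i else 0) + y \<bullet> i" if "i \<in> Basis" for i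
      unfolding y(1) inner_add_left c[OF that] ..
    have "y \<bullet> b = 0" if "b \<in> D" for b
    proof -
      have "b \<in> Basis" "b \<notin> B - D" using that D B by auto
      then show ?thesis using y(2)[rule_format, of b] by (auto split: if_splits)
    qed
    then have "\<forall>b\<in>D. x \<bullet> b = e b" using xi D B by auto
    moreover have "x \<in> cbox 0 (\<Sum>B)" unfolding mem_unit_box[OF B]
    proof
      fix i :: 'a assume i: "i \<in> Basis"
      show "0 \<le> x \<bullet> i \<and> x \<bullet> i \<le> (if i \<in> B then 1 else 0)"
      proof (cases "i \<in> D")
        case True
        then have "x \<bullet> i = e i" "e i \<in> {0, 1}" "i \<in> B" using calculation e D by auto
        then show ?thesis by auto
      next
        case False
        then have "0 \<le> y \<bullet> i" "y \<bullet> i \<le> (if i \<in> B then 1 else 0)" "x \<bullet> i = y \<bullet> i"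
          using xi[OF i] y(2) i by auto
        then show ?thesis by simp
      qed
    qed
    ultimately show "x \<in> {x \<in> cbox 0 (\<Sum>B). \<forall>b\<in>D. x \<bullet> b = e b}" by blast
  qed
  then show ?thesis using aff_dim_unit_box[OF BD] by (simp add: aff_dim_translation_eq)
qed

definition box_side :: "'a::euclidean_space set \<Rightarrow> 'a \<times> bool \<Rightarrow> 'a set" where
  "box_side B p = {x \<in> cbox 0 (\<Sum>B). x \<bullet> fst p = (if snd p then 1 else 0)}"

context
  fixes B :: "'a::euclidean_space set"
  assumes B: "B \<subseteq> Basis"
begin

lemma box_side_facet:
  assumes b: "b \<in> B" shows "box_side B (b, s) facet_of cbox 0 (\<Sum>B)"
proof -
  let ?Q = "cbox 0 (\<Sum>B)"
  have bB: "b \<in> Basis" using b B by blast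
  have fin: "finite B" using finite_subset[OF B finite_Basis] .
  have bounds: "0 \<le> x \<bullet> b" "x \<bullet> b \<le> 1" if "x \<in> ?Q" for x
    using that b bB unfolding mem_unit_box[OF B] by auto
  have "?Q \<inter> {x. b \<bullet> x = (if s then 1 else 0)} face_of ?Q"
  proof (cases s)
    case True
    have "?Q \<inter> {x. b \<bullet> x = 1} face_of ?Q"
      by (rule face_of_Int_supporting_hyperplane_le) (auto simp: inner_commute bounds)
    then show ?thesis using True by simp
  next
    case False
    have "?Q \<inter> {x. b \<bullet> x = 0} face_of ?Q"
      by (rule face_of_Int_supporting_hyperplane_ge) (auto simp: inner_commute bounds)
    then show ?thesis using False by simp
  qed
  moreover have eq: "box_side B (b, s) = ?Q \<inter> {x. b \<bullet> x = (if s then 1 else 0)}"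
    unfolding box_side_def by (auto simp: inner_commute)
  moreover have dim: "aff_dim (box_side B (b, s)) = int (card B) - 1"
  proof -
    have "box_side B (b, s) = {x \<in> ?Q. \<forall>b'\<in>{b}. x \<bullet> b' = (if s then 1 else 0)}"
      unfolding box_side_def by simp
    then have "aff_dim (box_side B (b, s)) = int (card (B - {b}))"
      using aff_dim_unit_box_slice[OF B, of "{b}" "\<lambda>_. if s then 1 else 0"] b by auto
    moreover have "0 < card B" using b fin card_gt_0_iff by blast
    ultimately show ?thesis using b fin by simp
  qed
  moreover have "box_side B (b, s) \<noteq> {}"
  proof -
    have "(if s then b else 0) \<in> box_side B (b, s)"
      unfolding box_side_def mem_unit_box[OF B] using b B by (auto simp: inner_Basis)
    then show ?thesis by blast
  qed
  ultimately show ?thesis unfolding facet_of_def using aff_dim_unit_box[OF B] by simp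
qed

text \<open>
  A point of the box with no coordinate 0 or 1 in the directions of \<open>B\<close> can be passed from every point \<open>x\<close>
  of the box to a point slightly beyond it, so a face containing it is the whole box. Hence a relative
  interior point of a facet lies on some side, and the facet is that side.
\<close>

lemma box_side_facets:
  assumes F: "F facet_of cbox 0 (\<Sum>B)"
  obtains b s where "b \<in> B" "F = box_side B (b, s)"
proof -
  let ?Q = "cbox 0 (\<Sum>B)"
  have fin: "finite B" using finite_subset[OF B finite_Basis] .
  have Ff: "F face_of ?Q" "F \<noteq> {}" "F \<noteq> ?Q" using F unfolding facet_of_def by auto
  have "convex F" using face_of_imp_convex[OF Ff(1)] .
  then obtain p where p: "p \<in> rel_interior F" using rel_interior_eq_empty Ff(2) by blast
  have pF: "p \<in> F" using p rel_interior_subset by blast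
  have pQ: "\<forall>i\<in>Basis. 0 \<le> p \<bullet> i \<and> p \<bullet> i \<le> (if i \<in> B then 1 else 0)"
    using pF face_of_imp_subset[OF Ff(1)] mem_unit_box[OF B] by blast
  have "\<exists>b\<in>B. p \<bullet> b = 0 \<or> p \<bullet> b = 1"
  proof (rule ccontr)
    assume "\<not> ?thesis"
    then have str: "0 < p \<bullet> b" "p \<bullet> b < 1" if "b \<in> B" for b
      using that pQ B by (force simp: less_le)+
    define \<epsilon> where "\<epsilon> = Min (insert 1 ((\<lambda>b. min (p \<bullet> b) (1 - p \<bullet> b)) ` B))"
    have e0: "0 < \<epsilon>" unfolding \<epsilon>_def using fin str by auto
    have e: "\<epsilon> \<le> p \<bullet> b" "\<epsilon> \<le> 1 - p \<bullet> b" if "b \<in> B" for b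
    proof -
      have "\<epsilon> \<le> min (p \<bullet> b) (1 - p \<bullet> b)" unfolding \<epsilon>_def using fin that by (intro Min_le) auto
      then show "\<epsilon> \<le> p \<bullet> b" "\<epsilon> \<le> 1 - p \<bullet> b" by auto
    qed
    have "?Q \<subseteq> F"
    proof
      fix x assume x: "x \<in> ?Q"
      define z where "z = p + \<epsilon> *\<^sub>R (p - x)"
      have z: "z \<in> ?Q" unfolding mem_unit_box[OF B]
      proof
        fix i :: 'a assume i: "i \<in> Basis"
        have zi: "z \<bullet> i = p \<bullet> i + \<epsilon> * (p \<bullet> i - x \<bullet> i)" unfolding z_def by (simp add: inner_simps)
        have xi: "0 \<le> x \<bullet> i" "x \<bullet> i \<le> (if i \<in> B then 1 else 0)" using x i unfolding mem_unit_box[OF B] by auto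
        show "0 \<le> z \<bullet> i \<and> z \<bullet> i \<le> (if i \<in> B then 1 else 0)"
        proof (cases "i \<in> B")
          case True
          have "-1 \<le> p \<bullet> i - x \<bullet> i" "p \<bullet> i - x \<bullet> i \<le> 1" using xi str[OF True] True by auto
          then have "\<epsilon> * (-1) \<le> \<epsilon> * (p \<bullet> i - x \<bullet> i)" "\<epsilon> * (p \<bullet> i - x \<bullet> i) \<le> \<epsilon> * 1"
            using mult_left_mono[of "-1" "p \<bullet> i - x \<bullet> i" \<epsilon>] mult_left_mono[of "p \<bullet> i - x \<bullet> i" 1 \<epsilon>] e0 by simp_all
          then show ?thesis using zi e[OF True] True by simp
        next
          case False
          then have "p \<bullet> i = 0" "x \<bullet> i = 0" using xi pQ i by (auto intro: antisym)
          then show ?thesis using zi False by simp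
        qed
      qed
      show "x \<in> F"
      proof (cases "x = z")
        case True
        then have "(1 + \<epsilon>) *\<^sub>R (p - x) = 0" unfolding z_def by (simp add: algebra_simps)
        then show ?thesis using e0 pF by simp
      next
        case False
        have "p = (1 - inverse (1 + \<epsilon>)) *\<^sub>R x + inverse (1 + \<epsilon>) *\<^sub>R z"
        proof -
          have "(1 + \<epsilon>) *\<^sub>R p = \<epsilon> *\<^sub>R x + z" unfolding z_def by (simp add: algebra_simps)
          then have "p = inverse (1 + \<epsilon>) *\<^sub>R (\<epsilon> *\<^sub>R x + z)"
            using e0 by (metis add_pos_pos less_irrefl scaleR_left.zero scaleR_scaleR scaleR_one left_inverse zero_less_one)
          also have "\<dots> = (1 - inverse (1 + \<epsilon>)) *\<^sub>R x + inverse (1 + \<epsilon>) *\<^sub>R z"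
          proof -
            have "inverse (1 + \<epsilon>) * \<epsilon> = 1 - inverse (1 + \<epsilon>)" using e0 by (simp add: field_simps)
            then show ?thesis by (simp add: scaleR_add_right)
          qed
          finally show ?thesis .
        qed
        moreover have "0 < inverse (1 + \<epsilon>)" "inverse (1 + \<epsilon>) < 1" using e0 by (auto simp: field_simps)
        ultimately have "p \<in> open_segment x z" unfolding in_segment using False by blast
        then show ?thesis using face_ofD[OF Ff(1) _ x z pF] by blast
      qed
    qed
    then show False using Ff face_of_imp_subset by blast
  qed
  then obtain b where b: "b \<in> B" "p \<bullet> b = 0 \<or> p \<bullet> b = 1" by blast
  have pQ': "p \<in> ?Q" using pF face_of_imp_subset[OF Ff(1)] by blast
  have "p \<in> box_side B (b, p \<bullet> b = 1)" using b(2) pQ' unfolding box_side_def by auto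
  then have "F \<subseteq> box_side B (b, p \<bullet> b = 1)"
    using subset_of_face_of[OF facet_of_imp_face_of[OF box_side_facet[OF b(1)]] facet_of_imp_subset[OF F]] p by blast
  then have "F = box_side B (b, p \<bullet> b = 1)" using facet_eq_of_subset[OF F box_side_facet[OF b(1)]] by blast
  then show thesis using that b(1) by blast
qed

lemma box_side_inj: "inj_on (box_side B) (B \<times> UNIV)"
proof (rule inj_onI, clarify)
  fix b s c t assume b: "b \<in> B" and c: "c \<in> B" and eq: "box_side B (b, s) = box_side B (c, t)"
  have fin: "finite B" using finite_subset[OF B finite_Basis] .
  \<comment> \<open>Two vertices on the side \<open>(b, s)\<close>: \<open>x\<close> is on no other side \<open>(c, s)\<close>, and \<open>y\<close> on no side \<open>(c, \<not> s)\<close>.\<close>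
  define x where "x = (if s then b else \<Sum>(B - {b}))"
  have BD: "B - {b} \<subseteq> Basis" using B by blast
  have xi: "x \<bullet> i = (if s then (if i = b then 1 else 0) else (if i \<in> B - {b} then 1 else 0))" if "i \<in> Basis" for i
    unfolding x_def using sum_Basis_inner[OF BD that] that b B by (auto simp: inner_Basis)
  define y where "y = (if s then \<Sum>B else 0)"
  have yi: "y \<bullet> i = (if s then (if i \<in> B then 1 else 0) else 0)" if "i \<in> Basis" for i
    unfolding y_def using sum_Basis_inner[OF B that] by auto
  have "x \<in> box_side B (b, s)" "y \<in> box_side B (b, s)"
    unfolding box_side_def mem_unit_box[OF B] using xi yi b B by auto
  then have "x \<in> box_side B (c, t)" "y \<in> box_side B (c, t)" using eq by auto
  then have "x \<bullet> c = (if t then 1 else 0)" "y \<bullet> c = (if t then 1 else 0)" unfolding box_side_def by auto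
  then show "b = c \<and> s = t" using xi[of c] yi[of c] c B by (auto split: if_splits)
qed

lemma box_vertex_coords:
  assumes v: "v extreme_point_of cbox 0 (\<Sum>B)" and b: "b \<in> B" shows "v \<bullet> b = 0 \<or> v \<bullet> b = 1"
proof (rule ccontr)
  let ?Q = "cbox 0 (\<Sum>B)"
  assume n: "\<not> ?thesis"
  have bB: "b \<in> Basis" using b B by blast
  have vQ: "v \<in> ?Q" using v unfolding extreme_point_of_def by blast
  then have s: "0 < v \<bullet> b" "v \<bullet> b < 1" using n b bB unfolding mem_unit_box[OF B] by (force simp: less_le)+
  define \<epsilon> where "\<epsilon> = min (v \<bullet> b) (1 - v \<bullet> b)"
  have e: "0 < \<epsilon>" "\<epsilon> \<le> v \<bullet> b" "\<epsilon> \<le> 1 - v \<bullet> b" unfolding \<epsilon>_def using s by auto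
  have in_box: "v + t *\<^sub>R b \<in> ?Q" if "\<bar>t\<bar> \<le> \<epsilon>" for t unfolding mem_unit_box[OF B]
  proof
    fix i :: 'a assume i: "i \<in> Basis"
    have "(v + t *\<^sub>R b) \<bullet> i = v \<bullet> i + (if i = b then t else 0)"
      using i bB by (simp add: inner_simps inner_Basis)
    then show "0 \<le> (v + t *\<^sub>R b) \<bullet> i \<and> (v + t *\<^sub>R b) \<bullet> i \<le> (if i \<in> B then 1 else 0)"
      using vQ i that e b unfolding mem_unit_box[OF B] by auto
  qed
  have "v = (1 - 1/2) *\<^sub>R (v + \<epsilon> *\<^sub>R b) + (1/2) *\<^sub>R (v + (-\<epsilon>) *\<^sub>R b)"
    by (simp add: algebra_simps flip: scaleR_add_left)
  moreover have "v + \<epsilon> *\<^sub>R b \<noteq> v + (-\<epsilon>) *\<^sub>R b"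
  proof
    assume "v + \<epsilon> *\<^sub>R b = v + (-\<epsilon>) *\<^sub>R b"
    then have "\<epsilon> *\<^sub>R b = (-\<epsilon>) *\<^sub>R b" by (rule add_left_imp_eq)
    then have "\<epsilon> = -\<epsilon>" using nonzero_Basis[OF bB] scaleR_right_imp_eq by blast
    then show False using e by simp
  qed
  ultimately have "v \<in> open_segment (v + \<epsilon> *\<^sub>R b) (v + (-\<epsilon>) *\<^sub>R b)"
    unfolding in_segment by (intro conjI exI[of _ "1/2"]) auto
  then show False using v in_box[of \<epsilon>] in_box[of "-\<epsilon>"] e unfolding extreme_point_of_def by auto
qed

lemma box_vertex:
  assumes A: "A \<subseteq> B" shows "(\<Sum>A) extreme_point_of cbox 0 (\<Sum>B)"
  unfolding extreme_point_of_def
proof (intro conjI ballI notI)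
  let ?Q = "cbox 0 (\<Sum>B)"
  have AB: "A \<subseteq> Basis" using A B by blast
  show "\<Sum>A \<in> ?Q" unfolding mem_unit_box[OF B] using sum_Basis_inner[OF AB] A by auto
  fix x y assume x: "x \<in> ?Q" and y: "y \<in> ?Q" and "\<Sum>A \<in> open_segment x y"
  then obtain u where u: "x \<noteq> y" "0 < u" "u < 1" "\<Sum>A = (1 - u) *\<^sub>R x + u *\<^sub>R y" unfolding in_segment by blast
  have "x \<bullet> i = y \<bullet> i" if i: "i \<in> Basis" for i
  proof -
    have "(\<Sum>A) \<bullet> i = (1 - u) * (x \<bullet> i) + u * (y \<bullet> i)" unfolding u(4) by (simp add: inner_simps)
    then have eq: "(if i \<in> A then 1 else 0) = (1 - u) * (x \<bullet> i) + u * (y \<bullet> i)"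
      using sum_Basis_inner[OF AB i] by simp
    have xy: "0 \<le> x \<bullet> i" "x \<bullet> i \<le> 1" "0 \<le> y \<bullet> i" "y \<bullet> i \<le> 1"
      using x y i unfolding mem_unit_box[OF B] by (auto split: if_splits intro: order_trans)
    show ?thesis
    proof (cases "i \<in> A")
      case True
      then have "(1 - u) * (1 - x \<bullet> i) + u * (1 - y \<bullet> i) = 0" using eq by (simp add: algebra_simps)
      moreover have "0 \<le> (1 - u) * (1 - x \<bullet> i)" "0 \<le> u * (1 - y \<bullet> i)" using u xy by auto
      ultimately have "(1 - u) * (1 - x \<bullet> i) = 0" "u * (1 - y \<bullet> i) = 0" by linarith+
      then show ?thesis using u by simp
    next
      case False
      have "0 \<le> (1 - u) * (x \<bullet> i)" "0 \<le> u * (y \<bullet> i)" using u xy by auto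
      moreover have "(1 - u) * (x \<bullet> i) + u * (y \<bullet> i) = 0" using eq False by simp
      ultimately have "(1 - u) * (x \<bullet> i) = 0" "u * (y \<bullet> i) = 0" by linarith+
      then show ?thesis using u by simp
    qed
  qed
  then show False using u(1) euclidean_eqI by blast
qed

text \<open>
  The sides are labelled by \<open>B \<times> UNIV\<close>, where flipping the truth value is the exchange of opposite
  sides; the vertices \<open>\<Sum>A\<close> correspond to the characteristic functions of the sets \<open>A \<subseteq> B\<close>.
\<close>

lemma box_cube_with:
  assumes c: "2 \<le> card B"
  shows "\<exists>\<alpha>. cube_with \<alpha> (dual_nodes (cbox 0 (\<Sum>B))) (dual_adjacent (cbox 0 (\<Sum>B))) (vertex_stars (cbox 0 (\<Sum>B)))"
    and "card (dual_nodes (cbox 0 (\<Sum>B))) = 2 * card B"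
proof -
  let ?Q = "cbox 0 (\<Sum>B)" and ?N = "B \<times> (UNIV :: bool set)"
  have fin: "finite B" using finite_subset[OF B finite_Basis] .
  have nodes: "box_side B ` ?N = dual_nodes ?Q"
    unfolding dual_nodes_def using box_side_facet box_side_facets by (auto, metis SigmaI UNIV_I image_eqI)
  have bij: "bij_betw (box_side B) ?N (dual_nodes ?Q)" unfolding bij_betw_def using nodes box_side_inj by blast
  show "card (dual_nodes ?Q) = 2 * card B" using bij_betw_same_card[OF bij] by (simp add: card_cartesian_product)
  define E where "E p q \<longleftrightarrow> p \<in> ?N \<and> q \<in> ?N \<and> fst p \<noteq> fst q" for p q :: "'a \<times> bool"
  define V where "V = {{(b, b \<in> A) | b. b \<in> B} | A. A \<subseteq> B}"
  have cube: "cube_with (\<lambda>p. (fst p, \<not> snd p)) ?N E V" unfolding cube_with_def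
  proof (intro conjI ballI allI)
    show "finite ?N" using fin by simp
    fix x y :: "'a \<times> bool"
    show "E x y \<longleftrightarrow> x \<in> ?N \<and> y \<in> ?N \<and> x \<noteq> y \<and> y \<noteq> (fst x, \<not> snd x)"
      unfolding E_def by (cases x; cases y) auto
  next
    show "V = {S. S \<subseteq> ?N \<and> (\<forall>x\<in>?N. x \<in> S \<longleftrightarrow> (fst x, \<not> snd x) \<notin> S)}"
    proof (intro set_eqI iffI)
      fix S assume "S \<in> V"
      then show "S \<in> {S. S \<subseteq> ?N \<and> (\<forall>x\<in>?N. x \<in> S \<longleftrightarrow> (fst x, \<not> snd x) \<notin> S)}" unfolding V_def by auto
    next
      fix S assume S: "S \<in> {S. S \<subseteq> ?N \<and> (\<forall>x\<in>?N. x \<in> S \<longleftrightarrow> (fst x, \<not> snd x) \<notin> S)}"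
      have flip: "(b, True) \<in> S \<longleftrightarrow> (b, False) \<notin> S" if "b \<in> B" for b
      proof -
        have "(b, True) \<in> ?N" using that by simp
        then have "(b, True) \<in> S \<longleftrightarrow> (fst (b, True), \<not> snd (b, True)) \<notin> S" using S by blast
        then show ?thesis by simp
      qed
      have "S = {(b, b \<in> {b \<in> B. (b, True) \<in> S}) | b. b \<in> B}"
      proof (intro set_eqI iffI)
        fix p assume p: "p \<in> S"
        obtain b s where bs: "p = (b, s)" by (cases p)
        have "p \<in> ?N" using p S by blast
        then have "b \<in> B" using bs by simp
        moreover have "s \<longleftrightarrow> (b, True) \<in> S" using p bs flip[OF calculation] by (cases s) auto
        ultimately show "p \<in> {(b, b \<in> {b \<in> B. (b, True) \<in> S}) | b. b \<in> B}" using bs by auto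
      next
        fix p assume "p \<in> {(b, b \<in> {b \<in> B. (b, True) \<in> S}) | b. b \<in> B}"
        then obtain b where b: "b \<in> B" "p = (b, (b, True) \<in> S)" by auto
        then show "p \<in> S" using flip[OF b(1)] by (cases "(b, True) \<in> S") auto
      qed
      then show "S \<in> V" unfolding V_def by blast
    qed
  qed auto
  have adj: "E p q \<longleftrightarrow> dual_adjacent ?Q (box_side B p) (box_side B q)" if pq: "p \<in> ?N" "q \<in> ?N" for p q
  proof -
    obtain b s c' t where p: "p = (b, s)" "q = (c', t)" "b \<in> B" "c' \<in> B" using pq by auto
    have fc: "box_side B p facet_of ?Q" "box_side B q facet_of ?Q" using box_side_facet p by auto
    have face: "box_side B p \<inter> box_side B q face_of ?Q"
      using face_of_Int facet_of_imp_face_of fc by blast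
    have da: "dual_adjacent ?Q (box_side B p) (box_side B q) \<longleftrightarrow>
        aff_dim (box_side B p \<inter> box_side B q) = int (card B) - 2"
      unfolding dual_adjacent_def dual_nodes_def ridge_of_def using fc face aff_dim_unit_box[OF B] by simp
    show ?thesis
    proof (cases "b = c'")
      case False
      define e where "e i = (if i = b then (if s then 1 else 0) else (if t then 1 else 0) :: real)" for i
      have "box_side B p \<inter> box_side B q = {x \<in> ?Q. \<forall>i\<in>{b, c'}. x \<bullet> i = e i}"
        unfolding box_side_def e_def p using False by auto
      then have "aff_dim (box_side B p \<inter> box_side B q) = int (card (B - {b, c'}))"
        using aff_dim_unit_box_slice[OF B, of "{b, c'}" e] p unfolding e_def by auto
      moreover have "card (B - {b, c'}) = card B - 2" using p False fin by (simp add: card_Diff_subset)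
      ultimately show ?thesis unfolding da E_def using p False c by auto
    next
      case True
      have "aff_dim (box_side B p \<inter> box_side B q) \<noteq> int (card B) - 2"
      proof (cases "s = t")
        case s: True
        then have "aff_dim (box_side B p \<inter> box_side B q) = int (card B) - 1"
          using fc(1) True p aff_dim_unit_box[OF B] unfolding facet_of_def by simp
        then show ?thesis by simp
      next
        case False
        then have "box_side B p \<inter> box_side B q = {}" unfolding box_side_def p using True by auto
        then have "aff_dim (box_side B p \<inter> box_side B q) = -1" by simp
        then show ?thesis using c by simp
      qed
      then show ?thesis unfolding da E_def using p True by simp
    qed
  qed
  have in_side: "box_side B ` {(b, b \<in> A) | b. b \<in> B} = vertex_star ?Q v"
    if v: "v \<in> ?Q" "\<And>b. b \<in> B \<Longrightarrow> v \<bullet> b = (if b \<in> A then 1 else 0)" for A v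
  proof (intro set_eqI iffI)
    fix F assume "F \<in> box_side B ` {(b, b \<in> A) | b. b \<in> B}"
    then obtain b where b: "b \<in> B" "F = box_side B (b, b \<in> A)" by blast
    then show "F \<in> vertex_star ?Q v"
      unfolding vertex_star_def using box_side_facet[OF b(1)] v unfolding box_side_def by auto
  next
    fix F assume "F \<in> vertex_star ?Q v"
    then have F: "F facet_of ?Q" "v \<in> F" unfolding vertex_star_def by auto
    obtain b s where b: "b \<in> B" "F = box_side B (b, s)" using box_side_facets[OF F(1)] by blast
    have "s \<longleftrightarrow> b \<in> A" using F(2) b v(2)[OF b(1)] unfolding box_side_def by (auto split: if_splits)
    then show "F \<in> box_side B ` {(b, b \<in> A) | b. b \<in> B}" using b by blast
  qed
  have "vertex_stars ?Q = (`) (box_side B) ` V"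
  proof (intro equalityI subsetI)
    fix S assume "S \<in> vertex_stars ?Q"
    then obtain v where v: "v extreme_point_of ?Q" "S = vertex_star ?Q v" unfolding vertex_stars_def by blast
    define A where "A = {b \<in> B. v \<bullet> b = 1}"
    have "v \<in> ?Q" using v(1) unfolding extreme_point_of_def by blast
    moreover have "v \<bullet> b = (if b \<in> A then 1 else 0)" if "b \<in> B" for b
      using box_vertex_coords[OF v(1) that] that unfolding A_def by auto
    ultimately have "S = box_side B ` {(b, b \<in> A) | b. b \<in> B}" using in_side[of v A] v(2) by simp
    moreover have "{(b, b \<in> A) | b. b \<in> B} \<in> V" unfolding V_def A_def by blast
    ultimately show "S \<in> (`) (box_side B) ` V" by blast
  next
    fix S assume "S \<in> (`) (box_side B) ` V"
    then obtain A where A: "A \<subseteq> B" "S = box_side B ` {(b, b \<in> A) | b. b \<in> B}" unfolding V_def by blast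
    have AB: "A \<subseteq> Basis" using A B by blast
    have ext: "(\<Sum>A) extreme_point_of ?Q" using box_vertex[OF A(1)] .
    then have "\<Sum>A \<in> ?Q" unfolding extreme_point_of_def by blast
    then have "S = vertex_star ?Q (\<Sum>A)"
      using in_side[of "\<Sum>A" A] sum_Basis_inner[OF AB] B A(2) by blast
    then show "S \<in> vertex_stars ?Q" unfolding vertex_stars_def using ext by blast
  qed
  then show "\<exists>\<alpha>. cube_with \<alpha> (dual_nodes ?Q) (dual_adjacent ?Q) (vertex_stars ?Q)"
    using cube_with_image[OF cube bij adj] unfolding dual_adjacent_def by blast
qed

end

section \<open>Combinatorial cubes, and lattice isomorphisms from stars\<close>

lemma face_lattice_iso_top:
  assumes f: "face_lattice_iso f P Q" and P: "convex P" and Q: "convex Q"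
  shows "f P = Q"
proof -
  have PP: "P face_of P" and QQ: "Q face_of Q" using P Q face_of_refl by blast+
  obtain D where D: "D face_of P" "Q = f D" using face_lattice_iso_surj[OF f QQ] by blast
  have "f D \<subseteq> f P" using face_lattice_iso_sub[OF f D(1) PP] face_of_imp_subset[OF D(1)] by blast
  moreover have "f P \<subseteq> Q" using face_of_imp_subset[OF face_lattice_iso_face[OF f PP]] .
  ultimately show ?thesis using D by blast
qed

lemma face_lattice_iso_Int:
  assumes f: "face_lattice_iso f P Q" and F: "F face_of P" and G: "G face_of P"
  shows "f (F \<inter> G) = f F \<inter> f G"
proof
  have FG: "F \<inter> G face_of P" using face_of_Int F G by blast
  show "f (F \<inter> G) \<subseteq> f F \<inter> f G"
    using face_lattice_iso_sub[OF f FG F] face_lattice_iso_sub[OF f FG G] by blast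
  have "f F \<inter> f G face_of Q" using face_of_Int face_lattice_iso_face[OF f] F G by blast
  then obtain D where D: "D face_of P" "f F \<inter> f G = f D" using face_lattice_iso_surj[OF f] by blast
  then have "D \<subseteq> F" "D \<subseteq> G" using face_lattice_iso_sub[OF f D(1)] F G by blast+
  then show "f F \<inter> f G \<subseteq> f (F \<inter> G)" using D face_lattice_iso_sub[OF f D(1) FG] by blast
qed

context
  fixes P :: "'a::euclidean_space set" and Q :: "'b::euclidean_space set" and f
  assumes P: "polytope P" and Q: "polytope Q" and f: "face_lattice_iso f P Q"
begin

lemma iso_dim: "F face_of P \<Longrightarrow> aff_dim (f F) = aff_dim F"
  using aff_dim_face_lattice_iso[OF P Q f] .

lemma iso_dim_top: "aff_dim P = aff_dim Q"
  using iso_dim[of P] face_lattice_iso_top[OF f] P Q polytope_imp_convex face_of_refl by metis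

lemma iso_facet: "F face_of P \<Longrightarrow> f F facet_of Q \<longleftrightarrow> F facet_of P"
  unfolding facet_of_def using iso_dim iso_dim_top face_lattice_iso_face[OF f] aff_dim_empty by metis

lemma iso_nodes: "bij_betw f (dual_nodes P) (dual_nodes Q)"
  unfolding bij_betw_def
proof
  show "inj_on f (dual_nodes P)"
    unfolding dual_nodes_def inj_on_def using face_lattice_iso_eq[OF f] facet_of_imp_face_of by blast
  show "f ` dual_nodes P = dual_nodes Q"
  proof (intro equalityI subsetI)
    fix G assume "G \<in> dual_nodes Q"
    then have G: "G facet_of Q" unfolding dual_nodes_def by blast
    then obtain F where "F face_of P" "G = f F" using face_lattice_iso_surj[OF f] facet_of_imp_face_of by blast
    then show "G \<in> f ` dual_nodes P" using G iso_facet unfolding dual_nodes_def by blast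
  qed (use iso_facet facet_of_imp_face_of in \<open>auto simp: dual_nodes_def\<close>)
qed

lemma iso_adjacent:
  assumes F: "F \<in> dual_nodes P" and G: "G \<in> dual_nodes P"
  shows "dual_adjacent P F G \<longleftrightarrow> dual_adjacent Q (f F) (f G)"
proof -
  have FG: "F face_of P" "G face_of P" using F G facet_of_imp_face_of unfolding dual_nodes_def by blast+
  have I: "F \<inter> G face_of P" using face_of_Int FG by blast
  have "f F \<in> dual_nodes Q" "f G \<in> dual_nodes Q" using F G iso_nodes unfolding bij_betw_def by blast+
  then show ?thesis
    unfolding dual_adjacent_def ridge_of_def
    using F G I face_lattice_iso_face[OF f I] iso_dim[OF I] iso_dim_top face_lattice_iso_Int[OF f FG] by simp
qed

lemma iso_star:
  assumes v: "{v} face_of P" and w: "f {v} = {w}"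
  shows "vertex_star Q w = f ` vertex_star P v"
proof (intro set_eqI iffI)
  fix G assume "G \<in> vertex_star Q w"
  then have G: "G facet_of Q" "{w} \<subseteq> G" unfolding vertex_star_def by auto
  then have "G \<in> f ` dual_nodes P" using iso_nodes unfolding bij_betw_def dual_nodes_def by blast
  then obtain F where F: "F facet_of P" "G = f F" unfolding dual_nodes_def by blast
  then have "{v} \<subseteq> F" using face_lattice_iso_sub[OF f v facet_of_imp_face_of[OF F(1)]] w G(2) by simp
  then show "G \<in> f ` vertex_star P v" using F unfolding vertex_star_def by blast
next
  fix G assume "G \<in> f ` vertex_star P v"
  then obtain F where F: "F facet_of P" "v \<in> F" "G = f F" unfolding vertex_star_def by blast
  then have "{w} \<subseteq> G" using face_lattice_iso_sub[OF f v facet_of_imp_face_of[OF F(1)]] w by simp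
  then show "G \<in> vertex_star Q w"
    unfolding vertex_star_def using F iso_facet[OF facet_of_imp_face_of[OF F(1)]] by simp
qed

lemma iso_stars: "vertex_stars Q = (`) f ` vertex_stars P"
proof (intro equalityI subsetI)
  fix S assume "S \<in> vertex_stars Q"
  then obtain w where w: "{w} face_of Q" "S = vertex_star Q w"
    unfolding vertex_stars_def face_of_singleton by blast
  obtain D where D: "D face_of P" "{w} = f D" using face_lattice_iso_surj[OF f w(1)] by blast
  have "aff_dim (f D) = 0" using D(2) by (metis aff_dim_sing)
  then have "aff_dim D = 0" using iso_dim[OF D(1)] by simp
  then obtain v where v: "D = {v}" using aff_dim_eq_0 by blast
  then have "S = f ` vertex_star P v" using iso_star[of v w] D w by simp
  then show "S \<in> (`) f ` vertex_stars P"
    unfolding vertex_stars_def using D(1) v by (auto simp: face_of_singleton)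
next
  fix S assume "S \<in> (`) f ` vertex_stars P"
  then obtain v where v: "{v} face_of P" "S = f ` vertex_star P v"
    unfolding vertex_stars_def face_of_singleton by blast
  have "aff_dim (f {v}) = 0" using iso_dim[OF v(1)] by simp
  then obtain w where w: "f {v} = {w}" using aff_dim_eq_0 by blast
  then have "w extreme_point_of Q" using face_lattice_iso_face[OF f v(1)] by (simp add: face_of_singleton)
  then show "S \<in> vertex_stars Q" unfolding vertex_stars_def using iso_star[OF v(1) w] v(2) by blast
qed

end

lemma dual_adjacent_nodes: "dual_adjacent P F G \<Longrightarrow> F \<in> dual_nodes P \<and> G \<in> dual_nodes P"
  unfolding dual_adjacent_def by blast

lemma combinatorial_cube_with:
  fixes C :: "'a::euclidean_space set"
  assumes C: "combinatorial_cube C" and d: "2 \<le> aff_dim C"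
  shows "\<exists>\<alpha>. cube_with \<alpha> (dual_nodes C) (dual_adjacent C) (vertex_stars C)"
    and "int (card (dual_nodes C)) = 2 * aff_dim C"
proof -
  have pC: "polytope C" using C unfolding combinatorial_cube_def by blast
  obtain B f where B: "B \<subseteq> (Basis :: 'a set)" and f: "face_lattice_iso f C (cbox 0 (\<Sum>B))"
    using C unfolding combinatorial_cube_def combinatorially_equivalent_def by blast
  let ?Q = "cbox 0 (\<Sum>B)"
  have pQ: "polytope ?Q" using polytope_interval .
  have dB: "aff_dim C = int (card B)" using iso_dim_top[OF pC pQ f] aff_dim_unit_box[OF B] by simp
  then have c: "2 \<le> card B" using d by simp
  obtain \<alpha> where cube: "cube_with \<alpha> (dual_nodes ?Q) (dual_adjacent ?Q) (vertex_stars ?Q)"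
    using box_cube_with(1)[OF B c] by blast
  note g = face_lattice_iso_inv[OF f]
  show "\<exists>\<alpha>. cube_with \<alpha> (dual_nodes C) (dual_adjacent C) (vertex_stars C)"
    by (rule cube_with_image[OF cube iso_nodes[OF pQ pC g] iso_adjacent[OF pQ pC g] _ iso_stars[OF pQ pC g]])
      (use dual_adjacent_nodes in blast)+
  show "int (card (dual_nodes C)) = 2 * aff_dim C"
    using bij_betw_same_card[OF iso_nodes[OF pC pQ f]] box_cube_with(2)[OF B c] dB by simp
qed

lemma face_subset_iff_vertices:
  fixes P :: "'a::euclidean_space set"
  assumes P: "polytope P" and D: "D face_of P" and D': "D' face_of P"
  shows "D \<subseteq> D' \<longleftrightarrow> (\<forall>v. v extreme_point_of P \<longrightarrow> v \<in> D \<longrightarrow> v \<in> D')"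
proof
  assume h: "\<forall>v. v extreme_point_of P \<longrightarrow> v \<in> D \<longrightarrow> v \<in> D'"
  have pD: "polytope D" using face_of_polytope_polytope[OF P D] .
  have "D = convex hull {v. v extreme_point_of D}"
    using Krein_Milman_Minkowski[OF polytope_imp_compact[OF pD] polytope_imp_convex[OF pD]] .
  moreover have "{v. v extreme_point_of D} \<subseteq> D'" using h extreme_point_of_face[OF D] by blast
  ultimately show "D \<subseteq> D'" using hull_minimal[of _ D' convex] face_of_imp_convex[OF D'] by metis
qed blast

text \<open>
  If all facets contained \<open>v\<close>, every vertex would equal \<open>v\<close>, since a vertex is the intersection of the
  facets containing it.
\<close>

lemma facet_avoiding_vertex:
  fixes P :: "'a::euclidean_space set"
  assumes P: "polytope P" and d: "1 \<le> aff_dim P"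
  shows "\<exists>G. G facet_of P \<and> v \<notin> G"
proof (rule ccontr)
  assume "\<not> ?thesis"
  then have v: "\<And>G. G facet_of P \<Longrightarrow> v \<in> G" by blast
  have ph: "polyhedron P" using P polytope_imp_polyhedron by blast
  have PP: "P face_of P" using P polytope_imp_convex face_of_refl by blast
  have ne: "\<not> P \<subseteq> {v}"
  proof
    assume "P \<subseteq> {v}"
    then have "aff_dim P \<le> aff_dim {v}" by (rule aff_dim_subset)
    then show False using d by simp
  qed
  have w: "w = v" if "w extreme_point_of P" for w
  proof -
    have f: "{w} face_of P" using that face_of_singleton by blast
    have "{w} \<noteq> P" using d by (metis aff_dim_sing not_one_le_zero)
    then have "{w} = \<Inter>{F. F facet_of P \<and> {w} \<subseteq> F}" using face_of_polyhedron[OF ph f insert_not_empty] by blast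
    moreover have "v \<in> \<Inter>{F. F facet_of P \<and> {w} \<subseteq> F}" using v by blast
    ultimately have "v \<in> {w}" by metis
    then show ?thesis by simp
  qed
  have "P = convex hull {v. v extreme_point_of P}"
    using Krein_Milman_Minkowski[OF polytope_imp_compact[OF P] polytope_imp_convex[OF P]] .
  moreover have "{v. v extreme_point_of P} \<subseteq> {v}" using w by blast
  ultimately show False using ne hull_minimal[of _ "{v}" convex] convex_singleton by metis
qed

lemma vertex_in_face_iff:
  fixes P :: "'a::euclidean_space set"
  assumes P: "polytope P" and d: "1 \<le> aff_dim P" and D: "D face_of P" and v: "v extreme_point_of P"
  shows "v \<in> D \<longleftrightarrow> (\<forall>G. G facet_of P \<longrightarrow> D \<subseteq> G \<longrightarrow> v \<in> G)"
proof
  assume h: "\<forall>G. G facet_of P \<longrightarrow> D \<subseteq> G \<longrightarrow> v \<in> G"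
  show "v \<in> D"
  proof (cases "D = P")
    case True then show ?thesis using v unfolding extreme_point_of_def by blast
  next
    case ne: False
    show ?thesis
    proof (cases "D = {}")
      case True then show ?thesis using h facet_avoiding_vertex[OF P d, of v] by blast
    next
      case False
      have "D = \<Inter>{F. F facet_of P \<and> D \<subseteq> F}"
        using face_of_polyhedron[OF polytope_imp_polyhedron[OF P] D False ne] .
      then show ?thesis using h by blast
    qed
  qed
qed blast

lemma face_of_Int_facets:
  assumes P: "convex P" and X: "\<And>G. G \<in> X \<Longrightarrow> G facet_of P"
  shows "P \<inter> \<Inter>X face_of P"
proof (cases "X = {}")
  case True then show ?thesis using P face_of_refl by simp
next
  case False
  then have "\<Inter>X face_of P" using X facet_of_imp_face_of by (intro face_of_Inter) blast+
  then show ?thesis using face_of_Int[of P P "\<Inter>X"] P face_of_refl by blast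
qed

text \<open>
  A face is the intersection of the facets containing it, and it is the convex hull of its vertices. So
  mapping \<open>D\<close> to the intersection of the images of the facets containing \<open>D\<close> respects which vertices are
  contained in a face, if vertices with corresponding stars are identified; this makes it an order
  isomorphism.
\<close>

theorem face_lattice_iso_of_stars:
  fixes P :: "'a::euclidean_space set" and P' :: "'b::euclidean_space set"
  assumes P: "polytope P" and P': "polytope P'" and d: "1 \<le> aff_dim P" "1 \<le> aff_dim P'"
    and bij: "bij_betw \<phi> (dual_nodes P) (dual_nodes P')"
    and stars: "vertex_stars P' = (`) \<phi> ` vertex_stars P"
  shows "\<exists>\<Phi>. face_lattice_iso \<Phi> P P' \<and> (\<forall>F\<in>dual_nodes P. \<Phi> F = \<phi> F)"
proof -
  have cP: "convex P" "convex P'" using P P' polytope_imp_convex by blast+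
  have inj: "inj_on \<phi> (dual_nodes P)" and im: "\<phi> ` dual_nodes P = dual_nodes P'"
    using bij unfolding bij_betw_def by auto
  have facet: "\<phi> G facet_of P'" if "G facet_of P" for G
    using im that unfolding dual_nodes_def by blast
  have facet_ex: "\<exists>G. G facet_of P \<and> G' = \<phi> G" if "G' facet_of P'" for G'
    using im that unfolding dual_nodes_def by blast
  define \<Phi> where "\<Phi> D = P' \<inter> \<Inter>{\<phi> G | G. G facet_of P \<and> D \<subseteq> G}" for D
  have \<Phi>face: "\<Phi> D face_of P'" for D
    unfolding \<Phi>_def using cP(2) facet by (intro face_of_Int_facets) auto
  have partner: "\<exists>w. w extreme_point_of P' \<and> vertex_star P' w = \<phi> ` vertex_star P v"
    if "v extreme_point_of P" for v
  proof -
    have "vertex_star P v \<in> vertex_stars P" unfolding vertex_stars_def using that by blast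
    then have "\<phi> ` vertex_star P v \<in> vertex_stars P'" unfolding stars by blast
    then show ?thesis unfolding vertex_stars_def by auto
  qed
  have partner': "\<exists>v. v extreme_point_of P \<and> vertex_star P' w = \<phi> ` vertex_star P v"
    if "w extreme_point_of P'" for w
  proof -
    have "vertex_star P' w \<in> vertex_stars P'" unfolding vertex_stars_def using that by blast
    then have "vertex_star P' w \<in> (`) \<phi> ` vertex_stars P" unfolding stars .
    then show ?thesis unfolding vertex_stars_def by auto
  qed
  have incid: "w \<in> \<phi> G \<longleftrightarrow> v \<in> G"
    if s: "vertex_star P' w = \<phi> ` vertex_star P v" and G: "G facet_of P" for v w G
  proof -
    have "w \<in> \<phi> G \<longleftrightarrow> \<phi> G \<in> vertex_star P' w" unfolding vertex_star_def using facet[OF G] by simp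
    also have "\<dots> \<longleftrightarrow> G \<in> vertex_star P v"
      unfolding s using inj_on_image_mem_iff[OF inj, of G "vertex_star P v"] G
      unfolding dual_nodes_def vertex_star_def by blast
    finally show ?thesis unfolding vertex_star_def using G by simp
  qed
  have key: "w \<in> \<Phi> D \<longleftrightarrow> v \<in> D"
    if v: "v extreme_point_of P" and w: "w extreme_point_of P'"
      and s: "vertex_star P' w = \<phi> ` vertex_star P v" and D: "D face_of P" for v w D
  proof -
    have "w \<in> P'" using w unfolding extreme_point_of_def by blast
    then have "w \<in> \<Phi> D \<longleftrightarrow> (\<forall>G. G facet_of P \<longrightarrow> D \<subseteq> G \<longrightarrow> w \<in> \<phi> G)" unfolding \<Phi>_def by blast
    also have "\<dots> \<longleftrightarrow> (\<forall>G. G facet_of P \<longrightarrow> D \<subseteq> G \<longrightarrow> v \<in> G)" using incid[OF s] by blast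
    also have "\<dots> \<longleftrightarrow> v \<in> D" using vertex_in_face_iff[OF P d(1) D v] by simp
    finally show ?thesis .
  qed
  have order: "D \<subseteq> D' \<longleftrightarrow> \<Phi> D \<subseteq> \<Phi> D'" if D: "D face_of P" and D': "D' face_of P" for D D'
    unfolding face_subset_iff_vertices[OF P D D'] face_subset_iff_vertices[OF P' \<Phi>face \<Phi>face]
    using partner partner' key[OF _ _ _ D] key[OF _ _ _ D'] by metis
  have surj: "\<exists>D. D face_of P \<and> \<Phi> D = D'" if D': "D' face_of P'" for D'
  proof -
    define D where "D = P \<inter> \<Inter>{G. G facet_of P \<and> D' \<subseteq> \<phi> G}"
    have D: "D face_of P" unfolding D_def using cP(1) by (intro face_of_Int_facets) auto
    have "w \<in> \<Phi> D \<longleftrightarrow> w \<in> D'" if w: "w extreme_point_of P'" for w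
    proof -
      obtain v where v: "v extreme_point_of P" "vertex_star P' w = \<phi> ` vertex_star P v" using partner'[OF w] by blast
      have vP: "v \<in> P" using v unfolding extreme_point_of_def by blast
      have "w \<in> \<Phi> D \<longleftrightarrow> v \<in> D" using key[OF v(1) w v(2) D] .
      also have "\<dots> \<longleftrightarrow> (\<forall>G. G facet_of P \<longrightarrow> D' \<subseteq> \<phi> G \<longrightarrow> v \<in> G)" unfolding D_def using vP by blast
      also have "\<dots> \<longleftrightarrow> (\<forall>G. G facet_of P \<longrightarrow> D' \<subseteq> \<phi> G \<longrightarrow> w \<in> \<phi> G)" using incid[OF v(2)] by blast
      also have "\<dots> \<longleftrightarrow> (\<forall>G'. G' facet_of P' \<longrightarrow> D' \<subseteq> G' \<longrightarrow> w \<in> G')" using facet facet_ex by metis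
      also have "\<dots> \<longleftrightarrow> w \<in> D'" using vertex_in_face_iff[OF P' d(2) D' w] by simp
      finally show ?thesis .
    qed
    then have "\<Phi> D = D'"
      using face_subset_iff_vertices[OF P' \<Phi>face D'] face_subset_iff_vertices[OF P' D' \<Phi>face] by blast
    then show ?thesis using D by blast
  qed
  have "face_lattice_iso \<Phi> P P'" unfolding face_lattice_iso_def bij_betw_def
  proof (intro conjI allI impI)
    show "inj_on \<Phi> {F. F face_of P}" unfolding inj_on_def using order by blast
    show "\<Phi> ` {F. F face_of P} = {F. F face_of P'}" using \<Phi>face surj by blast
  qed (use order in blast)
  moreover have "\<Phi> F = \<phi> F" if "F \<in> dual_nodes P" for F
  proof -
    have F: "F facet_of P" using that unfolding dual_nodes_def by blast
    then have "{\<phi> G | G. G facet_of P \<and> F \<subseteq> G} = {\<phi> F}" using facet_eq_of_subset by blast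
    then show ?thesis unfolding \<Phi>_def using facet_of_imp_subset[OF facet[OF F]] by auto
  qed
  ultimately show ?thesis by blast
qed

section \<open>Cutting a polytope by a hyperplane\<close>

lemma in_open_segment_dir:
  fixes p d :: "'a::real_vector"
  assumes "d \<noteq> 0" "0 < s" "0 < t"
  shows "p \<in> open_segment (p - s *\<^sub>R d) (p + t *\<^sub>R d)"
proof -
  define u where "u = s / (s + t)"
  have u: "0 < u" "u < 1" unfolding u_def using assms by (auto simp: field_simps)
  have "u * (s + t) = s" unfolding u_def using assms by simp
  then have e: "u * t - (1 - u) * s = 0" by (simp add: algebra_simps)
  have "(1 - u) *\<^sub>R (p - s *\<^sub>R d) + u *\<^sub>R (p + t *\<^sub>R d) = p + (u * t - (1 - u) * s) *\<^sub>R d"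
    by (simp add: algebra_simps)
  then have "p = (1 - u) *\<^sub>R (p - s *\<^sub>R d) + u *\<^sub>R (p + t *\<^sub>R d)" using e by simp
  moreover have "p - s *\<^sub>R d \<noteq> p + t *\<^sub>R d"
  proof
    assume "p - s *\<^sub>R d = p + t *\<^sub>R d"
    then have "(s + t) *\<^sub>R d = 0" by (simp add: algebra_simps)
    then show False using assms by simp
  qed
  ultimately show ?thesis unfolding in_segment using u by blast
qed

lemma open_segment_dir:
  fixes p x z :: "'a::real_vector"
  assumes "p \<in> open_segment x z"
  obtains u where "0 < u" "u < 1" "x = p - u *\<^sub>R (z - x)" "z = p + (1 - u) *\<^sub>R (z - x)" "z - x \<noteq> 0"
proof -
  obtain u where u: "x \<noteq> z" "0 < u" "u < 1" "p = (1 - u) *\<^sub>R x + u *\<^sub>R z" using assms unfolding in_segment by blast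
  show thesis using that[OF u(2,3)] u(1,4) by (simp add: algebra_simps)
qed

lemma shrink_below:
  fixes a :: "'a::euclidean_space"
  assumes P: "convex P" and p: "p \<in> P" "a \<bullet> p < b" and z: "z \<in> P"
  obtains t where "0 < t" "t \<le> 1" "p + t *\<^sub>R (z - p) \<in> P" "a \<bullet> (p + t *\<^sub>R (z - p)) < b"
proof -
  define r where "r = a \<bullet> (z - p)"
  define t where "t = min 1 ((b - a \<bullet> p) / (2 * (\<bar>r\<bar> + 1)))"
  have t: "0 < t" "t \<le> 1" unfolding t_def using p by auto
  have "t * (\<bar>r\<bar> + 1) \<le> (b - a \<bullet> p) / 2"
  proof -
    have "t \<le> (b - a \<bullet> p) / (2 * (\<bar>r\<bar> + 1))" unfolding t_def by simp
    then have "t * (\<bar>r\<bar> + 1) \<le> (b - a \<bullet> p) / (2 * (\<bar>r\<bar> + 1)) * (\<bar>r\<bar> + 1)" by (intro mult_right_mono) auto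
    also have "\<dots> = (b - a \<bullet> p) / 2" by (simp add: field_simps)
    finally show ?thesis .
  qed
  moreover have "t * r \<le> t * (\<bar>r\<bar> + 1)" using t by (intro mult_left_mono) auto
  ultimately have "a \<bullet> (p + t *\<^sub>R (z - p)) < b"
    using p(2) unfolding r_def by (simp add: inner_add_right)
  moreover have "p + t *\<^sub>R (z - p) \<in> P"
  proof -
    have "p + t *\<^sub>R (z - p) = (1 - t) *\<^sub>R p + t *\<^sub>R z" by (simp add: algebra_simps)
    then show ?thesis using convexD[OF P p(1) z, of "1 - t" t] t by simp
  qed
  ultimately show thesis using that t by blast
qed

lemma aff_dim_lower_part:
  fixes X :: "'a::euclidean_space set"
  assumes X: "convex X" and x: "x \<in> X" "a \<bullet> x < b"
  shows "aff_dim (X \<inter> {x. a \<bullet> x \<le> b}) = aff_dim X"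
proof -
  have "X \<inter> {x. a \<bullet> x < b} \<noteq> {}" using x by blast
  then have "aff_dim (X \<inter> {x. a \<bullet> x < b}) = aff_dim X"
    using aff_dim_convex_Int_open[OF X open_halfspace_lt] by blast
  moreover have "aff_dim (X \<inter> {x. a \<bullet> x < b}) \<le> aff_dim (X \<inter> {x. a \<bullet> x \<le> b})" by (intro aff_dim_subset) auto
  moreover have "aff_dim (X \<inter> {x. a \<bullet> x \<le> b}) \<le> aff_dim X" by (intro aff_dim_subset) auto
  ultimately show ?thesis by linarith
qed

lemma rel_interior_below:
  fixes X :: "'a::euclidean_space set"
  assumes X: "convex X" and x: "x \<in> X" "a \<bullet> x < b"
  shows "\<exists>p \<in> rel_interior X. a \<bullet> p < b"
proof (rule ccontr)
  assume "\<not> ?thesis"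
  then have "rel_interior X \<subseteq> {x. b \<le> a \<bullet> x}" by (auto simp: not_less)
  then have "closure (rel_interior X) \<subseteq> {x. b \<le> a \<bullet> x}"
    by (rule closure_minimal) (rule closed_halfspace_ge)
  then have "X \<subseteq> {x. b \<le> a \<bullet> x}" using convex_closure_rel_interior[OF X] closure_subset by blast
  then show False using x by auto
qed

lemma aff_dim_hyperplane_part:
  fixes X :: "'a::euclidean_space set"
  assumes X: "convex X" and x: "x \<in> X" "a \<bullet> x < b" and y: "y \<in> X" "b < a \<bullet> y"
  shows "aff_dim (X \<inter> {x. a \<bullet> x = b}) = aff_dim X - 1"
proof -
  obtain x' where x': "x' \<in> rel_interior X" "a \<bullet> x' < b" using rel_interior_below[OF X x] by blast
  obtain y' where y': "y' \<in> rel_interior X" "b < a \<bullet> y'"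
    using rel_interior_below[OF X y(1), of "-a" "-b"] y(2) by auto
  define u where "u = (b - a \<bullet> x') / (a \<bullet> y' - a \<bullet> x')"
  define p where "p = (1 - u) *\<^sub>R x' + u *\<^sub>R y'"
  have u: "0 \<le> u" "u \<le> 1" unfolding u_def using x' y' by (auto simp: field_simps)
  have "u * (a \<bullet> y' - a \<bullet> x') = b - a \<bullet> x'" unfolding u_def using x' y' by simp
  then have ap: "a \<bullet> p = b" unfolding p_def by (simp add: inner_simps algebra_simps)
  have p: "p \<in> rel_interior X"
    unfolding p_def using convexD[OF convex_rel_interior[OF X] x'(1) y'(1)] u by simp
  then obtain e where e: "0 < e" "ball p e \<inter> affine hull X \<subseteq> X" unfolding rel_interior_ball by blast
  let ?A = "affine hull X \<inter> {x. a \<bullet> x = b}"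
  have "p \<in> X" using p rel_interior_subset by blast
  then have pA: "p \<in> ?A" using ap by (simp add: hull_inc)
  have cA: "convex ?A" by (intro convex_Int affine_imp_convex affine_affine_hull convex_hyperplane)
  have "x \<in> affine hull X" using x(1) by (rule hull_inc)
  then have "\<not> affine hull X \<subseteq> {v. a \<bullet> v = b}" using x(2) by auto
  then have dA: "aff_dim ?A = aff_dim X - 1"
    using aff_dim_affine_Int_hyperplane[OF affine_affine_hull, of X a b] pA by auto
  have "p \<in> ?A \<inter> ball p e" using pA e(1) by simp
  then have "aff_dim (?A \<inter> ball p e) = aff_dim ?A" using aff_dim_convex_Int_open[OF cA open_ball] by blast
  moreover have "aff_dim (?A \<inter> ball p e) \<le> aff_dim (X \<inter> {x. a \<bullet> x = b})"
    using e(2) by (intro aff_dim_subset) auto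
  moreover have "aff_dim (X \<inter> {x. a \<bullet> x = b}) \<le> aff_dim ?A"
    using hull_subset[of X affine] by (intro aff_dim_subset) auto
  ultimately show ?thesis using dA by linarith
qed

lemma facet_lower_part:
  fixes P :: "'a::euclidean_space set"
  assumes P: "convex P" and X: "X facet_of P" and x: "x \<in> X" "a \<bullet> x < b"
  shows "(X \<inter> {x. a \<bullet> x \<le> b}) facet_of (P \<inter> {x. a \<bullet> x \<le> b})"
proof -
  have Xf: "X face_of P" "aff_dim X = aff_dim P - 1" using X unfolding facet_of_def by auto
  have "x \<in> P" using x(1) face_of_imp_subset[OF Xf(1)] by blast
  then have "aff_dim (P \<inter> {x. a \<bullet> x \<le> b}) = aff_dim P" using aff_dim_lower_part[OF P _ x(2)] by blast
  moreover have "aff_dim (X \<inter> {x. a \<bullet> x \<le> b}) = aff_dim X"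
    using aff_dim_lower_part[OF face_of_imp_convex[OF Xf(1)] x] .
  moreover have "(X \<inter> {x. a \<bullet> x \<le> b}) face_of (P \<inter> {x. a \<bullet> x \<le> b})"
    using face_of_slice[OF Xf(1) convex_halfspace_le] .
  moreover have "X \<inter> {x. a \<bullet> x \<le> b} \<noteq> {}" using x by (force simp: less_imp_le)
  ultimately show ?thesis unfolding facet_of_def using Xf(2) by simp
qed

lemma facet_lower_part_inj:
  fixes P :: "'a::euclidean_space set"
  assumes X: "X facet_of P" and Y: "Y facet_of P" and x: "x \<in> X" "a \<bullet> x < b"
    and eq: "X \<inter> {x. a \<bullet> x \<le> b} = Y \<inter> {x. a \<bullet> x \<le> b}"
  shows "X = Y"
proof -
  have XY: "X \<inter> Y face_of P" using face_of_Int X Y facet_of_imp_face_of by blast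
  have cX: "convex X" using X facet_of_imp_face_of face_of_imp_convex by blast
  have "aff_dim X = aff_dim (X \<inter> {x. a \<bullet> x \<le> b})" using aff_dim_lower_part[OF cX x] by simp
  also have "\<dots> \<le> aff_dim (X \<inter> Y)" using eq by (intro aff_dim_subset) blast
  finally have "aff_dim (X \<inter> Y) = aff_dim X" using aff_dim_subset[of "X \<inter> Y" X] by simp
  then have "X \<inter> Y = X" using face_eq_of_aff_dim[OF XY facet_of_imp_face_of[OF X]] by blast
  then show ?thesis using facet_eq_of_subset[OF X Y] by blast
qed

text \<open>
  A relative interior point of \<open>Y\<close> strictly below the hyperplane is in the relative boundary of \<open>P\<close>, as
  near it \<open>P\<close> and its lower part agree. So it is on a facet \<open>X\<close> of \<open>P\<close>, whose lower part contains \<open>Y\<close>.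
\<close>

lemma facet_of_lower_part_extends:
  fixes P :: "'a::euclidean_space set"
  assumes P: "polytope P" and Y: "Y facet_of (P \<inter> {x. a \<bullet> x \<le> b})" and y: "y \<in> Y" "a \<bullet> y < b"
  obtains X x where "X facet_of P" "x \<in> X" "a \<bullet> x < b" "X \<inter> {x. a \<bullet> x \<le> b} = Y"
proof -
  let ?L = "P \<inter> {x. a \<bullet> x \<le> b}"
  have cP: "convex P" using P polytope_imp_convex by blast
  have Yf: "Y face_of ?L" using facet_of_imp_face_of[OF Y] .
  have cY: "convex Y" using face_of_imp_convex[OF Yf] .
  obtain p where p: "p \<in> rel_interior Y" "a \<bullet> p < b" using rel_interior_below[OF cY y] by blast
  have pY: "p \<in> Y" using p rel_interior_subset by blast
  have pP: "p \<in> P" using pY face_of_imp_subset[OF Yf] by blast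
  have "p \<notin> rel_interior P"
  proof
    assume ri: "p \<in> rel_interior P"
    have "?L \<subseteq> Y"
    proof
      fix x assume x: "x \<in> ?L"
      show "x \<in> Y"
      proof (cases "x = p")
        case True then show ?thesis using pY by simp
      next
        case False
        have "x \<in> affine hull P" using x by (simp add: hull_inc)
        then obtain e where e: "1 < e" "(1 - e) *\<^sub>R x + e *\<^sub>R p \<in> P"
          using convex_rel_interior_if2[OF cP ri] by blast
        define z where "z = (1 - e) *\<^sub>R x + e *\<^sub>R p"
        have z: "z - p = (e - 1) *\<^sub>R (p - x)" unfolding z_def by (simp add: algebra_simps)
        have zP: "z \<in> P" using e unfolding z_def by blast
        obtain t where t: "0 < t" "p + t *\<^sub>R (z - p) \<in> P" "a \<bullet> (p + t *\<^sub>R (z - p)) < b"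
          by (rule shrink_below[OF cP pP p(2) zP]) blast
        have "p \<in> open_segment (p - 1 *\<^sub>R (p - x)) (p + (t * (e - 1)) *\<^sub>R (p - x))"
          using False t(1) e(1) by (intro in_open_segment_dir) auto
        then have "p \<in> open_segment x (p + t *\<^sub>R (z - p))" unfolding z by simp
        moreover have "p + t *\<^sub>R (z - p) \<in> ?L" using t by auto
        ultimately show ?thesis using face_ofD[OF Yf _ x _ pY] by blast
      qed
    qed
    then have "Y = ?L" using face_of_imp_subset[OF Yf] by blast
    then show False using Y by simp
  qed
  moreover have "rel_frontier P = P - rel_interior P"
    unfolding rel_frontier_def using polytope_imp_closed[OF P] closure_closed by blast
  ultimately have "p \<in> \<Union>{X. X facet_of P}"
    using pP rel_frontier_of_polyhedron[OF polytope_imp_polyhedron[OF P]] by blast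
  then obtain X where X: "X facet_of P" "p \<in> X" by blast
  have XL: "(X \<inter> {x. a \<bullet> x \<le> b}) facet_of ?L" using facet_lower_part[OF cP X p(2)] .
  have "Y \<subseteq> X \<inter> {x. a \<bullet> x \<le> b}"
    using subset_of_face_of[OF facet_of_imp_face_of[OF XL] facet_of_imp_subset[OF Y]] p X(2) by force
  then have "Y = X \<inter> {x. a \<bullet> x \<le> b}" using facet_eq_of_subset[OF Y XL] by blast
  then show thesis using that X p(2) by blast
qed

lemma extreme_point_of_lower_part:
  fixes P :: "'a::euclidean_space set"
  assumes P: "convex P" and v: "v extreme_point_of (P \<inter> {x. a \<bullet> x \<le> b})" and av: "a \<bullet> v < b"
  shows "v extreme_point_of P"
  unfolding extreme_point_of_def
proof (intro conjI ballI notI)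
  show vP: "v \<in> P" using v unfolding extreme_point_of_def by blast
  fix x z assume x: "x \<in> P" and z: "z \<in> P" and seg: "v \<in> open_segment x z"
  obtain u where u: "0 < u" "u < 1" "x = v - u *\<^sub>R (z - x)" "z = v + (1 - u) *\<^sub>R (z - x)" "z - x \<noteq> 0"
    using open_segment_dir[OF seg] by blast
  obtain s where s: "0 < s" "v + s *\<^sub>R (x - v) \<in> P" "a \<bullet> (v + s *\<^sub>R (x - v)) < b"
    by (rule shrink_below[OF P vP av x]) blast
  obtain t where t: "0 < t" "v + t *\<^sub>R (z - v) \<in> P" "a \<bullet> (v + t *\<^sub>R (z - v)) < b"
    by (rule shrink_below[OF P vP av z]) blast
  define d where "d = z - x"
  have "x - v = - u *\<^sub>R d" "z - v = (1 - u) *\<^sub>R d" using u(3,4) unfolding d_def by (auto simp: algebra_simps)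
  then have "v + s *\<^sub>R (x - v) = v - (s * u) *\<^sub>R d" "v + t *\<^sub>R (z - v) = v + (t * (1 - u)) *\<^sub>R d" by auto
  moreover have "v \<in> open_segment (v - (s * u) *\<^sub>R d) (v + (t * (1 - u)) *\<^sub>R d)"
    using u s t unfolding d_def by (intro in_open_segment_dir) auto
  ultimately have "v \<in> open_segment (v + s *\<^sub>R (x - v)) (v + t *\<^sub>R (z - v))" by simp
  moreover have "v + s *\<^sub>R (x - v) \<in> P \<inter> {x. a \<bullet> x \<le> b}" "v + t *\<^sub>R (z - v) \<in> P \<inter> {x. a \<bullet> x \<le> b}"
    using s t by auto
  ultimately show False using v unfolding extreme_point_of_def by blast
qed

text \<open>
  The hyperplane that defines the facet \<open>Q \<inter> C\<close> of \<open>Q\<close> separates \<open>Q\<close> from \<open>C\<close>: a point of \<open>C\<close> that is not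
  strictly above it is in \<open>Q\<close>, since otherwise the segment from a point of \<open>Q\<close> strictly below would pass
  through \<open>Q \<inter> C\<close> while still strictly below. The case \<open>P = Q\<close> occurs when \<open>C\<close> is itself a facet of \<open>Q\<close>.
\<close>

lemma union_along_facet_is_cut:
  fixes P Q C :: "'a::euclidean_space set"
  assumes P: "polytope P" and Q: "polytope Q" and C: "polytope C"
    and PQC: "P = Q \<union> C" and F: "(Q \<inter> C) facet_of Q" and ne: "P \<noteq> Q"
  obtains a b q c where "Q = P \<inter> {x. a \<bullet> x \<le> b}" "C = P \<inter> {x. b \<le> a \<bullet> x}" "Q \<inter> C = P \<inter> {x. a \<bullet> x = b}"
    "q \<in> P" "a \<bullet> q < b" "c \<in> P" "b < a \<bullet> c"
proof -
  obtain a b where ab: "Q \<subseteq> {x. a \<bullet> x \<le> b}" "Q \<inter> C = Q \<inter> {x. a \<bullet> x = b}"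
    using facet_of_polyhedron[OF polytope_imp_polyhedron[OF Q] F] by metis
  have "Q \<inter> C \<noteq> Q" using F by auto
  then obtain q where q: "q \<in> Q" "a \<bullet> q < b" using ab by (force simp: less_le)
  have below: "x \<in> Q" if x: "x \<in> C" "a \<bullet> x \<le> b" for x
  proof (rule ccontr)
    assume n: "x \<notin> Q"
    have "closed_segment q x \<subseteq> Q \<union> C"
      using closed_segment_subset[OF _ _ polytope_imp_convex[OF P]] q x PQC by blast
    moreover have "Q \<inter> closed_segment q x \<noteq> {}" "C \<inter> closed_segment q x \<noteq> {}" using q x by auto
    moreover have "closed Q" "closed C" using Q C polytope_imp_closed by blast+
    ultimately have "Q \<inter> C \<inter> closed_segment q x \<noteq> {}"
      using connected_segment(1)[of q x] unfolding connected_closed by blast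
    then obtain z where z: "z \<in> Q" "z \<in> C" "z \<in> closed_segment q x" by blast
    then obtain t where t: "0 \<le> t" "t \<le> 1" "z = (1 - t) *\<^sub>R q + t *\<^sub>R x" unfolding in_segment by blast
    have "t \<noteq> 1" using t(3) z(1) n by auto
    then have "(1 - t) * (a \<bullet> q) < (1 - t) * b" using t(2) q(2) by simp
    moreover have "t * (a \<bullet> x) \<le> t * b" using t(1) x(2) by (rule mult_left_mono[rotated])
    ultimately have "a \<bullet> z < b" unfolding t(3) by (simp add: inner_simps algebra_simps)
    then show False using z ab(2) by auto
  qed
  have 1: "Q = P \<inter> {x. a \<bullet> x \<le> b}" using PQC ab(1) below by blast
  have "b \<le> a \<bullet> x" if "x \<in> C" for x
  proof (rule ccontr)
    assume "\<not> ?thesis"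
    then have "x \<in> Q" "a \<bullet> x < b" using below that by auto
    then show False using that ab(2) by auto
  qed
  then have 2: "C = P \<inter> {x. b \<le> a \<bullet> x}" using PQC ab by (auto intro: antisym)
  have 3: "Q \<inter> C = P \<inter> {x. a \<bullet> x = b}" using 1 2 by auto
  obtain c where c: "c \<in> C" "c \<notin> Q" using PQC ne by blast
  then have "b < a \<bullet> c" using below[OF c(1)] c(2) not_le by blast
  then show thesis using that[OF 1 2 3] q c PQC by blast
qed

section \<open>Capping without crossing facets\<close>

text \<open>
  Reversing the sign of \<open>a\<close> and \<open>b\<close> exchanges \<open>Q\<close> and \<open>C\<close>; so only \<open>Q\<close> is treated, and facts on \<open>C\<close> follow by
  the lemma \<open>mirror\<close>. For the same reason "some point of \<open>X\<close> is strictly below" is expressed as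
  \<open>\<not> X \<subseteq> C\<close>.
\<close>

locale cut =
  fixes P Q C F :: "'a::euclidean_space set" and a :: 'a and b :: real and q c :: 'a
  assumes polytope_P: "polytope P"
    and Q_eq: "Q = P \<inter> {x. a \<bullet> x \<le> b}" and C_eq: "C = P \<inter> {x. b \<le> a \<bullet> x}"
    and F_eq: "F = P \<inter> {x. a \<bullet> x = b}"
    and q: "q \<in> P" "a \<bullet> q < b" and c: "c \<in> P" "b < a \<bullet> c"
begin

lemma mirror: "cut P C Q F (-a) (-b) c q"
  by unfold_locales (use polytope_P Q_eq C_eq F_eq q c in auto)

lemma convex_P: "convex P"
  using polytope_P polytope_imp_convex by blast

lemma Q_Int_C: "Q \<inter> C = F" and Q_Un_C: "Q \<union> C = P"
  unfolding Q_eq C_eq F_eq by auto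

lemma F_sub: "F \<subseteq> Q" "F \<subseteq> C"
  using Q_Int_C by auto

lemma below: "X \<subseteq> P \<Longrightarrow> \<not> X \<subseteq> C \<Longrightarrow> \<exists>x\<in>X. a \<bullet> x < b"
  unfolding C_eq by fastforce

lemma Int_Q: "X \<subseteq> P \<Longrightarrow> X \<inter> Q = X \<inter> {x. a \<bullet> x \<le> b}"
  unfolding Q_eq by blast

lemma polytope_Q: "polytope Q"
  unfolding Q_eq using polytope_Int_polyhedron[OF polytope_P polyhedron_halfspace_le] .

lemma dim_Q: "aff_dim Q = aff_dim P"
  unfolding Q_eq using aff_dim_lower_part[OF convex_P q] .

lemma dim_F: "aff_dim F = aff_dim P - 1"
  unfolding F_eq using aff_dim_hyperplane_part[OF convex_P q c] .

lemma F_nonempty: "F \<noteq> {}"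
proof
  assume "F = {}"
  then have "aff_dim P = 0" using dim_F by simp
  then obtain x where "P = {x}" using aff_dim_eq_0 by blast
  then show False using q c by auto
qed

lemma F_facet: "F facet_of Q"
proof -
  have "F = Q \<inter> {x. a \<bullet> x = b}" unfolding F_eq Q_eq by auto
  moreover have "(Q \<inter> {x. a \<bullet> x = b}) face_of Q"
    using polytope_imp_convex[OF polytope_Q] unfolding Q_eq
    by (intro face_of_Int_supporting_hyperplane_le) auto
  ultimately show ?thesis unfolding facet_of_def using F_nonempty dim_F dim_Q by simp
qed

text \<open>
  A facet inside \<open>F\<close> would be equal to \<open>F\<close>, but a segment from \<open>q\<close> to \<open>c\<close> crosses \<open>F\<close> in an inner point.
\<close>

lemma facet_not_in_F:
  assumes X: "X facet_of P" shows "\<not> X \<subseteq> F"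
proof
  assume sub: "X \<subseteq> F"
  have dX: "aff_dim X = aff_dim F" using X dim_F unfolding facet_of_def by simp
  have "X = affine hull X \<inter> P" using face_of_imp_eq_affine_Int[OF convex_P facet_of_imp_face_of[OF X]] .
  moreover have "affine hull X = affine hull F" using aff_dim_eq_full_gen[OF sub] dX by blast
  ultimately have XF: "X = F" using sub hull_subset[of F affine] F_eq by blast
  define t where "t = (b - a \<bullet> q) / (a \<bullet> c - a \<bullet> q)"
  have t: "0 < t" "t < 1" unfolding t_def using q c by (auto simp: field_simps)
  define z where "z = (1 - t) *\<^sub>R q + t *\<^sub>R c"
  have "t * (a \<bullet> c - a \<bullet> q) = b - a \<bullet> q" unfolding t_def using q c by simp
  then have "a \<bullet> z = b" unfolding z_def by (simp add: inner_simps algebra_simps)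
  moreover have "z \<in> P" unfolding z_def using convexD[OF convex_P q(1) c(1), of "1 - t" t] t by simp
  ultimately have "z \<in> X" unfolding XF F_eq by blast
  moreover have "q \<noteq> c" using q c by auto
  then have "z \<in> open_segment q c" unfolding in_segment z_def using t by blast
  ultimately have "q \<in> X" using face_ofD[OF facet_of_imp_face_of[OF X] _ q(1) c(1)] by blast
  then show False unfolding XF F_eq using q by auto
qed

lemma facet_not_in_both: "X facet_of P \<Longrightarrow> \<not> (X \<subseteq> Q \<and> X \<subseteq> C)"
  using facet_not_in_F Q_Int_C by blast

lemma facet_Int_Q:
  assumes X: "X facet_of P" and n: "\<not> X \<subseteq> C"
  shows "(X \<inter> Q) facet_of Q" "X \<inter> Q \<noteq> F"
proof -
  have sub: "X \<subseteq> P" using facet_of_imp_subset[OF X] .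
  obtain x where x: "x \<in> X" "a \<bullet> x < b" using below[OF sub n] by blast
  show "(X \<inter> Q) facet_of Q"
    using facet_lower_part[OF convex_P X x] unfolding Int_Q[OF sub] Q_eq[symmetric] .
  have "x \<in> X \<inter> Q" unfolding Int_Q[OF sub] using x by simp
  then show "X \<inter> Q \<noteq> F" using x unfolding F_eq by auto
qed

lemma facet_Int_Q_inj:
  assumes X: "X facet_of P" "\<not> X \<subseteq> C" and Y: "Y facet_of P" and eq: "X \<inter> Q = Y \<inter> Q"
  shows "X = Y"
proof -
  have sub: "X \<subseteq> P" "Y \<subseteq> P" using facet_of_imp_subset X(1) Y by blast+
  obtain x where "x \<in> X" "a \<bullet> x < b" using below[OF sub(1) X(2)] by blast
  then show ?thesis using facet_lower_part_inj[OF X(1) Y] eq unfolding Int_Q[OF sub(1)] Int_Q[OF sub(2)] by blast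
qed

lemma facet_Q_extends:
  assumes Y: "Y facet_of Q" "Y \<noteq> F"
  obtains X where "X facet_of P" "\<not> X \<subseteq> C" "X \<inter> Q = Y"
proof -
  have sub: "Y \<subseteq> P" using facet_of_imp_subset[OF Y(1)] unfolding Q_eq by blast
  have "\<not> Y \<subseteq> F" using facet_eq_of_subset[OF Y(1) F_facet] Y(2) by blast
  then have "\<not> Y \<subseteq> C" using facet_of_imp_subset[OF Y(1)] Q_Int_C by blast
  then obtain y where y: "y \<in> Y" "a \<bullet> y < b" using below[OF sub] by blast
  obtain X x where X: "X facet_of P" "x \<in> X" "a \<bullet> x < b" "X \<inter> {x. a \<bullet> x \<le> b} = Y"
    using facet_of_lower_part_extends[OF polytope_P Y(1)[unfolded Q_eq] y] by blast
  moreover have "\<not> X \<subseteq> C" using X unfolding C_eq by force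
  moreover have "X \<inter> Q = Y" using Int_Q[OF facet_of_imp_subset[OF X(1)]] X(4) by simp
  ultimately show thesis using that by blast
qed

lemma bij_facets_Q: "bij_betw (\<lambda>X. X \<inter> Q) {X. X facet_of P \<and> \<not> X \<subseteq> C} (dual_nodes Q - {F})"
  unfolding bij_betw_def
proof
  show "inj_on (\<lambda>X. X \<inter> Q) {X. X facet_of P \<and> \<not> X \<subseteq> C}"
    by (rule inj_onI) (use facet_Int_Q_inj in blast)
  show "(\<lambda>X. X \<inter> Q) ` {X. X facet_of P \<and> \<not> X \<subseteq> C} = dual_nodes Q - {F}"
  proof (intro equalityI subsetI)
    fix Y assume "Y \<in> dual_nodes Q - {F}"
    then have "Y facet_of Q" "Y \<noteq> F" unfolding dual_nodes_def by auto
    then obtain X where "X facet_of P" "\<not> X \<subseteq> C" "X \<inter> Q = Y" using facet_Q_extends by blast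
    then show "Y \<in> (\<lambda>X. X \<inter> Q) ` {X. X facet_of P \<and> \<not> X \<subseteq> C}" by blast
  qed (use facet_Int_Q in \<open>auto simp: dual_nodes_def\<close>)
qed

lemma extreme_Q: "v extreme_point_of Q \<Longrightarrow> v \<notin> F \<Longrightarrow> v extreme_point_of P"
proof -
  assume v: "v extreme_point_of Q" "v \<notin> F"
  then have "v \<in> Q" unfolding extreme_point_of_def by blast
  then have "a \<bullet> v < b" using v(2) unfolding Q_eq F_eq by (simp add: less_le)
  then show ?thesis using extreme_point_of_lower_part[OF convex_P v(1)[unfolded Q_eq]] by blast
qed

lemma extreme_P: "v extreme_point_of P \<Longrightarrow> v \<in> Q \<Longrightarrow> v extreme_point_of Q"
  unfolding extreme_point_of_def Q_eq by blast

lemma extreme_F: "v extreme_point_of F \<longleftrightarrow> v extreme_point_of Q \<and> v \<in> F"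
  using extreme_point_of_face[OF facet_of_imp_face_of[OF F_facet]] .

text \<open>
  A crossing facet is cut by the same hyperplane, so all facts on cuts apply one dimension lower.
\<close>

lemma cut_facet:
  assumes X: "X facet_of P" "\<not> X \<subseteq> Q" "\<not> X \<subseteq> C"
  shows "\<exists>q c. cut X (X \<inter> Q) (X \<inter> C) (X \<inter> F) a b q c"
proof -
  have sub: "X \<subseteq> P" using facet_of_imp_subset X(1) by blast
  obtain x where x: "x \<in> X" "a \<bullet> x < b" using below[OF sub X(3)] by blast
  obtain y where y: "y \<in> X" "b < a \<bullet> y" using cut.below[OF mirror sub X(2)] by auto
  have "cut X (X \<inter> Q) (X \<inter> C) (X \<inter> F) a b x y"
    by unfold_locales (use facet_polytope[OF polytope_P X(1)] sub x y in \<open>auto simp: Q_eq C_eq F_eq\<close>)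
  then show ?thesis by blast
qed

end

lemma dual_adjacent_dim:
  fixes P :: "'a::euclidean_space set"
  assumes "F facet_of P" "G facet_of P"
  shows "dual_adjacent P F G \<longleftrightarrow> aff_dim (F \<inter> G) = aff_dim P - 2"
  using assms face_of_Int facet_of_imp_face_of unfolding dual_adjacent_def dual_nodes_def ridge_of_def by blast

lemma dual_graph_on: "polytope P \<Longrightarrow> graph_on (dual_nodes P) (dual_adjacent P)"
  unfolding graph_on_def using finite_dual_nodes dual_adjacent_nodes dual_adjacent_neq dual_adjacent_sym by blast

lemma vertex_in_two_facets:
  fixes P :: "'a::euclidean_space set"
  assumes P: "polytope P" and d: "2 \<le> aff_dim P" and v: "v extreme_point_of P" and F: "F facet_of P"
  obtains G where "G facet_of P" "G \<noteq> F" "v \<in> G"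
proof -
  have f: "{v} face_of P" using v face_of_singleton by blast
  have "{v} \<noteq> P" using d by (metis aff_dim_sing not_numeral_le_zero)
  then have eq: "{v} = \<Inter>{F. F facet_of P \<and> {v} \<subseteq> F}"
    using face_of_polyhedron[OF polytope_imp_polyhedron[OF P] f insert_not_empty] by blast
  have "\<not> F \<subseteq> {v}"
  proof
    assume "F \<subseteq> {v}"
    then have "aff_dim F \<le> aff_dim {v}" by (rule aff_dim_subset)
    then show False using F d unfolding facet_of_def by simp
  qed
  then obtain x where x: "x \<in> F" "x \<noteq> v" by blast
  then have "x \<notin> \<Inter>{F. F facet_of P \<and> {v} \<subseteq> F}" using eq by (metis singletonD)
  then obtain G where "G facet_of P" "{v} \<subseteq> G" "x \<notin> G" by blast
  then show thesis using that x(1) by blast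
qed

definition polytope_system :: "'a::euclidean_space set \<Rightarrow> bool" where
  "polytope_system P \<longleftrightarrow> capped_system (dual_nodes P) (dual_adjacent P) (vertex_stars P)"

locale cap_cut = cut +
  assumes cubical_P: "cubical_polytope P" and cubical_Q: "cubical_polytope Q"
    and cube_C: "combinatorial_cube C" and dim_P: "3 \<le> aff_dim P"
begin

lemmas mF_facet = cut.F_facet[OF mirror]
  and polytope_C = cut.polytope_Q[OF mirror]
  and dim_C = cut.dim_Q[OF mirror]
  and facet_Int_C = cut.facet_Int_Q[OF mirror]
  and facet_Int_C_inj = cut.facet_Int_Q_inj[OF mirror]
  and facet_C_extends = cut.facet_Q_extends[OF mirror]
  and extreme_C = cut.extreme_Q[OF mirror]
  and extreme_P_C = cut.extreme_P[OF mirror]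
  and extreme_F_C = cut.extreme_F[OF mirror]

lemma cube_C_with: "\<exists>\<alpha>. cube_with \<alpha> (dual_nodes C) (dual_adjacent C) (vertex_stars C)"
  and card_C: "int (card (dual_nodes C)) = 2 * aff_dim P"
  using combinatorial_cube_with[OF cube_C] dim_C dim_P by auto

text \<open>
  Facets, being of the same dimension as in \<open>P\<close>, are adjacent in \<open>P\<close> if and only if they are in \<open>Q\<close> or
  \<open>C\<close>. A facet of \<open>Q\<close> and one of \<open>C\<close> meet inside \<open>F\<close>, so they are adjacent if and only if they meet \<open>F\<close> in
  the same facet of \<open>F\<close>. A vertex of \<open>F\<close> stays a vertex since it lies on a second facet of \<open>Q\<close>, which is
  a face of \<open>P\<close>.
\<close>

lemma system_not_crossing:
  assumes nc: "\<And>X. X facet_of P \<Longrightarrow> X \<subseteq> Q \<or> X \<subseteq> C" and sys: "polytope_system Q"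
  shows "polytope_system P"
proof -
  have dQ: "2 \<le> aff_dim Q" and dC: "2 \<le> aff_dim C" using dim_Q dim_C dim_P by auto
  have facet_Q: "Y facet_of P" if Y: "Y facet_of Q" "Y \<noteq> F" for Y
  proof -
    obtain X where X: "X facet_of P" "\<not> X \<subseteq> C" "X \<inter> Q = Y" using facet_Q_extends[OF Y] by blast
    then have "X \<subseteq> Q" using nc by blast
    then show ?thesis using X by (simp add: inf.absorb1)
  qed
  have facet_C: "Y facet_of P" if Y: "Y facet_of C" "Y \<noteq> F" for Y
  proof -
    obtain X where X: "X facet_of P" "\<not> X \<subseteq> Q" "X \<inter> C = Y" using facet_C_extends[OF Y] by blast
    then have "X \<subseteq> C" using nc by blast
    then show ?thesis using X by (simp add: inf.absorb1)
  qed
  have F_not: "\<not> F facet_of P" using facet_not_in_F by blast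
  have facet_P: "(X facet_of Q \<or> X facet_of C) \<and> X \<noteq> F" if X: "X facet_of P" for X
  proof -
    have "X \<noteq> F" using X F_not by blast
    moreover have "X facet_of Q \<or> X facet_of C"
    proof (cases "X \<subseteq> C")
      case False
      then have "X \<subseteq> Q" using nc[OF X] by blast
      then show ?thesis using facet_Int_Q(1)[OF X False] by (simp add: inf.absorb1)
    next
      case True
      then have "\<not> X \<subseteq> Q" using facet_not_in_both[OF X] by blast
      then show ?thesis using facet_Int_C(1)[OF X] True by (simp add: inf.absorb1)
    qed
    ultimately show ?thesis by blast
  qed
  have not_both: "Y = F" if "Y facet_of Q" "Y facet_of C" for Y
    using facet_Q[OF that(1)] facet_not_in_both facet_of_imp_subset that by blast
  obtain \<alpha> where cube: "cube_with \<alpha> (dual_nodes C) (dual_adjacent C) (vertex_stars C)" using cube_C_with by blast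
  define \<tau> where "\<tau> = inv_into (nb (dual_adjacent Q) F) (\<lambda>G. F \<inter> G) \<circ> (\<lambda>G. F \<inter> G)"
  have bQ: "bij_betw (\<lambda>G. F \<inter> G) (nb (dual_adjacent Q) F) (dual_nodes F)"
    using neighbours_facets[OF polytope_Q dQ F_facet] .
  have bC: "bij_betw (\<lambda>G. F \<inter> G) (nb (dual_adjacent C) F) (dual_nodes F)"
    using neighbours_facets[OF polytope_C dC mF_facet] .
  have \<tau>: "bij_betw \<tau> (nb (dual_adjacent C) F) (nb (dual_adjacent Q) F)"
    unfolding \<tau>_def using bij_betw_trans[OF bC bij_betw_inv_into[OF bQ]] .
  have \<tau>F: "F \<inter> \<tau> x = F \<inter> x" if "dual_adjacent C F x" for x
  proof -
    have "F \<inter> x \<in> dual_nodes F" using bC that unfolding bij_betw_def by auto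
    then show ?thesis unfolding \<tau>_def using bij_betw_inv_into_right[OF bQ] by simp
  qed
  have \<tau>Q: "dual_adjacent Q F (\<tau> x)" if "dual_adjacent C F x" for x
  proof -
    have "\<tau> x \<in> nb (dual_adjacent Q) F" using \<tau> that unfolding bij_betw_def by auto
    then show ?thesis by simp
  qed
  have \<tau>_unique: "y = \<tau> x" if x: "dual_adjacent C F x" and y: "dual_adjacent Q F y" "F \<inter> y = F \<inter> x" for x y
  proof -
    have "inj_on (\<lambda>G. F \<inter> G) (nb (dual_adjacent Q) F)" using bQ unfolding bij_betw_def by blast
    then show ?thesis using \<tau>F[OF x] \<tau>Q[OF x] y unfolding inj_on_def by simp
  qed
  have mixed: "dual_adjacent P x y \<longleftrightarrow> dual_adjacent C F y \<and> x = \<tau> y"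
    if x: "x facet_of Q" "x \<noteq> F" and y: "y facet_of C" "y \<noteq> F" for x y
  proof -
    note xP = facet_Q[OF x] and yP = facet_C[OF y]
    have sub: "x \<inter> y \<subseteq> F" using facet_of_imp_subset[OF x(1)] facet_of_imp_subset[OF y(1)] Q_Int_C by blast
    have I: "x \<inter> y face_of P" using face_of_Int facet_of_imp_face_of xP yP by blast
    show ?thesis
    proof
      assume "dual_adjacent P x y"
      then have d: "aff_dim (x \<inter> y) = aff_dim P - 2" using dual_adjacent_dim[OF xP yP] by blast
      have side: "F \<inter> Z = x \<inter> y \<and> dual_adjacent R F Z"
        if R: "F facet_of R" "Z facet_of R" "Z \<noteq> F" "aff_dim R = aff_dim P" "R \<subseteq> P" "x \<inter> y \<subseteq> Z" for R Z
      proof -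
        have FZ: "F \<inter> Z face_of R" using face_of_Int facet_of_imp_face_of R(1,2) by blast
        then have "F \<inter> Z face_of F" using face_of_face[OF facet_of_imp_face_of[OF R(1)]] by blast
        moreover have "F \<inter> Z \<noteq> F" using facet_eq_of_subset[OF R(1,2)] R(3) by blast
        ultimately have "aff_dim (F \<inter> Z) < aff_dim F"
          using face_of_aff_dim_lt face_of_imp_convex[OF facet_of_imp_face_of[OF R(1)]] by blast
        moreover have XZ: "x \<inter> y \<subseteq> F \<inter> Z" using sub R(6) by blast
        ultimately have dz: "aff_dim (F \<inter> Z) = aff_dim (x \<inter> y)" using aff_dim_subset[OF XZ] d dim_F by linarith
        have "F \<inter> Z \<subseteq> P" using F_eq by blast
        then have "x \<inter> y face_of F \<inter> Z" using face_of_subset[OF I XZ] by blast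
        then have "x \<inter> y = F \<inter> Z" using face_of_aff_dim_lt[of "F \<inter> Z" "x \<inter> y"] dz face_of_imp_convex[OF FZ] by force
        then show ?thesis using dual_adjacent_dim[OF R(1,2)] d R(4) by simp
      qed
      have "F \<inter> x = x \<inter> y \<and> dual_adjacent Q F x"
        using side[OF F_facet x dim_Q] Q_Un_C by blast
      moreover have "F \<inter> y = x \<inter> y \<and> dual_adjacent C F y"
        using side[OF mF_facet y dim_C] Q_Un_C by blast
      ultimately show "dual_adjacent C F y \<and> x = \<tau> y" using \<tau>_unique[of y x] by simp
    next
      assume h: "dual_adjacent C F y \<and> x = \<tau> y"
      then have "F \<inter> x = F \<inter> y" using \<tau>F by blast
      then have "x \<inter> y = F \<inter> y" using sub by blast
      moreover have "aff_dim (F \<inter> y) = aff_dim C - 2" using dual_adjacent_dim[OF mF_facet y(1)] h by blast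
      ultimately show "dual_adjacent P x y" using dual_adjacent_dim[OF xP yP] dim_C by simp
    qed
  qed
  have same_Q: "dual_adjacent P x y \<longleftrightarrow> dual_adjacent Q x y"
    if "x facet_of Q" "x \<noteq> F" "y facet_of Q" "y \<noteq> F" for x y
    using dual_adjacent_dim[OF that(1,3)] dual_adjacent_dim[OF facet_Q[OF that(1,2)] facet_Q[OF that(3,4)]] dim_Q by simp
  have same_C: "dual_adjacent P x y \<longleftrightarrow> dual_adjacent C x y"
    if "x facet_of C" "x \<noteq> F" "y facet_of C" "y \<noteq> F" for x y
    using dual_adjacent_dim[OF that(1,3)] dual_adjacent_dim[OF facet_C[OF that(1,2)] facet_C[OF that(3,4)]] dim_C by simp
  have nodesD: "dual_adjacent R x y \<Longrightarrow> x facet_of R \<and> y facet_of R" for R :: "'a set" and x y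
    unfolding dual_adjacent_def dual_nodes_def by blast
  have adjC_F: "x facet_of C \<and> x \<noteq> F" if "dual_adjacent C F x" for x
    using nodesD[OF that] dual_adjacent_neq[OF that] by blast
  have adjQ_F: "x facet_of Q \<and> x \<noteq> F" if "dual_adjacent Q F x" for x
    using nodesD[OF that] dual_adjacent_neq[OF that] by blast
  have adj: "dual_adjacent P x y \<longleftrightarrow>
      (x \<noteq> F \<and> y \<noteq> F \<and> (dual_adjacent Q x y \<or> dual_adjacent C x y)) \<or>
      (dual_adjacent C F x \<and> y = \<tau> x) \<or> (dual_adjacent C F y \<and> x = \<tau> y)" (is "?L \<longleftrightarrow> ?R") for x y
  proof
    assume L: ?L
    then have xy: "x facet_of P" "y facet_of P" using nodesD by blast+
    have ne: "x \<noteq> F" "y \<noteq> F" using facet_P[OF xy(1)] facet_P[OF xy(2)] by blast+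
    have L': "dual_adjacent P y x" using L dual_adjacent_sym[of P x y] by simp
    consider "x facet_of Q" "y facet_of Q" | "x facet_of C" "y facet_of C"
      | "x facet_of Q" "y facet_of C" | "x facet_of C" "y facet_of Q"
      using facet_P[OF xy(1)] facet_P[OF xy(2)] by blast
    then show ?R
    proof cases
      case 1 then show ?thesis using L ne same_Q[OF 1(1) ne(1) 1(2) ne(2)] by simp
    next
      case 2 then show ?thesis using L ne same_C[OF 2(1) ne(1) 2(2) ne(2)] by simp
    next
      case 3 then show ?thesis using L mixed[OF 3(1) ne(1) 3(2) ne(2)] by simp
    next
      case 4 then show ?thesis using L' mixed[OF 4(2) ne(2) 4(1) ne(1)] by simp
    qed
  next
    assume ?R
    then consider "x \<noteq> F" "y \<noteq> F" "dual_adjacent Q x y" | "x \<noteq> F" "y \<noteq> F" "dual_adjacent C x y"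
      | "dual_adjacent C F x" "y = \<tau> x" | "dual_adjacent C F y" "x = \<tau> y" by blast
    then show ?L
    proof cases
      case 1 then show ?thesis using same_Q[of x y] nodesD[OF 1(3)] by simp
    next
      case 2 then show ?thesis using same_C[of x y] nodesD[OF 2(3)] by simp
    next
      case 3
      then have "dual_adjacent P y x" using mixed[of y x] adjC_F[OF 3(1)] adjQ_F[OF \<tau>Q[OF 3(1)]] by simp
      then show ?thesis using dual_adjacent_sym[of P x y] by simp
    next
      case 4
      then show ?thesis using mixed[of x y] adjC_F[OF 4(1)] adjQ_F[OF \<tau>Q[OF 4(1)]] by simp
    qed
  qed
  have F_Q: "F \<in> dual_nodes Q" and F_C: "F \<in> dual_nodes C" using F_facet mF_facet unfolding dual_nodes_def by auto
  have extP: "v extreme_point_of P" if v: "v extreme_point_of Q" for v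
  proof -
    obtain G where G: "G facet_of Q" "G \<noteq> F" "v \<in> G" using vertex_in_two_facets[OF polytope_Q dQ v F_facet] by blast
    have "v extreme_point_of G" using extreme_point_of_face[OF facet_of_imp_face_of[OF G(1)]] v G(3) by blast
    then show ?thesis using extreme_point_of_face[OF facet_of_imp_face_of[OF facet_Q[OF G(1,2)]]] by blast
  qed
  have inP: "v \<in> R" if "v extreme_point_of R" for v and R :: "'a set" using that unfolding extreme_point_of_def by blast
  have star_off_F: "vertex_star P v = vertex_star R v"
    if R: "R = Q \<or> R = C" and v: "v \<in> R" "v \<notin> F" for v R
  proof -
    have other: "\<not> (v \<in> Q \<and> v \<in> C)" using v(2) Q_Int_C by blast
    show ?thesis
      unfolding vertex_star_def using R v other facet_P facet_Q facet_C facet_of_imp_subset by blast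
  qed
  have star_C: "vertex_star C v = insert F {x \<in> nb (dual_adjacent C) F. \<tau> x \<in> vertex_star Q v}"
    if v: "v extreme_point_of C" "v \<in> F" for v
  proof (intro equalityI subsetI)
    have S: "vertex_star C v \<in> vertex_stars C" unfolding vertex_stars_def using v by blast
    have FS: "F \<in> vertex_star C v" unfolding vertex_star_def using mF_facet v by blast
    have flip: "F \<in> vertex_star C v \<longleftrightarrow> \<alpha> F \<notin> vertex_star C v"
      using conjunct2[OF cube_star[OF cube, THEN iffD1, OF S]] F_C by blast
    fix x assume x: "x \<in> vertex_star C v"
    show "x \<in> insert F {x \<in> nb (dual_adjacent C) F. \<tau> x \<in> vertex_star Q v}"
    proof (cases "x = F")
      case False
      have "x facet_of C" "v \<in> x" using x unfolding vertex_star_def by auto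
      moreover have "x \<noteq> \<alpha> F" using flip FS x by blast
      ultimately have a: "dual_adjacent C F x"
        using cube_adj[OF cube, of F x] F_C False unfolding dual_nodes_def by blast
      have "v \<in> \<tau> x" using \<tau>F[OF a] v(2) \<open>v \<in> x\<close> by blast
      then show ?thesis using a adjQ_F[OF \<tau>Q[OF a]] unfolding vertex_star_def by simp
    qed simp
  next
    fix x assume "x \<in> insert F {x \<in> nb (dual_adjacent C) F. \<tau> x \<in> vertex_star Q v}"
    then consider "x = F" | "dual_adjacent C F x" "v \<in> \<tau> x" unfolding vertex_star_def by auto
    then show "x \<in> vertex_star C v"
    proof cases
      case 1 then show ?thesis unfolding vertex_star_def using mF_facet v by blast
    next
      case 2
      then have "v \<in> x" using \<tau>F[OF 2(1)] v(2) by blast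
      then show ?thesis unfolding vertex_star_def using adjC_F[OF 2(1)] by blast
    qed
  qed
  have star_F: "vertex_star P v = (vertex_star Q v - {F}) \<union> {x \<in> nb (dual_adjacent C) F. \<tau> x \<in> vertex_star Q v}"
    if v: "v extreme_point_of F" for v
  proof -
    have vC: "v extreme_point_of C" "v \<in> F" using extreme_F_C[of v] v by auto
    have "vertex_star P v = (vertex_star Q v - {F}) \<union> (vertex_star C v - {F})"
      unfolding vertex_star_def using facet_P facet_Q facet_C by blast
    moreover have "F \<notin> nb (dual_adjacent C) F" using dual_adjacent_neq by fastforce
    ultimately show ?thesis unfolding star_C[OF vC] by blast
  qed
  have stars: "vertex_stars P = {S \<in> vertex_stars Q. F \<notin> S} \<union> {S \<in> vertex_stars C. F \<notin> S} \<union>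
      {(S - {F}) \<union> {x \<in> nb (dual_adjacent C) F. \<tau> x \<in> S} | S. S \<in> vertex_stars Q \<and> F \<in> S}" (is "_ = ?A \<union> ?B \<union> ?D")
  proof (intro equalityI subsetI)
    fix S assume "S \<in> vertex_stars P"
    then obtain v where v: "v extreme_point_of P" "S = vertex_star P v" unfolding vertex_stars_def by blast
    consider "v \<in> F" | "v \<in> Q" "v \<notin> F" | "v \<in> C" "v \<notin> F" using inP[OF v(1)] Q_Un_C by blast
    then show "S \<in> ?A \<union> ?B \<union> ?D"
    proof cases
      case 1
      have vQ: "v extreme_point_of Q" using extreme_P[OF v(1)] 1 F_sub by blast
      have vF: "v extreme_point_of F" using extreme_F[of v] vQ 1 by blast
      have "F \<in> vertex_star Q v" unfolding vertex_star_def using F_facet 1 by blast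
      moreover have "vertex_star Q v \<in> vertex_stars Q" unfolding vertex_stars_def using vQ by blast
      ultimately show ?thesis using star_F[OF vF] v(2) by blast
    next
      case 2
      have "v extreme_point_of Q" using extreme_P[OF v(1) 2(1)] .
      moreover have "S = vertex_star Q v" using star_off_F[of Q v] 2 v(2) by blast
      moreover have "F \<notin> vertex_star Q v" unfolding vertex_star_def using 2 by blast
      ultimately show ?thesis unfolding vertex_stars_def by blast
    next
      case 3
      have "v extreme_point_of C" using extreme_P_C[OF v(1) 3(1)] .
      moreover have "S = vertex_star C v" using star_off_F[of C v] 3 v(2) by blast
      moreover have "F \<notin> vertex_star C v" unfolding vertex_star_def using 3 by blast
      ultimately show ?thesis unfolding vertex_stars_def by blast
    qed
  next
    fix S assume "S \<in> ?A \<union> ?B \<union> ?D"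
    then consider v where "v extreme_point_of Q" "S = vertex_star Q v" "F \<notin> vertex_star Q v"
      | v where "v extreme_point_of C" "S = vertex_star C v" "F \<notin> vertex_star C v"
      | v where "v extreme_point_of Q" "F \<in> vertex_star Q v"
        "S = (vertex_star Q v - {F}) \<union> {x \<in> nb (dual_adjacent C) F. \<tau> x \<in> vertex_star Q v}"
      unfolding vertex_stars_def by blast
    then show "S \<in> vertex_stars P"
    proof cases
      case (1 v)
      have "v \<notin> F" using 1 F_facet unfolding vertex_star_def by blast
      then have "S = vertex_star P v" using star_off_F[of Q v] inP[OF 1(1)] 1(2) by blast
      then show ?thesis unfolding vertex_stars_def using extP[OF 1(1)] by blast
    next
      case (2 v)
      have vF: "v \<notin> F" using 2 mF_facet unfolding vertex_star_def by blast
      then have "S = vertex_star P v" using star_off_F[of C v] inP[OF 2(1)] 2(2) by blast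
      then show ?thesis unfolding vertex_stars_def using extreme_C[OF 2(1) vF] by blast
    next
      case (3 v)
      have "v extreme_point_of F" using extreme_F[of v] 3 unfolding vertex_star_def by blast
      then have "S = vertex_star P v" using star_F 3(3) by blast
      then show ?thesis unfolding vertex_stars_def using extP[OF 3(1)] by blast
    qed
  qed
  show ?thesis unfolding polytope_system_def
  proof (rule capped_system_glue[OF sys[unfolded polytope_system_def] F_Q cube F_C _ _ \<tau> _ adj stars])
    show "6 \<le> card (dual_nodes C)" using card_C dim_P by linarith
    show "dual_nodes Q \<inter> dual_nodes C = {F}" using not_both F_facet mF_facet unfolding dual_nodes_def by blast
    show "dual_nodes P = dual_nodes Q \<union> dual_nodes C - {F}"
      using facet_P facet_Q facet_C unfolding dual_nodes_def by blast
    show "insert F {x \<in> nb (dual_adjacent C) F. \<tau> x \<in> S} \<in> vertex_stars C" if S: "S \<in> vertex_stars Q" "F \<in> S" for S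
    proof -
      obtain v where v: "v extreme_point_of Q" "S = vertex_star Q v" using S(1) unfolding vertex_stars_def by blast
      have "v \<in> F" using S(2) v(2) unfolding vertex_star_def by blast
      then have "v extreme_point_of F" using extreme_F[of v] v(1) by blast
      then have vC: "v extreme_point_of C" "v \<in> F" using extreme_F_C[of v] by auto
      show ?thesis unfolding v(2) star_C[OF vC, symmetric] vertex_stars_def using vC(1) by blast
    qed
  qed
qed

end

section \<open>Capping with crossing facets\<close>

lemma cube_nb_card:
  assumes cube: "cube_with \<alpha> N E V" and f: "f \<in> N" shows "int (card (nb E f)) = int (card N) - 2"
proof -
  have opp: "\<alpha> f \<in> N" "\<alpha> f \<noteq> f" using cube_opp[OF cube f] by auto
  have "nb E f = N - {f, \<alpha> f}" unfolding nb_def cube_adj[OF cube] using f by auto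
  moreover have "card (N - {f, \<alpha> f}) = card N - 2"
    using f opp cube_finite[OF cube] by (subst card_Diff_subset) auto
  moreover have "card {f, \<alpha> f} \<le> card N" using f opp cube_finite[OF cube] by (intro card_mono) auto
  then have "2 \<le> card N" using opp by simp
  ultimately show ?thesis by simp
qed

lemma cube_star_flip:
  assumes cube: "cube_with \<alpha> N E V" and S: "S \<in> V" and f: "f \<in> S"
  shows "insert (\<alpha> f) (S - {f}) \<in> V"
proof -
  have sub: "S \<subseteq> N" and flip: "\<And>x. x \<in> N \<Longrightarrow> x \<in> S \<longleftrightarrow> \<alpha> x \<notin> S"
    using cube_star[OF cube, THEN iffD1, OF S] by auto
  have fN: "f \<in> N" using f sub by blast
  have opp: "\<alpha> x \<in> N" "\<alpha> x \<noteq> x" "\<alpha> (\<alpha> x) = x" if "x \<in> N" for x using cube_opp[OF cube that] by auto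
  have "x \<in> insert (\<alpha> f) (S - {f}) \<longleftrightarrow> \<alpha> x \<notin> insert (\<alpha> f) (S - {f})" if x: "x \<in> N" for x
  proof -
    have "\<alpha> x = \<alpha> f \<longleftrightarrow> x = f" "\<alpha> x = f \<longleftrightarrow> x = \<alpha> f" using opp(3)[OF x] opp(3)[OF fN] by metis+
    then show ?thesis using flip[OF x] flip[OF fN] f opp(2)[OF fN] by auto
  qed
  moreover have "insert (\<alpha> f) (S - {f}) \<subseteq> N" using sub opp(1)[OF fN] by blast
  ultimately show ?thesis unfolding cube_star[OF cube] by blast
qed

text \<open>
  Corresponding stars suffice, since they already give an isomorphism of face lattices.
\<close>

lemma system_transfer:
  fixes P :: "'a::euclidean_space set" and Q :: "'b::euclidean_space set"
  assumes P: "polytope P" and Q: "polytope Q" and d: "1 \<le> aff_dim P" "1 \<le> aff_dim Q"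
    and bij: "bij_betw \<psi> (dual_nodes P) (dual_nodes Q)"
    and stars: "vertex_stars Q = (`) \<psi> ` vertex_stars P" and sys: "polytope_system Q"
  shows "polytope_system P"
proof -
  obtain \<Phi> where \<Phi>: "face_lattice_iso \<Phi> P Q" using face_lattice_iso_of_stars[OF P Q d bij stars] by blast
  note g = face_lattice_iso_inv[OF \<Phi>]
  show ?thesis unfolding polytope_system_def
    by (rule capped_system_image[OF sys[unfolded polytope_system_def] iso_nodes[OF Q P g] iso_adjacent[OF Q P g] _ iso_stars[OF Q P g]])
      (use dual_adjacent_nodes in blast)+
qed

context cap_cut
begin

definition crossing :: "'a set \<Rightarrow> bool" where
  "crossing X \<longleftrightarrow> X facet_of P \<and> \<not> X \<subseteq> Q \<and> \<not> X \<subseteq> C"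

lemma crossingD: "crossing X \<Longrightarrow> X facet_of P" "crossing X \<Longrightarrow> \<not> X \<subseteq> Q" "crossing X \<Longrightarrow> \<not> X \<subseteq> C"
  unfolding crossing_def by auto

lemma crossing_cut: "crossing X \<Longrightarrow> \<exists>q c. cut X (X \<inter> Q) (X \<inter> C) (X \<inter> F) a b q c"
  using cut_facet crossingD by blast

lemma polytope_F: "polytope F" using facet_polytope[OF polytope_Q F_facet] .

lemma dim_crossing: "crossing X \<Longrightarrow> aff_dim X = aff_dim P - 1"
  using crossingD(1) unfolding facet_of_def by blast

lemma cube_of_facet_P: "X facet_of P \<Longrightarrow> combinatorial_cube X"
  and cube_of_facet_Q: "Y facet_of Q \<Longrightarrow> combinatorial_cube Y"
  using cubical_P cubical_Q unfolding cubical_polytope_def by auto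

lemma crossing_parts:
  assumes X: "crossing X"
  shows "(X \<inter> F) facet_of (X \<inter> Q)" "aff_dim (X \<inter> Q) = aff_dim P - 1" "aff_dim (X \<inter> F) = aff_dim P - 2"
    "X \<inter> F \<noteq> {}" "(X \<inter> Q) facet_of Q" "X \<inter> Q \<noteq> F" "(X \<inter> C) facet_of C" "X \<inter> C \<noteq> F"
proof -
  obtain q' c' where "cut X (X \<inter> Q) (X \<inter> C) (X \<inter> F) a b q' c'" using crossing_cut[OF X] by blast
  then interpret S: cut X "X \<inter> Q" "X \<inter> C" "X \<inter> F" a b q' c' .
  show "(X \<inter> F) facet_of (X \<inter> Q)" using S.F_facet .
  show "aff_dim (X \<inter> Q) = aff_dim P - 1" using S.dim_Q dim_crossing[OF X] by simp
  show "aff_dim (X \<inter> F) = aff_dim P - 2" using S.dim_F dim_crossing[OF X] by simp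
  show "X \<inter> F \<noteq> {}" using S.F_nonempty .
qed (use facet_Int_Q facet_Int_C crossingD[OF X] in blast)+

lemma crossing_F:
  assumes X: "crossing X" shows "(X \<inter> F) facet_of F"
proof -
  have "(X \<inter> Q) \<inter> F face_of Q" using face_of_Int facet_of_imp_face_of crossing_parts(5)[OF X] F_facet by blast
  then have "(X \<inter> Q) \<inter> F face_of F" using face_of_face[OF facet_of_imp_face_of[OF F_facet]] by blast
  moreover have "(X \<inter> Q) \<inter> F = X \<inter> F" using F_sub by blast
  ultimately show ?thesis unfolding facet_of_def using crossing_parts(3,4)[OF X] dim_F by simp
qed

lemma crossing_F_inj:
  assumes X: "crossing X" and X': "crossing X'" and eq: "X \<inter> F = X' \<inter> F"
  shows "X = X'"
proof -
  obtain G where G: "\<And>K. K facet_of Q \<Longrightarrow> X \<inter> F \<subseteq> K \<Longrightarrow> K = F \<or> K = G"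
    using ridge_other_facet[OF polytope_Q F_facet crossing_F[OF X]] by metis
  have "X \<inter> F \<subseteq> X \<inter> Q" "X \<inter> F \<subseteq> X' \<inter> Q" using F_sub eq by blast+
  then have "X \<inter> Q = G" "X' \<inter> Q = G" using G crossing_parts(5,6)[OF X] crossing_parts(5,6)[OF X'] by blast+
  then show ?thesis using facet_Int_Q_inj[OF crossingD(1,3)[OF X] crossingD(1)[OF X']] by simp
qed

text \<open>
  Let \<open>m\<close> be the dimension of \<open>X\<close>. The cubes \<open>X\<close>, \<open>X \<inter> Q\<close> and \<open>X \<inter> C\<close> have \<open>2 * m\<close> facets each. Those of
  \<open>X \<inter> Q\<close> other than \<open>X \<inter> F\<close> come from the facets of \<open>X\<close> not inside \<open>C\<close>, and likewise for \<open>X \<inter> C\<close>; hence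
  \<open>2 * m - 2\<close> facets of \<open>X\<close> cross. Their lower parts are neighbours of \<open>X \<inter> F\<close>, which has only \<open>2 * m - 2\<close>
  neighbours in \<open>X \<inter> Q\<close>, so every neighbour arises in this way.
\<close>

lemma crossing_neighbours:
  assumes X: "crossing X" and K: "dual_adjacent (X \<inter> Q) (X \<inter> F) K"
  shows "\<exists>Y. Y facet_of X \<and> \<not> Y \<subseteq> Q \<and> \<not> Y \<subseteq> C \<and> Y \<inter> Q = K"
proof -
  obtain q' c' where "cut X (X \<inter> Q) (X \<inter> C) (X \<inter> F) a b q' c'" using crossing_cut[OF X] by blast
  then interpret S: cut X "X \<inter> Q" "X \<inter> C" "X \<inter> F" a b q' c' .
  have dX: "aff_dim X = aff_dim P - 1" using dim_crossing[OF X] .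
  have d2: "2 \<le> aff_dim X" using dX dim_P by simp
  have nX: "int (card (dual_nodes X)) = 2 * aff_dim X"
    using combinatorial_cube_with(2)[OF cube_of_facet_P[OF crossingD(1)[OF X]] d2] .
  have cubeXQ: "combinatorial_cube (X \<inter> Q)" using cube_of_facet_Q[OF crossing_parts(5)[OF X]] .
  have nXQ: "int (card (dual_nodes (X \<inter> Q))) = 2 * aff_dim X"
    using combinatorial_cube_with(2)[OF cubeXQ] S.dim_Q d2 by simp
  have nXC: "int (card (dual_nodes (X \<inter> C))) = 2 * aff_dim X"
  proof -
    obtain \<alpha> where cube: "cube_with \<alpha> (dual_nodes C) (dual_adjacent C) (vertex_stars C)" using cube_C_with by blast
    have "X \<inter> C \<in> dual_nodes C" using crossing_parts(7)[OF X] unfolding dual_nodes_def by blast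
    then have "int (card (nb (dual_adjacent C) (X \<inter> C))) = 2 * aff_dim P - 2"
      using cube_nb_card[OF cube] card_C by simp
    moreover have "2 \<le> aff_dim C" using dim_C dim_P by simp
    ultimately show ?thesis
      using bij_betw_same_card[OF neighbours_facets[OF polytope_C _ crossing_parts(7)[OF X]]] dX by simp
  qed
  let ?A = "{Y. Y facet_of X \<and> \<not> Y \<subseteq> X \<inter> C}" and ?B = "{Y. Y facet_of X \<and> \<not> Y \<subseteq> X \<inter> Q}"
  have fin: "finite (dual_nodes X)" using finite_dual_nodes[OF S.polytope_P] .
  have finQ: "finite (dual_nodes (X \<inter> Q))" using finite_dual_nodes[OF S.polytope_Q] .
  have finC: "finite (dual_nodes (X \<inter> C))" using finite_dual_nodes[OF cut.polytope_Q[OF S.mirror]] .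
  have "X \<inter> F \<in> dual_nodes (X \<inter> Q)" using S.F_facet unfolding dual_nodes_def by blast
  then have "int (card (dual_nodes (X \<inter> Q) - {X \<inter> F})) = 2 * aff_dim X - 1"
    using nXQ d2 by (subst card_Diff_singleton) auto
  then have cA: "int (card ?A) = 2 * aff_dim X - 1" using bij_betw_same_card[OF S.bij_facets_Q] by simp
  have "X \<inter> F \<in> dual_nodes (X \<inter> C)" using cut.F_facet[OF S.mirror] unfolding dual_nodes_def by blast
  then have "int (card (dual_nodes (X \<inter> C) - {X \<inter> F})) = 2 * aff_dim X - 1"
    using nXC d2 by (subst card_Diff_singleton) auto
  then have cB: "int (card ?B) = 2 * aff_dim X - 1" using bij_betw_same_card[OF cut.bij_facets_Q[OF S.mirror]] by simp
  have AB: "?A \<union> ?B = dual_nodes X" unfolding dual_nodes_def using S.facet_not_in_both by blast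
  have "finite (?A \<union> ?B)" unfolding AB using fin .
  then have fAB: "finite ?A" "finite ?B" by simp_all
  have cAB: "int (card (?A \<inter> ?B)) = 2 * aff_dim X - 2"
    using card_Un_Int[OF fAB] cA cB nX unfolding AB by linarith
  let ?n = "nb (dual_adjacent (X \<inter> Q)) (X \<inter> F)"
  have sub: "(\<lambda>Y. Y \<inter> (X \<inter> Q)) ` (?A \<inter> ?B) \<subseteq> ?n"
  proof
    fix K assume "K \<in> (\<lambda>Y. Y \<inter> (X \<inter> Q)) ` (?A \<inter> ?B)"
    then obtain Y where Y: "Y facet_of X" "\<not> Y \<subseteq> X \<inter> C" "\<not> Y \<subseteq> X \<inter> Q" "K = Y \<inter> (X \<inter> Q)" by blast
    obtain q'' c'' where "cut Y (Y \<inter> (X \<inter> Q)) (Y \<inter> (X \<inter> C)) (Y \<inter> (X \<inter> F)) a b q'' c''"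
      using S.cut_facet[OF Y(1,3,2)] by blast
    then have "aff_dim (Y \<inter> (X \<inter> F)) = aff_dim Y - 1" by (rule cut.dim_F)
    then have dim: "aff_dim (Y \<inter> (X \<inter> F)) = aff_dim (X \<inter> Q) - 2"
      using Y(1) S.dim_Q unfolding facet_of_def by simp
    have Kf: "K facet_of X \<inter> Q" using S.facet_Int_Q(1)[OF Y(1,2)] Y(4) by simp
    have "(X \<inter> F) \<inter> K = Y \<inter> (X \<inter> F)" using Y(4) F_sub by blast
    then have "dual_adjacent (X \<inter> Q) (X \<inter> F) K" using dual_adjacent_dim[OF S.F_facet Kf] dim by simp
    then show "K \<in> ?n" by simp
  qed
  have "inj_on (\<lambda>Y. Y \<inter> (X \<inter> Q)) (?A \<inter> ?B)"
    by (rule inj_on_subset[OF bij_betw_imp_inj_on[OF S.bij_facets_Q]]) blast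
  then have "card ((\<lambda>Y. Y \<inter> (X \<inter> Q)) ` (?A \<inter> ?B)) = card (?A \<inter> ?B)" by (rule card_image)
  moreover have "int (card ?n) = 2 * aff_dim X - 2"
  proof -
    have "2 \<le> aff_dim (X \<inter> Q)" using S.dim_Q d2 by simp
    then obtain \<beta> where "cube_with \<beta> (dual_nodes (X \<inter> Q)) (dual_adjacent (X \<inter> Q)) (vertex_stars (X \<inter> Q))"
      using combinatorial_cube_with(1)[OF cubeXQ] by blast
    then show ?thesis using cube_nb_card \<open>X \<inter> F \<in> dual_nodes (X \<inter> Q)\<close> nXQ by metis
  qed
  moreover have "finite ?n" using finite_nb[OF dual_graph_on[OF S.polytope_Q]] .
  ultimately have "(\<lambda>Y. Y \<inter> (X \<inter> Q)) ` (?A \<inter> ?B) = ?n" using card_subset_eq[OF _ sub] cAB by simp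
  then have "K \<in> (\<lambda>Y. Y \<inter> (X \<inter> Q)) ` (?A \<inter> ?B)" using K by simp
  then obtain Y where Y: "Y facet_of X" "\<not> Y \<subseteq> X \<inter> C" "\<not> Y \<subseteq> X \<inter> Q" "K = Y \<inter> (X \<inter> Q)" by blast
  moreover have "Y \<subseteq> X" using facet_of_imp_subset[OF Y(1)] .
  ultimately show ?thesis by blast
qed

text \<open>
  The ridge \<open>X \<inter> F \<inter> R'\<close> of \<open>F\<close> lies on a neighbour of \<open>X \<inter> F\<close> in \<open>X \<inter> Q\<close>, which is the lower part of a
  crossing facet of \<open>X\<close>. The other facet \<open>X'\<close> of \<open>P\<close> through the latter crosses too, and \<open>X' \<inter> F\<close> is the
  second facet of \<open>F\<close> through that ridge, namely \<open>R'\<close>.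
\<close>

lemma crossing_step:
  assumes X: "crossing X" and R': "dual_adjacent F (X \<inter> F) R'"
  obtains X' where "crossing X'" "R' = X' \<inter> F" "(X \<inter> X') facet_of X" "\<not> X \<inter> X' \<subseteq> C"
proof -
  let ?R = "X \<inter> F" and ?K = "X \<inter> Q"
  have dF: "2 \<le> aff_dim F" and dK: "2 \<le> aff_dim ?K" using dim_F dim_P crossing_parts(2)[OF X] by auto
  have R: "?R facet_of F" and RK: "?R facet_of ?K" using crossing_F[OF X] crossing_parts(1)[OF X] by auto
  have R'F: "R' facet_of F" using R' unfolding dual_adjacent_def dual_nodes_def by blast
  have ne: "R' \<noteq> ?R" using dual_adjacent_neq[OF R'] by blast
  have Z: "(?R \<inter> R') facet_of ?R" using dual_adjacent_facet[OF dF R R'F] R' by blast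
  have pK: "polytope ?K" using facet_polytope[OF polytope_Q crossing_parts(5)[OF X]] .
  obtain K where K: "K facet_of ?K" "?R \<inter> R' = ?R \<inter> K" using ridge_other_facet[OF pK RK Z] by metis
  have "dual_adjacent ?K ?R K" using dual_adjacent_facet[OF dK RK K(1)] Z K(2) by simp
  then obtain Y where Y: "Y facet_of X" "\<not> Y \<subseteq> Q" "\<not> Y \<subseteq> C" "Y \<inter> Q = K" using crossing_neighbours[OF X] by blast
  obtain X' where X': "X' facet_of P" "X' \<noteq> X" "Y = X \<inter> X'"
    using ridge_other_facet[OF polytope_P crossingD(1)[OF X] Y(1)] by metis
  have cX': "crossing X'" unfolding crossing_def using X' Y by blast
  have "?R \<inter> R' \<subseteq> X' \<inter> F" using K(2) Y(4) X'(3) by blast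
  moreover obtain G where "\<And>H. H facet_of F \<Longrightarrow> ?R \<inter> R' \<subseteq> H \<Longrightarrow> H = ?R \<or> H = G"
    using ridge_other_facet[OF polytope_F R Z] by metis
  ultimately have "X' \<inter> F = ?R \<or> X' \<inter> F = R'" using crossing_F[OF cX'] R'F ne by (metis inf_le2)
  moreover have "X' \<inter> F \<noteq> ?R" using crossing_F_inj[OF cX' X] X'(2) by blast
  ultimately show thesis using that[OF cX'] X'(3) Y by blast
qed

lemma cube_F_with: "\<exists>\<alpha>. cube_with \<alpha> (dual_nodes F) (dual_adjacent F) (vertex_stars F)"
  and card_F: "4 \<le> card (dual_nodes F)"
proof -
  have d: "2 \<le> aff_dim F" using dim_F dim_P by simp
  note cube = combinatorial_cube_with[OF cube_of_facet_Q[OF F_facet] d]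
  show "\<exists>\<alpha>. cube_with \<alpha> (dual_nodes F) (dual_adjacent F) (vertex_stars F)" using cube(1) .
  show "4 \<le> card (dual_nodes F)" using cube(2) d by linarith
qed

text \<open>
  In a cube of dimension at least 2 any two facets are joined by at most two steps between neighbours.
\<close>

lemma facets_F_cross:
  assumes X0: "crossing X0" and R: "R facet_of F"
  shows "\<exists>X. crossing X \<and> R = X \<inter> F"
proof -
  obtain \<alpha> where cube: "cube_with \<alpha> (dual_nodes F) (dual_adjacent F) (vertex_stars F)" using cube_F_with by blast
  let ?R0 = "X0 \<inter> F"
  have N: "R \<in> dual_nodes F" "?R0 \<in> dual_nodes F" using R crossing_F[OF X0] unfolding dual_nodes_def by auto
  have step: "\<exists>X. crossing X \<and> R2 = X \<inter> F" if "crossing X1" "dual_adjacent F (X1 \<inter> F) R2" for X1 R2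
    using crossing_step[OF that] by metis
  show ?thesis
  proof (cases "R = ?R0 \<or> dual_adjacent F ?R0 R")
    case True then show ?thesis using X0 step by blast
  next
    case False
    then have opp: "R = \<alpha> ?R0" using cube_adj[OF cube] N by blast
    obtain R2 where R2: "R2 \<in> dual_nodes F" "R2 \<noteq> ?R0" "R2 \<noteq> \<alpha> ?R0"
      using pick_fourth[OF card_F, of ?R0 "\<alpha> ?R0" ?R0] by blast
    have "dual_adjacent F ?R0 R2" using cube_adj[OF cube, of ?R0 R2] N R2 by blast
    then obtain X2 where X2: "crossing X2" "R2 = X2 \<inter> F" using step[OF X0] by blast
    have "R \<noteq> \<alpha> R2" using cube_opp[OF cube R2(1)] cube_opp[OF cube N(2)] opp R2(2) by metis
    then have "dual_adjacent F R2 R" using cube_adj[OF cube, of R2 R] N R2 opp by blast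
    then show ?thesis using step[OF X2(1)] X2(2) by blast
  qed
qed

text \<open>
  In each of \<open>Q\<close> and \<open>C\<close> there is a vertex off \<open>F\<close> that lies on all crossing facets through \<open>w\<close>. The segment
  between them meets \<open>F\<close> in a point on all facets of \<open>F\<close> through \<open>w\<close>, hence in \<open>w\<close>.
\<close>

lemma F_vertex_between:
  assumes X0: "crossing X0" and w: "w extreme_point_of F"
  obtains q' c' where "q' \<in> P" "a \<bullet> q' < b" "c' \<in> P" "b < a \<bullet> c'" "w \<in> open_segment q' c'"
proof -
  have wF: "w \<in> F" and wQ: "w extreme_point_of Q" and wC: "w extreme_point_of C"
    using w extreme_F extreme_F_C by blast+
  have dF: "2 \<le> aff_dim F" using dim_F dim_P by simp
  have fw: "{w} face_of F" using w face_of_singleton by blast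
  have "{w} \<noteq> F" using dF by (metis aff_dim_sing not_numeral_le_zero)
  then have only_w: "{w} = \<Inter>{R. R facet_of F \<and> {w} \<subseteq> R}"
    using face_of_polyhedron[OF polytope_imp_polyhedron[OF polytope_F] fw insert_not_empty] by blast
  \<comment> \<open>The neighbour of \<open>w\<close> in the cube \<open>C\<close> across the facet \<open>F\<close>.\<close>
  obtain c' where c': "c' \<in> C" "c' \<notin> F" "\<And>X. crossing X \<Longrightarrow> w \<in> X \<Longrightarrow> c' \<in> X"
  proof -
    obtain \<alpha> where cube: "cube_with \<alpha> (dual_nodes C) (dual_adjacent C) (vertex_stars C)" using cube_C_with by blast
    have F_C: "F \<in> dual_nodes C" using mF_facet unfolding dual_nodes_def by blast
    have S: "vertex_star C w \<in> vertex_stars C" unfolding vertex_stars_def using wC by blast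
    have FS: "F \<in> vertex_star C w" unfolding vertex_star_def using mF_facet wF by blast
    from cube_star_flip[OF cube S FS] obtain x where
      x: "x extreme_point_of C" "vertex_star C x = insert (\<alpha> F) (vertex_star C w - {F})"
      unfolding vertex_stars_def by auto
    have "F \<notin> vertex_star C x" unfolding x(2) using cube_opp[OF cube F_C] by auto
    then have "x \<notin> F" unfolding vertex_star_def using mF_facet by blast
    moreover have "x \<in> C" using x(1) unfolding extreme_point_of_def by blast
    moreover have "x \<in> X" if X: "crossing X" "w \<in> X" for X
    proof -
      have "w \<in> X \<inter> C" using X(2) wF F_sub by blast
      then have "X \<inter> C \<in> vertex_star C x"
        unfolding x(2) using crossing_parts(7,8)[OF X(1)] unfolding vertex_star_def by blast
      then show ?thesis unfolding vertex_star_def by blast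
    qed
    ultimately show thesis using that by blast
  qed
  \<comment> \<open>Its counterpart in \<open>Q\<close> is the neighbour of \<open>w\<close> off \<open>F\<close> in the cube \<open>X1 \<inter> Q\<close>, for one crossing facet
    \<open>X1\<close> through \<open>w\<close>. The other crossing facets through \<open>w\<close> meet this cube in facets other than \<open>R1\<close>, so
    they contain the neighbour as well.\<close>
  obtain q' where q': "q' \<in> Q" "q' \<notin> F" "\<And>X. crossing X \<Longrightarrow> w \<in> X \<Longrightarrow> q' \<in> X"
  proof -
    obtain R1 where R1: "R1 facet_of F" "w \<in> R1"
      using face_of_polyhedron_subset_facet[OF polytope_imp_polyhedron[OF polytope_F] fw insert_not_empty \<open>{w} \<noteq> F\<close>]
      by blast
    obtain X1 where X1: "crossing X1" "R1 = X1 \<inter> F" using facets_F_cross[OF X0 R1(1)] by blast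
    let ?K = "X1 \<inter> Q"
    obtain q1 c1 where "cut X1 ?K (X1 \<inter> C) (X1 \<inter> F) a b q1 c1" using crossing_cut[OF X1(1)] by blast
    then interpret S: cut X1 ?K "X1 \<inter> C" "X1 \<inter> F" a b q1 c1 .
    have dK: "2 \<le> aff_dim ?K" using crossing_parts(2)[OF X1(1)] dim_P by simp
    obtain \<beta> where cube: "cube_with \<beta> (dual_nodes ?K) (dual_adjacent ?K) (vertex_stars ?K)"
      using combinatorial_cube_with(1)[OF cube_of_facet_Q[OF crossing_parts(5)[OF X1(1)]] dK] by blast
    have wK: "w \<in> ?K" using R1(2) X1(2) F_sub by blast
    have "w extreme_point_of ?K"
      using extreme_point_of_face[OF facet_of_imp_face_of[OF crossing_parts(5)[OF X1(1)]]] wQ wK by blast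
    then have St: "vertex_star ?K w \<in> vertex_stars ?K" unfolding vertex_stars_def by blast
    have RK: "R1 facet_of ?K" using crossing_parts(1)[OF X1(1)] X1(2) by simp
    then have RS: "R1 \<in> vertex_star ?K w" unfolding vertex_star_def using R1(2) by blast
    from cube_star_flip[OF cube St RS] obtain x where
      x: "x extreme_point_of ?K" "vertex_star ?K x = insert (\<beta> R1) (vertex_star ?K w - {R1})"
      unfolding vertex_stars_def by auto
    have "R1 \<in> dual_nodes ?K" using RK unfolding dual_nodes_def by blast
    then have "R1 \<notin> vertex_star ?K x" unfolding x(2) using cube_opp[OF cube] by force
    then have "x \<notin> R1" unfolding vertex_star_def using RK by blast
    moreover have xK: "x \<in> ?K" using x(1) unfolding extreme_point_of_def by blast
    ultimately have xF: "x \<in> Q" "x \<notin> F" using X1(2) by auto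
    have "x \<in> X" if X: "crossing X" "w \<in> X" for X
    proof (cases "X = X1")
      case True then show ?thesis using xK by blast
    next
      case False
      obtain \<alpha> where cubeF: "cube_with \<alpha> (dual_nodes F) (dual_adjacent F) (vertex_stars F)" using cube_F_with by blast
      have XF: "X \<inter> F facet_of F" using crossing_F[OF X(1)] .
      have neR: "X \<inter> F \<noteq> R1" using crossing_F_inj[OF X(1) X1(1)] False X1(2) by blast
      have SF: "vertex_star F w \<in> vertex_stars F" unfolding vertex_stars_def using w by blast
      have in_star: "R1 \<in> vertex_star F w" "X \<inter> F \<in> vertex_star F w"
        unfolding vertex_star_def using R1 XF X(2) wF by auto
      have "\<alpha> R1 \<notin> vertex_star F w"
        using cube_star[OF cubeF, THEN iffD1, OF SF] in_star(1) by blast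
      then have "X \<inter> F \<noteq> \<alpha> R1" using in_star(2) by metis
      moreover have "R1 \<in> dual_nodes F" "X \<inter> F \<in> dual_nodes F" using R1(1) XF unfolding dual_nodes_def by simp_all
      ultimately have "dual_adjacent F R1 (X \<inter> F)" using cube_adj[OF cubeF, of R1 "X \<inter> F"] neR by simp
      then obtain X' where X': "crossing X'" "X \<inter> F = X' \<inter> F" "(X1 \<inter> X') facet_of X1" "\<not> X1 \<inter> X' \<subseteq> C"
        using crossing_step[OF X1(1), of "X \<inter> F"] X1(2) by metis
      have "X' = X" using crossing_F_inj[OF X'(1) X(1)] X'(2) by simp
      then have Y: "(X1 \<inter> X) facet_of X1" "\<not> X1 \<inter> X \<subseteq> X1 \<inter> C" using X'(3,4) by auto
      have "(X1 \<inter> X) \<inter> ?K facet_of ?K" "(X1 \<inter> X) \<inter> ?K \<noteq> R1"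
        using S.facet_Int_Q[OF Y] X1(2) by auto
      moreover have "w \<in> (X1 \<inter> X) \<inter> ?K" using wK X(2) by blast
      ultimately have "(X1 \<inter> X) \<inter> ?K \<in> vertex_star ?K w - {R1}" unfolding vertex_star_def by simp
      then have "(X1 \<inter> X) \<inter> ?K \<in> vertex_star ?K x" unfolding x(2) by blast
      then show ?thesis unfolding vertex_star_def by blast
    qed
    then show thesis using that xF by blast
  qed
  have qP: "q' \<in> P" "a \<bullet> q' < b" using q' unfolding Q_eq F_eq by (auto simp: less_le)
  have cP: "c' \<in> P" "b < a \<bullet> c'" using c' unfolding C_eq F_eq by (auto simp: less_le)
  define t where "t = (b - a \<bullet> q') / (a \<bullet> c' - a \<bullet> q')"
  have t: "0 < t" "t < 1" unfolding t_def using qP cP by (auto simp: field_simps)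
  define z where "z = (1 - t) *\<^sub>R q' + t *\<^sub>R c'"
  have "t * (a \<bullet> c' - a \<bullet> q') = b - a \<bullet> q'" unfolding t_def using qP cP by simp
  then have "a \<bullet> z = b" unfolding z_def by (simp add: inner_simps algebra_simps)
  moreover have conv: "z \<in> X" if "convex X" "q' \<in> X" "c' \<in> X" for X
    unfolding z_def using convexD[OF that, of "1 - t" t] t by simp
  ultimately have zF: "z \<in> F" unfolding F_eq using conv[OF convex_P qP(1) cP(1)] by blast
  have "z \<in> R" if R: "R facet_of F" "{w} \<subseteq> R" for R
  proof -
    obtain X where X: "crossing X" "R = X \<inter> F" using facets_F_cross[OF X0 R(1)] by blast
    then have "w \<in> X" using R(2) by blast
    then have "z \<in> X"
      using conv[OF face_of_imp_convex[OF facet_of_imp_face_of[OF crossingD(1)[OF X(1)]]] q'(3)[OF X(1)] c'(3)[OF X(1)]] by blast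
    then show ?thesis using X(2) zF by blast
  qed
  then have "z \<in> \<Inter>{R. R facet_of F \<and> {w} \<subseteq> R}" by blast
  then have "z = w" using only_w by (metis singletonD)
  moreover have "q' \<noteq> c'" using qP cP by auto
  then have "z \<in> open_segment q' c'" unfolding in_segment z_def using t by blast
  ultimately show thesis using that qP cP by blast
qed

lemma F_vertex_lost:
  assumes X0: "crossing X0" and w: "w extreme_point_of F"
  shows "\<not> w extreme_point_of P" and "X facet_of P \<Longrightarrow> w \<in> X \<Longrightarrow> crossing X"
proof -
  obtain q' c' where h: "q' \<in> P" "a \<bullet> q' < b" "c' \<in> P" "b < a \<bullet> c'" "w \<in> open_segment q' c'"
    using F_vertex_between[OF X0 w] by blast
  show "\<not> w extreme_point_of P" using h unfolding extreme_point_of_def by blast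
  assume X: "X facet_of P" "w \<in> X"
  then have "q' \<in> X" "c' \<in> X" using face_ofD[OF facet_of_imp_face_of[OF X(1)] h(5,1,3) X(2)] by auto
  moreover have "q' \<notin> C" "c' \<notin> Q" unfolding Q_eq C_eq using h(2,4) by auto
  ultimately show "crossing X" unfolding crossing_def using X(1) by blast
qed

text \<open>
  The only facet of \<open>P\<close> inside \<open>C\<close> is the facet \<open>F'\<close> of \<open>C\<close> opposite to \<open>F\<close>. So mapping \<open>F'\<close> to \<open>F\<close> and
  intersecting all other facets with \<open>Q\<close> is a bijection onto the facets of \<open>Q\<close>. A vertex of \<open>F'\<close> and the
  vertex of \<open>F\<close> next to it in the cube lie on the same crossing facets, and the facets of \<open>Q\<close> through the
  vertex of \<open>F\<close> are just \<open>F\<close> and the lower parts of these crossing facets. So stars correspond.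
\<close>

lemma system_crossing:
  assumes X0: "crossing X0" and sys: "polytope_system Q"
  shows "polytope_system P"
proof -
  obtain \<alpha> where cube: "cube_with \<alpha> (dual_nodes C) (dual_adjacent C) (vertex_stars C)" using cube_C_with by blast
  define F' where "F' = \<alpha> F"
  have F_C: "F \<in> dual_nodes C" using mF_facet unfolding dual_nodes_def by blast
  have F': "F' \<in> dual_nodes C" "F' \<noteq> F" "\<alpha> F' = F" using cube_opp[OF cube F_C] unfolding F'_def by auto
  have F'C: "F' facet_of C" using F'(1) unfolding dual_nodes_def by blast
  have dC: "2 \<le> aff_dim C" using dim_C dim_P by simp
  have crossC: "dual_adjacent C F (X \<inter> C)" if X: "crossing X" for X
  proof -
    have "F \<inter> (X \<inter> C) = X \<inter> F" using F_sub by blast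
    then show ?thesis
      using dual_adjacent_dim[OF mF_facet crossing_parts(7)[OF X]] crossing_parts(3)[OF X] dim_C by simp
  qed
  have sides: "\<exists>X. crossing X \<and> x = X \<inter> C" if x: "x facet_of C" "x \<noteq> F" "x \<noteq> F'" for x
  proof -
    have a: "dual_adjacent C F x"
      using cube_adj[OF cube, of F x] F_C x unfolding dual_nodes_def F'_def by blast
    then have R: "(F \<inter> x) facet_of F" using dual_adjacent_facet[OF dC mF_facet x(1)] by blast
    obtain X where X: "crossing X" "F \<inter> x = X \<inter> F" using facets_F_cross[OF X0 R] by blast
    obtain G where G: "\<And>K. K facet_of C \<Longrightarrow> F \<inter> x \<subseteq> K \<Longrightarrow> K = F \<or> K = G"
      using ridge_other_facet[OF polytope_C mF_facet R] by metis
    have "x = G" using G[OF x(1)] x(2) by blast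
    moreover have "F \<inter> x \<subseteq> X \<inter> C" using X(2) F_sub by blast
    then have "X \<inter> C = G" using G[OF crossing_parts(7)[OF X(1)]] crossing_parts(8)[OF X(1)] by blast
    ultimately show ?thesis using X(1) by blast
  qed
  have F'P: "F' facet_of P"
  proof -
    obtain X where X: "X facet_of P" "\<not> X \<subseteq> Q" "X \<inter> C = F'" using facet_C_extends[OF F'C F'(2)] by blast
    have "X \<subseteq> C"
    proof (rule ccontr)
      assume "\<not> X \<subseteq> C"
      then have "crossing X" unfolding crossing_def using X by blast
      then have "dual_adjacent C F F'" using crossC X(3) by metis
      then show False using cube_adj[OF cube, of F F'] unfolding F'_def by blast
    qed
    then show ?thesis using X(1,3) by (simp add: inf.absorb1)
  qed
  have F'sub: "F' \<subseteq> C" using facet_of_imp_subset[OF F'C] .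
  have onlyF': "X = F'" if X: "X facet_of P" "X \<subseteq> C" for X
  proof (rule ccontr)
    assume ne: "X \<noteq> F'"
    have XC: "X \<inter> C = X" using X(2) by blast
    have nQ: "\<not> X \<subseteq> Q" using facet_not_in_both[OF X(1)] X(2) by blast
    have "X facet_of C" "X \<noteq> F" using facet_Int_C[OF X(1) nQ] XC by auto
    then obtain X' where X': "crossing X'" "X = X' \<inter> C" using sides ne by blast
    then have "X = X'" using facet_Int_C_inj[OF X(1) nQ crossingD(1)[OF X'(1)]] XC by simp
    then show False using X' X(2) crossingD(3) by blast
  qed
  define \<psi> where "\<psi> X = (if X = F' then F else X \<inter> Q)" for X
  let ?N = "{X. X facet_of P \<and> \<not> X \<subseteq> C}"
  have nodesP: "dual_nodes P = insert F' ?N" unfolding dual_nodes_def using onlyF' F'P by blast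
  have F'N: "F' \<notin> ?N" using F'sub by blast
  have F_Q: "F \<in> dual_nodes Q" using F_facet unfolding dual_nodes_def by blast
  have bij: "bij_betw \<psi> (dual_nodes P) (dual_nodes Q)"
  proof -
    have eq: "\<psi> X = X \<inter> Q" if "X \<in> ?N" for X using that F'N unfolding \<psi>_def by metis
    have "bij_betw \<psi> ?N (dual_nodes Q - {F})"
      using bij_facets_Q bij_betw_cong[of ?N \<psi> "\<lambda>X. X \<inter> Q", OF eq] by blast
    then have "bij_betw \<psi> (?N \<union> {F'}) (dual_nodes Q - {F} \<union> {\<psi> F'})"
      using F'N by (subst notIn_Un_bij_betw3[symmetric]) (auto simp: \<psi>_def)
    moreover have "dual_nodes Q - {F} \<union> {\<psi> F'} = dual_nodes Q" using F_Q unfolding \<psi>_def by auto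
    moreover have "?N \<union> {F'} = dual_nodes P" unfolding nodesP by blast
    ultimately show ?thesis by simp
  qed
  have inR: "v \<in> R" if "v extreme_point_of R" for v and R :: "'a set" using that unfolding extreme_point_of_def by blast
  have \<psi>F': "\<psi> F' = F" and \<psi>n: "\<And>X. X \<noteq> F' \<Longrightarrow> \<psi> X = X \<inter> Q" unfolding \<psi>_def by auto
  have star_off: "vertex_star Q v = \<psi> ` vertex_star P v" if v: "v \<in> Q" "v \<notin> F" for v
  proof -
    have vC: "v \<notin> C" using v Q_Int_C by blast
    have ne: "X \<noteq> F'" "\<not> X \<subseteq> C" if "v \<in> X" for X using that vC F'sub by blast+
    show ?thesis
    proof (intro equalityI subsetI)
      fix Y assume "Y \<in> vertex_star Q v"
      then have Y: "Y facet_of Q" "v \<in> Y" unfolding vertex_star_def by auto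
      then obtain X where X: "X facet_of P" "X \<inter> Q = Y" using facet_Q_extends[OF Y(1)] v(2) by metis
      then have "v \<in> X" using Y(2) by blast
      then show "Y \<in> \<psi> ` vertex_star P v"
        using X \<psi>n[OF ne(1)] unfolding vertex_star_def by (intro image_eqI[of _ _ X]) auto
    next
      fix Y assume "Y \<in> \<psi> ` vertex_star P v"
      then obtain X where X: "X facet_of P" "v \<in> X" "Y = \<psi> X" unfolding vertex_star_def by blast
      then show "Y \<in> vertex_star Q v"
        using \<psi>n[OF ne(1)[OF X(2)]] facet_Int_Q(1)[OF X(1) ne(2)[OF X(2)]] v(1) unfolding vertex_star_def by auto
    qed
  qed
  have star_on: "vertex_star Q w = \<psi> ` vertex_star P v"
    if v: "v \<in> C" "v \<notin> F" and w: "w extreme_point_of F"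
      and S: "vertex_star C w = insert F (vertex_star C v - {F'})" and F'S: "F' \<in> vertex_star C v" for v w
  proof -
    have wF: "w \<in> F" using inR[OF w] .
    have vQ: "v \<notin> Q" using v Q_Int_C by blast
    have same: "w \<in> X \<longleftrightarrow> v \<in> X" if X: "crossing X" for X
    proof -
      have "w \<in> X \<longleftrightarrow> X \<inter> C \<in> vertex_star C w"
        unfolding vertex_star_def using crossing_parts(7)[OF X] wF F_sub by blast
      also have "\<dots> \<longleftrightarrow> X \<inter> C \<in> vertex_star C v"
      proof -
        have "X \<inter> C \<noteq> F'" using crossC[OF X] cube_adj[OF cube, of F "X \<inter> C"] unfolding F'_def by blast
        then show ?thesis unfolding S using crossing_parts(8)[OF X] by blast
      qed
      also have "\<dots> \<longleftrightarrow> v \<in> X" unfolding vertex_star_def using crossing_parts(7)[OF X] v(1) by blast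
      finally show ?thesis .
    qed
    have crF': "X \<noteq> F'" if "crossing X" for X using crossingD(3)[OF that] F'sub by blast
    show ?thesis
    proof (intro equalityI subsetI)
      fix Y assume "Y \<in> vertex_star Q w"
      then have Y: "Y facet_of Q" "w \<in> Y" unfolding vertex_star_def by auto
      show "Y \<in> \<psi> ` vertex_star P v"
      proof (cases "Y = F")
        case True
        have "F' \<in> vertex_star P v" using F'S F'P unfolding vertex_star_def by blast
        then show ?thesis using True \<psi>F' by blast
      next
        case False
        obtain X where X: "X facet_of P" "X \<inter> Q = Y" using facet_Q_extends[OF Y(1) False] by metis
        then have cX: "crossing X" using F_vertex_lost(2)[OF X0 w] Y(2) by blast
        then have "v \<in> X" using same X(2) Y(2) by blast
        then show ?thesis
          using X \<psi>n[OF crF'[OF cX]] unfolding vertex_star_def by (intro image_eqI[of _ _ X]) auto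
      qed
    next
      fix Y assume "Y \<in> \<psi> ` vertex_star P v"
      then obtain X where X: "X facet_of P" "v \<in> X" "Y = \<psi> X" unfolding vertex_star_def by blast
      show "Y \<in> vertex_star Q w"
      proof (cases "X = F'")
        case True then show ?thesis using X(3) \<psi>F' F_facet wF unfolding vertex_star_def by simp
      next
        case False
        then have "\<not> X \<subseteq> C" using onlyF'[OF X(1)] by blast
        then have cX: "crossing X" unfolding crossing_def using X vQ by blast
        then have "w \<in> X" using same X(2) by blast
        then show ?thesis
          using \<psi>n[OF False] X(3) crossing_parts(5)[OF cX] wF F_sub(1) unfolding vertex_star_def by auto
      qed
    qed
  qed
  have stars: "vertex_stars Q = (`) \<psi> ` vertex_stars P"
  proof (intro equalityI subsetI)
    fix S assume "S \<in> vertex_stars Q"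
    then obtain w where w: "w extreme_point_of Q" "S = vertex_star Q w" unfolding vertex_stars_def by blast
    have "\<exists>v. v extreme_point_of P \<and> S = \<psi> ` vertex_star P v"
    proof (cases "w \<in> F")
      case False
      then show ?thesis using extreme_Q[OF w(1) False] star_off[OF inR[OF w(1)] False] w(2) by blast
    next
      case True
      then have wF: "w extreme_point_of F" using extreme_F w(1) by blast
      then have wC: "w extreme_point_of C" using extreme_F_C by blast
      have Sw: "vertex_star C w \<in> vertex_stars C" unfolding vertex_stars_def using wC by blast
      have Fw: "F \<in> vertex_star C w" unfolding vertex_star_def using mF_facet True by blast
      have nF': "F' \<notin> vertex_star C w" using cube_star[OF cube, THEN iffD1, OF Sw] Fw F_C unfolding F'_def by blast
      from cube_star_flip[OF cube Sw Fw] obtain v where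
        v: "v extreme_point_of C" "vertex_star C v = insert F' (vertex_star C w - {F})"
        unfolding vertex_stars_def F'_def by auto
      have "F \<notin> vertex_star C v" unfolding v(2) using F'(2) by blast
      then have vF: "v \<notin> F" unfolding vertex_star_def using mF_facet by blast
      have "vertex_star C w = insert F (vertex_star C v - {F'})" unfolding v(2) using Fw nF' by blast
      then show ?thesis
        using star_on[OF inR[OF v(1)] vF wF] v extreme_C[OF v(1) vF] w(2) by blast
    qed
    then show "S \<in> (`) \<psi> ` vertex_stars P" unfolding vertex_stars_def by blast
  next
    fix S assume "S \<in> (`) \<psi> ` vertex_stars P"
    then obtain v where v: "v extreme_point_of P" "S = \<psi> ` vertex_star P v" unfolding vertex_stars_def by blast
    have vF: "v \<notin> F"
    proof
      assume "v \<in> F"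
      then have "v extreme_point_of F" using extreme_F extreme_P[OF v(1)] F_sub by blast
      then show False using F_vertex_lost(1)[OF X0] v(1) by blast
    qed
    have "\<exists>w. w extreme_point_of Q \<and> S = vertex_star Q w"
    proof (cases "v \<in> Q")
      case True
      then show ?thesis using star_off[OF True vF] extreme_P[OF v(1) True] v(2) by blast
    next
      case False
      then have vC: "v \<in> C" using inR[OF v(1)] Q_Un_C by blast
      then have Cv: "v extreme_point_of C" using extreme_P_C[OF v(1)] by blast
      have Sv: "vertex_star C v \<in> vertex_stars C" unfolding vertex_stars_def using Cv by blast
      have "F \<notin> vertex_star C v" using vF unfolding vertex_star_def by blast
      then have F'v: "F' \<in> vertex_star C v"
        using cube_star[OF cube, THEN iffD1, OF Sv] F_C unfolding F'_def by blast
      from cube_star_flip[OF cube Sv F'v] obtain w where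
        w: "w extreme_point_of C" "vertex_star C w = insert F (vertex_star C v - {F'})"
        unfolding vertex_stars_def F'(3) by auto
      have "F \<in> vertex_star C w" unfolding w(2) by blast
      then have "w \<in> F" unfolding vertex_star_def by blast
      then have wF: "w extreme_point_of F" using extreme_F_C w(1) by blast
      then show ?thesis using star_on[OF vC vF wF w(2) F'v] v(2) extreme_F by blast
    qed
    then show "S \<in> vertex_stars Q" unfolding vertex_stars_def by blast
  qed
  show ?thesis
    using system_transfer[OF polytope_P polytope_Q _ _ bij stars sys] dim_P dim_Q by simp
qed

lemma system_cap:
  assumes sys: "polytope_system Q" shows "polytope_system P"
  using system_crossing[OF _ sys] system_not_crossing[OF _ sys] unfolding crossing_def by blast

end

section \<open>Low dimensions and the reconstruction theorem\<close>

lemma combinatorial_cube_dim: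
  fixes C :: "'a::euclidean_space set"
  assumes "combinatorial_cube C" shows "polytope C" "0 \<le> aff_dim C"
proof -
  show pC: "polytope C" using assms unfolding combinatorial_cube_def by blast
  obtain B f where B: "B \<subseteq> (Basis :: 'a set)" and f: "face_lattice_iso f C (cbox 0 (\<Sum>B))"
    using assms unfolding combinatorial_cube_def combinatorially_equivalent_def by blast
  show "0 \<le> aff_dim C" using iso_dim_top[OF pC polytope_interval f] aff_dim_unit_box[OF B] by simp
qed

text \<open>
  The case \<open>P = Q\<close> occurs when the cube is a facet of \<open>Q\<close>.
\<close>

lemma capped_over_step:
  assumes "capped_over P Q"
  shows "aff_dim P = aff_dim Q" and "3 \<le> aff_dim P \<Longrightarrow> polytope_system Q \<Longrightarrow> polytope_system P"
proof -
  obtain C where cub: "cubical_polytope P" "cubical_polytope Q" and C: "combinatorial_cube C"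
    and PQC: "P = Q \<union> C" and F: "(Q \<inter> C) facet_of Q"
    using assms unfolding capped_over_def by blast
  have poly: "polytope P" "polytope Q" "polytope C"
    using cub combinatorial_cube_dim(1)[OF C] unfolding cubical_polytope_def by auto
  have "aff_dim P = aff_dim Q \<and> (3 \<le> aff_dim P \<longrightarrow> polytope_system Q \<longrightarrow> polytope_system P)"
  proof (cases "P = Q")
    case False
    obtain a b q c where h: "Q = P \<inter> {x. a \<bullet> x \<le> b}" "C = P \<inter> {x. b \<le> a \<bullet> x}" "Q \<inter> C = P \<inter> {x. a \<bullet> x = b}"
      "q \<in> P" "a \<bullet> q < b" "c \<in> P" "b < a \<bullet> c"
      using union_along_facet_is_cut[OF poly PQC F False] by blast
    have cut: "cut P Q C (Q \<inter> C) a b q c" by (rule cut.intro) (fact poly(1) h)+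
    have "cap_cut P Q C (Q \<inter> C) a b q c" if "3 \<le> aff_dim P"
      by (intro cap_cut.intro cut cap_cut_axioms.intro) (fact cub C that)+
    then show ?thesis using cut.dim_Q[OF cut] cap_cut.system_cap by fastforce
  qed simp
  then show "aff_dim P = aff_dim Q" "3 \<le> aff_dim P \<Longrightarrow> polytope_system Q \<Longrightarrow> polytope_system P" by blast+
qed

lemma capped_cubical_polytope_system:
  assumes "capped_cubical_polytope P"
  shows "polytope P" "0 \<le> aff_dim P" and "3 \<le> aff_dim P \<Longrightarrow> polytope_system P"
proof -
  obtain k p where p: "p k = P" "\<forall>i\<le>k. cubical_polytope (p i)" "combinatorial_cube (p 0)"
    "\<forall>i<k. capped_over (p (Suc i)) (p i)"
    using assms unfolding capped_cubical_polytope_def by blast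
  have ind: "i \<le> k \<Longrightarrow> 0 \<le> aff_dim (p i) \<and> (3 \<le> aff_dim (p i) \<longrightarrow> polytope_system (p i))" for i
  proof (induction i)
    case 0
    have "polytope_system (p 0)" if d: "3 \<le> aff_dim (p 0)"
    proof -
      have d2: "2 \<le> aff_dim (p 0)" using d by simp
      obtain \<alpha> where "cube_with \<alpha> (dual_nodes (p 0)) (dual_adjacent (p 0)) (vertex_stars (p 0))"
        using combinatorial_cube_with(1)[OF p(3) d2] by blast
      moreover have "6 \<le> card (dual_nodes (p 0))" using combinatorial_cube_with(2)[OF p(3) d2] d by linarith
      ultimately show ?thesis unfolding polytope_system_def by (rule capped_system.cube)
    qed
    then show ?case using combinatorial_cube_dim(2)[OF p(3)] by blast
  next
    case (Suc i)
    then have "capped_over (p (Suc i)) (p i)" using p(4) by simp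
    from capped_over_step[OF this] Suc show ?case by simp
  qed
  show "polytope P" using p(1,2) unfolding cubical_polytope_def by blast
  show "0 \<le> aff_dim P" "3 \<le> aff_dim P \<Longrightarrow> polytope_system P" using ind[of k] p(1) by auto
qed

lemma facets_of_segment:
  fixes S :: "'a::euclidean_space set"
  assumes S: "polytope S" and d: "aff_dim S = 1"
  shows "dual_nodes S = (\<lambda>v. {v}) ` {v. v extreme_point_of S}" "card (dual_nodes S) = 2"
proof -
  have "X facet_of S \<longleftrightarrow> (\<exists>v. v extreme_point_of S \<and> X = {v})" for X
  proof
    assume X: "X facet_of S"
    then have "aff_dim X = 0" using d unfolding facet_of_def by simp
    then obtain v where "X = {v}" using aff_dim_eq_0 by blast
    then show "\<exists>v. v extreme_point_of S \<and> X = {v}" using facet_of_imp_face_of[OF X] face_of_singleton by blast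
  next
    assume "\<exists>v. v extreme_point_of S \<and> X = {v}"
    then show "X facet_of S" unfolding facet_of_def using face_of_singleton d by fastforce
  qed
  then show nodes: "dual_nodes S = (\<lambda>v. {v}) ` {v. v extreme_point_of S}" unfolding dual_nodes_def by blast
  have "collinear S" using d by (simp add: collinear_aff_dim)
  moreover have "S \<noteq> {}" using d by auto
  ultimately obtain a b where ab: "S = closed_segment a b"
    using compact_convex_collinear_segment[OF _ polytope_imp_compact[OF S] polytope_imp_convex[OF S]] by metis
  have "a \<noteq> b" using ab d by auto
  have "{v. v extreme_point_of S} = {a, b}" unfolding ab using extreme_point_of_segment by blast
  then have "dual_nodes S = {{a}, {b}}" unfolding nodes by simp
  then show "card (dual_nodes S) = 2" using \<open>a \<noteq> b\<close> by simp
qed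

lemma vertex_stars_1:
  fixes P :: "'a::euclidean_space set"
  assumes P: "polytope P" and d: "aff_dim P = 1"
  shows "vertex_stars P = (\<lambda>F. {F}) ` dual_nodes P"
proof -
  have "vertex_star P v = {{v}}" if v: "v extreme_point_of P" for v
  proof -
    have f: "G facet_of P \<longleftrightarrow> (\<exists>u. u extreme_point_of P \<and> G = {u})" for G
      using facets_of_segment(1)[OF P d] unfolding dual_nodes_def by blast
    show ?thesis unfolding vertex_star_def f using v by blast
  qed
  then show ?thesis unfolding vertex_stars_def facets_of_segment(1)[OF P d] by (auto simp: image_image)
qed

lemma degree_1:
  fixes P :: "'a::euclidean_space set"
  assumes P: "polytope P" and d: "aff_dim P = 1" and F: "F facet_of P"
  shows "card (nb (dual_adjacent P) F) = 1"
proof -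
  have "dual_adjacent P F G \<longleftrightarrow> G \<in> dual_nodes P - {F}" for G
  proof (cases "G \<in> dual_nodes P \<and> G \<noteq> F")
    case True
    have point: "\<exists>u. X = {u}" if "X \<in> dual_nodes P" for X
      using that unfolding facets_of_segment(1)[OF P d] by blast
    have "F \<in> dual_nodes P" using F unfolding dual_nodes_def by blast
    then obtain u v where "F = {u}" "G = {v}" using point True by metis
    then have "F \<inter> G = {}" using True by auto
    then have "aff_dim (F \<inter> G) = aff_dim P - 2" using d by simp
    then show ?thesis using dual_adjacent_dim[OF F, of G] True unfolding dual_nodes_def by simp
  next
    case False
    then show ?thesis using dual_adjacent_neq dual_adjacent_nodes by blast
  qed
  then have "nb (dual_adjacent P) F = dual_nodes P - {F}" unfolding nb_def by blast
  then show ?thesis using facets_of_segment(2)[OF P d] F unfolding dual_nodes_def by simp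
qed

lemma degree_2:
  fixes P :: "'a::euclidean_space set"
  assumes P: "polytope P" and d: "aff_dim P = 2" and F: "F facet_of P"
  shows "card (nb (dual_adjacent P) F) = 2"
proof -
  have "aff_dim F = 1" using F d unfolding facet_of_def by simp
  then have "card (dual_nodes F) = 2" using facets_of_segment(2) facet_polytope[OF P F] by blast
  moreover have "2 \<le> aff_dim P" using d by simp
  ultimately show ?thesis using bij_betw_same_card[OF neighbours_facets[OF P _ F]] by simp
qed

lemma vertex_stars_2:
  fixes P :: "'a::euclidean_space set"
  assumes P: "polytope P" and d: "aff_dim P = 2"
  shows "vertex_stars P = {{F, G} | F G. dual_adjacent P F G}"
proof -
  have d2: "2 \<le> aff_dim P" using d by simp
  have star: "vertex_star P v = {F, G}"
    if a: "dual_adjacent P F G" and v: "F \<inter> G = {v}" for F G v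
  proof -
    have FG: "F facet_of P" "G facet_of P" "F \<noteq> G"
      using dual_adjacent_nodes[OF a] dual_adjacent_neq[OF a] unfolding dual_nodes_def by auto
    have R: "(F \<inter> G) facet_of F" using dual_adjacent_facet[OF d2 FG(1,2)] a by blast
    obtain H where H: "\<And>K. K facet_of P \<Longrightarrow> F \<inter> G \<subseteq> K \<Longrightarrow> K = F \<or> K = H"
      using ridge_other_facet[OF P FG(1) R] by metis
    have "G = H" using H[OF FG(2)] FG(3) by blast
    then have only: "K = F \<or> K = G" if "K facet_of P" "v \<in> K" for K
      using H[OF that(1)] that(2) unfolding v by simp
    have "v \<in> F" "v \<in> G" using v by blast+
    then show ?thesis unfolding vertex_star_def using FG(1,2) only by auto
  qed
  show ?thesis
  proof (intro equalityI subsetI)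
    fix S assume "S \<in> vertex_stars P"
    then obtain v where v: "v extreme_point_of P" "S = vertex_star P v" unfolding vertex_stars_def by blast
    have fv: "{v} face_of P" using v face_of_singleton by blast
    have "{v} \<noteq> P" using d by (metis aff_dim_sing zero_neq_numeral)
    then obtain F where F: "F facet_of P" "v \<in> F"
      using face_of_polyhedron_subset_facet[OF polytope_imp_polyhedron[OF P] fv insert_not_empty] by blast
    obtain G where G: "G facet_of P" "G \<noteq> F" "v \<in> G" using vertex_in_two_facets[OF P d2 v(1) F(1)] by blast
    have FG: "F \<inter> G face_of F"
      using face_of_Int[OF facet_of_imp_face_of[OF F(1)] facet_of_imp_face_of[OF G(1)]]
        face_of_face[OF facet_of_imp_face_of[OF F(1)]] by blast
    moreover have "F \<inter> G \<noteq> F" using facet_eq_of_subset[OF F(1) G(1)] G(2) by blast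
    ultimately have "aff_dim (F \<inter> G) < 1"
      using face_of_aff_dim_lt[of F "F \<inter> G"] face_of_imp_convex[OF facet_of_imp_face_of[OF F(1)]] F(1) d
      unfolding facet_of_def by simp
    moreover have "aff_dim {v} \<le> aff_dim (F \<inter> G)" using F(2) G(3) by (intro aff_dim_subset) blast
    ultimately have dim: "aff_dim (F \<inter> G) = 0" by simp
    then have FGv: "F \<inter> G = {v}" using F(2) G(3) aff_dim_eq_0 by (metis IntI singletonD)
    have a: "dual_adjacent P F G" using dual_adjacent_dim[OF F(1) G(1)] dim d by simp
    have "S = {F, G}" using star[OF a FGv] v(2) by simp
    then show "S \<in> {{F, G} | F G. dual_adjacent P F G}" using a by blast
  next
    fix S assume "S \<in> {{F, G} | F G. dual_adjacent P F G}"
    then obtain F G where a: "dual_adjacent P F G" and S: "S = {F, G}" by blast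
    have R: "F \<inter> G face_of P" "aff_dim (F \<inter> G) = 0" using a d unfolding dual_adjacent_def ridge_of_def by auto
    then obtain v where v: "F \<inter> G = {v}" using aff_dim_eq_0 by blast
    then have "v extreme_point_of P" using R(1) face_of_singleton by metis
    moreover have "S = vertex_star P v" using star[OF a v] S by simp
    ultimately show "S \<in> vertex_stars P" unfolding vertex_stars_def by blast
  qed
qed

lemma capped_system_degree:
  assumes "capped_system N E V" shows "\<exists>f\<in>N. 4 \<le> card (nb E f)"
  using assms
proof cases
  case (cube \<alpha>)
  then obtain f where f: "f \<in> N" by fastforce
  have "4 \<le> card (nb E f)" using cube_nb_card[OF cube(1) f] cube(2) by linarith
  then show ?thesis using f by (rule bexI[where x = f])
next
  case (cap f)
  show ?thesis using cap_node_card[OF \<open>cap_node E f\<close>] \<open>f \<in> N\<close> by (rule bexI[where x = f])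
qed

lemma degree_dual_graph_iso:
  assumes iso: "dual_graph_iso \<phi> P P'" and F: "F \<in> dual_nodes P"
  shows "card (nb (dual_adjacent P') (\<phi> F)) = card (nb (dual_adjacent P) F)"
proof -
  have bij: "bij_betw \<phi> (dual_nodes P) (dual_nodes P')"
    and adj: "\<And>F G. F \<in> dual_nodes P \<Longrightarrow> G \<in> dual_nodes P \<Longrightarrow> dual_adjacent P F G \<longleftrightarrow> dual_adjacent P' (\<phi> F) (\<phi> G)"
    using iso unfolding dual_graph_iso_def by auto
  have sub: "nb (dual_adjacent P) F \<subseteq> dual_nodes P" unfolding nb_def using dual_adjacent_nodes by blast
  have "nb (dual_adjacent P') (\<phi> F) = \<phi> ` nb (dual_adjacent P) F"
  proof (intro equalityI subsetI)
    fix G' assume "G' \<in> nb (dual_adjacent P') (\<phi> F)"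
    then have a: "dual_adjacent P' (\<phi> F) G'" by simp
    then have "G' \<in> \<phi> ` dual_nodes P" using dual_adjacent_nodes[OF a] bij unfolding bij_betw_def by blast
    then obtain G where G: "G \<in> dual_nodes P" "G' = \<phi> G" by blast
    then have "dual_adjacent P F G" using adj[OF F G(1)] a by simp
    then show "G' \<in> \<phi> ` nb (dual_adjacent P) F" using G(2) by simp
  next
    fix G' assume "G' \<in> \<phi> ` nb (dual_adjacent P) F"
    then obtain G where G: "dual_adjacent P F G" "G' = \<phi> G" by auto
    then show "G' \<in> nb (dual_adjacent P') (\<phi> F)" using adj[OF F] dual_adjacent_nodes[OF G(1)] by simp
  qed
  moreover have "inj_on \<phi> (nb (dual_adjacent P) F)"
    using bij sub inj_on_subset unfolding bij_betw_def by blast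
  ultimately show ?thesis by (simp add: card_image)
qed

lemma dual_nodes_empty_iff:
  fixes P :: "'a::euclidean_space set"
  assumes P: "polytope P" and d: "0 \<le> aff_dim P"
  shows "dual_nodes P = {} \<longleftrightarrow> aff_dim P = 0"
proof
  assume n: "dual_nodes P = {}"
  show "aff_dim P = 0"
  proof (rule ccontr)
    assume "aff_dim P \<noteq> 0"
    then have "0 < aff_dim P" using d by simp
    then obtain F where "F facet_of P" using polytope_facet_exists[OF P] by blast
    then show False using n unfolding dual_nodes_def by blast
  qed
next
  assume "aff_dim P = 0"
  then have "\<not> F facet_of P" for F unfolding facet_of_def by (metis aff_dim_empty aff_dim_eq_0 diff_0 face_of_imp_subset subset_singletonD aff_dim_sing zero_neq_neg_one)
  then show "dual_nodes P = {}" unfolding dual_nodes_def by blast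
qed

lemma degrees_by_dim:
  fixes R :: "'a::euclidean_space set"
  defines "E \<equiv> (\<lambda>F. card (nb (dual_adjacent R) F)) ` dual_nodes R"
  assumes R: "polytope R" "0 \<le> aff_dim R" "3 \<le> aff_dim R \<Longrightarrow> polytope_system R"
  shows "(aff_dim R = 0 \<longrightarrow> E = {}) \<and> (aff_dim R = 1 \<longrightarrow> E = {1}) \<and> (aff_dim R = 2 \<longrightarrow> E = {2}) \<and>
      (3 \<le> aff_dim R \<longrightarrow> (\<exists>n\<in>E. 4 \<le> n))"
proof (intro conjI impI)
  have const: "E = {n}" if pos: "0 < aff_dim R" and deg: "\<And>F. F facet_of R \<Longrightarrow> card (nb (dual_adjacent R) F) = n" for n
  proof -
    obtain F where "F facet_of R" using polytope_facet_exists[OF R(1) pos] by blast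
    then show ?thesis using deg unfolding E_def dual_nodes_def by force
  qed
  show "E = {}" if "aff_dim R = 0" using dual_nodes_empty_iff[OF R(1,2)] that unfolding E_def by simp
  show "E = {1}" if "aff_dim R = 1" using const[of 1] degree_1[OF R(1) that] that by simp
  show "E = {2}" if "aff_dim R = 2" using const[of 2] degree_2[OF R(1) that] that by simp
  show "\<exists>n\<in>E. 4 \<le> n" if d: "3 \<le> aff_dim R"
  proof -
    obtain F where "F \<in> dual_nodes R" "4 \<le> card (nb (dual_adjacent R) F)"
      using capped_system_degree[OF R(3)[OF d, unfolded polytope_system_def]] by metis
    then show ?thesis unfolding E_def by blast
  qed
qed

lemma face_of_point_iff: "F face_of {y} \<longleftrightarrow> F = {} \<or> F = {y}"
  using face_of_imp_subset[of F "{y}"] face_of_refl[of "{y}"] by auto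

text \<open>
  All degrees are 1 in dimension 1 and 2 in dimension 2, and some degree is at least 4 from dimension 3 on,
  where the uniqueness of the stars applies in all dimensions at once.
\<close>

lemma dual_graph_iso_dim:
  fixes P :: "'a::euclidean_space set" and P' :: "'b::euclidean_space set"
  assumes P: "capped_cubical_polytope P" and P': "capped_cubical_polytope P'" and iso: "dual_graph_iso \<phi> P P'"
  shows "min 3 (aff_dim P) = min 3 (aff_dim P')"
proof -
  note cP = capped_cubical_polytope_system[OF P] and cP' = capped_cubical_polytope_system[OF P']
  have bij: "bij_betw \<phi> (dual_nodes P) (dual_nodes P')" using iso unfolding dual_graph_iso_def by blast
  then have im: "\<phi> ` dual_nodes P = dual_nodes P'" unfolding bij_betw_def by blast
  define D where "D = (\<lambda>F. card (nb (dual_adjacent P) F)) ` dual_nodes P"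
  have D': "D = (\<lambda>F. card (nb (dual_adjacent P') F)) ` dual_nodes P'"
    unfolding im[symmetric] D_def image_image using degree_dual_graph_iso[OF iso] by (intro image_cong) auto
  have cases: "r = 0 \<or> r = 1 \<or> r = 2 \<or> 3 \<le> r" if "0 \<le> r" for r :: int using that by linarith
  show ?thesis
    using degrees_by_dim[OF cP, folded D_def] degrees_by_dim[OF cP', folded D'] cases[OF cP(2)] cases[OF cP'(2)] by (elim disjE) auto
qed

lemma face_lattice_iso_points:
  assumes x: "P = {x}" "P' = {x'}"
  shows "face_lattice_iso (\<lambda>F. if F = {} then {} else {x'}) P P'"
proof -
  have f: "{F. F face_of P} = {{}, {x}}" "{F. F face_of P'} = {{}, {x'}}"
    unfolding x face_of_point_iff by auto
  show ?thesis
    unfolding face_lattice_iso_def f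
  proof (intro conjI allI impI)
    show "bij_betw (\<lambda>F. if F = {} then {} else {x'}) {{}, {x}} {{}, {x'}}" unfolding bij_betw_def by auto
    fix F G assume "F face_of P" "G face_of P"
    then have "F \<in> {{}, {x}}" "G \<in> {{}, {x}}" using f(1) by blast+
    then show "F \<subseteq> G \<longleftrightarrow> (if F = {} then {} else {x'}) \<subseteq> (if G = {} then {} else {x'})" by auto
  qed
qed

text \<open>
  In dimension at least 3 both the stars of \<open>P'\<close> and the images of the stars of \<open>P\<close> form a capped system on
  the dual graph of \<open>P'\<close>, so they agree.
\<close>

lemma dual_graph_iso_vertex_stars:
  fixes P :: "'a::euclidean_space set" and P' :: "'b::euclidean_space set"
  assumes cap: "capped_cubical_polytope P" "capped_cubical_polytope P'"
    and iso: "dual_graph_iso \<phi> P P'" and d: "1 \<le> aff_dim P"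
  shows "vertex_stars P' = (`) \<phi> ` vertex_stars P"
proof -
  note P = capped_cubical_polytope_system[OF cap(1)] and P' = capped_cubical_polytope_system[OF cap(2)]
  note dims = dual_graph_iso_dim[OF cap iso]
  have bij: "bij_betw \<phi> (dual_nodes P) (dual_nodes P')"
    and adj: "\<And>F G. F \<in> dual_nodes P \<Longrightarrow> G \<in> dual_nodes P \<Longrightarrow> dual_adjacent P F G \<longleftrightarrow> dual_adjacent P' (\<phi> F) (\<phi> G)"
    using iso unfolding dual_graph_iso_def by auto
  have im: "\<phi> ` dual_nodes P = dual_nodes P'" using bij unfolding bij_betw_def by blast
  consider "aff_dim P = 1" | "aff_dim P = 2" | "3 \<le> aff_dim P" using d by linarith
  then show ?thesis
  proof cases
    case 1
    then have one': "aff_dim P' = 1" using dims by simp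
    show ?thesis unfolding vertex_stars_1[OF P(1) 1] vertex_stars_1[OF P'(1) one'] im[symmetric]
      by (simp add: image_image)
  next
    case 2
    then have two': "aff_dim P' = 2" using dims by simp
    show ?thesis unfolding vertex_stars_2[OF P(1) 2] vertex_stars_2[OF P'(1) two']
    proof (intro equalityI subsetI)
      fix S' assume "S' \<in> {{F, G} | F G. dual_adjacent P' F G}"
      then obtain F' G' where S': "S' = {F', G'}" and a: "dual_adjacent P' F' G'" by blast
      have "F' \<in> \<phi> ` dual_nodes P" "G' \<in> \<phi> ` dual_nodes P" using dual_adjacent_nodes[OF a] im by simp_all
      then obtain F G where FG: "F \<in> dual_nodes P" "G \<in> dual_nodes P" "F' = \<phi> F" "G' = \<phi> G" by auto
      then have "dual_adjacent P F G" using adj[OF FG(1,2)] a by simp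
      then show "S' \<in> (`) \<phi> ` {{F, G} | F G. dual_adjacent P F G}"
        unfolding S' FG(3,4) by (intro image_eqI[of _ _ "{F, G}"]) auto
    next
      fix S' assume "S' \<in> (`) \<phi> ` {{F, G} | F G. dual_adjacent P F G}"
      then obtain F G where S': "S' = {\<phi> F, \<phi> G}" and a: "dual_adjacent P F G" by auto
      have "dual_adjacent P' (\<phi> F) (\<phi> G)" using adj[of F G] dual_adjacent_nodes[OF a] a by simp
      then show "S' \<in> {{F, G} | F G. dual_adjacent P' F G}" unfolding S' by blast
    qed
  next
    case 3
    then have three': "3 \<le> aff_dim P'" using dims by linarith
    have "capped_system (dual_nodes P') (dual_adjacent P') ((`) \<phi> ` vertex_stars P)"
      by (rule capped_system_image[OF P(3)[OF 3, unfolded polytope_system_def] bij adj _ refl])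
        (use dual_adjacent_nodes in blast)+
    then show ?thesis
      using capped_system_unique P'(3)[OF three'] unfolding polytope_system_def by blast
  qed
qed

text \<open>A point has no facets, so it has no stars either and is treated by hand.\<close>

lemma dual_graph_iso_induces_face_lattice_iso:
  fixes P :: "'a::euclidean_space set" and P' :: "'b::euclidean_space set"
  assumes cap: "capped_cubical_polytope P" "capped_cubical_polytope P'"
    and iso: "dual_graph_iso \<phi> P P'"
  shows "\<exists>\<Phi>. face_lattice_iso \<Phi> P P' \<and> (\<forall>F\<in>dual_nodes P. \<Phi> F = \<phi> F)"
proof -
  note P = capped_cubical_polytope_system[OF cap(1)] and P' = capped_cubical_polytope_system[OF cap(2)]
  note dims = dual_graph_iso_dim[OF cap iso]
  show ?thesis
  proof (cases "aff_dim P = 0")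
    case True
    then have "aff_dim P' = 0" using dims by simp
    then obtain x x' where "P = {x}" "P' = {x'}" using True aff_dim_eq_0 by metis
    then have "face_lattice_iso (\<lambda>F. if F = {} then {} else {x'}) P P'" by (rule face_lattice_iso_points)
    moreover have "dual_nodes P = {}" using dual_nodes_empty_iff[OF P(1,2)] True by simp
    ultimately show ?thesis by blast
  next
    case False
    then have d: "1 \<le> aff_dim P" "1 \<le> aff_dim P'" using P(2) dims by auto
    have "bij_betw \<phi> (dual_nodes P) (dual_nodes P')" using iso unfolding dual_graph_iso_def by blast
    then show ?thesis
      using face_lattice_iso_of_stars[OF P(1) P'(1) d] dual_graph_iso_vertex_stars[OF cap iso d(1)] by blast
  qed
qed

theorem theorem3p7:
  fixes P :: "'a::euclidean_space set" and P' :: "'b::euclidean_space set"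
    and \<phi> :: "'a set \<Rightarrow> 'b set"
  assumes "capped_cubical_polytope P" and "capped_cubical_polytope P'"
    and "dual_graph_iso \<phi> P P'"
  shows "(\<exists>\<Phi>. face_lattice_iso \<Phi> P P' \<and> (\<forall>F\<in>dual_nodes P. \<Phi> F = \<phi> F))
    \<and> combinatorially_equivalent P P'"
  using dual_graph_iso_induces_face_lattice_iso[OF assms] unfolding combinatorially_equivalent_def by blast

end
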